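(* For $|q|<1$, the following four identities hold: $$\sum_{n_1,n_2,n_3\geq0}\frac{q^{4n_1^2+4n_1n_2+3n_2^2-2n_2n_3+n_3^2}}{(q^4;q^4)_{n_1}(q^4;q^4)_{n_2}(q^4;q^4)_{n_3}}=\frac{(q^6;q^6)_{\infty}(q^{12};q^{12})_{\infty}}{(q^3;q^3)_{\infty}(q^8;q^8)_{\infty}(q,q^{11};q^{12})_{\infty}},$$ $$\sum_{n_1,n_2,n_3\geq0}\frac{q^{4n_1^2+4n_1n_2+3n_2^2-2n_2n_3+n_3^2-2n_2+2n_3}}{(q^4;q^4)_{n_1}(q^4;q^4)_{n_2}(q^4;q^4)_{n_3}}=\frac{(q^{12};q^{12})_{\infty}}{(q^8;q^8)_{\infty}(q,q^{11};q^{12})_{\infty}(q^5,q^7;q^{12})_{\infty}},$$ $$\sum_{n_1,n_2,n_3\geq0}\frac{q^{4n_1^2+4n_1n_2+3n_2^2-2n_2n_3+n_3^2+2n_3}}{(q^4;q^4)_{n_1}(q^4;q^4)_{n_2}(q^4;q^4)_{n_3}}=\frac{(q^6;q^6)_{\infty}^5(q^8;q^8)_{\infty}}{(q^3;q^3)_{\infty}^2(q^4;q^4)_{\infty}^2(q^{12};q^{12})_{\infty}^2},$$ $$\sum_{n_1,n_2,n_3\geq0}\frac{q^{4n_1^2+4n_1n_2+3n_2^2-2n_2n_3+n_3^2+4n_1+2n_2+2n_3}}{(q^4;q^4)_{n_1}(q^4;q^4)_{n_2}(q^4;q^4)_{n_3}}=\frac{(q^6;q^6)_{\infty}(q^{1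2};q^{12})_{\infty}}{(q^3;q^3)_{\infty}(q^8;q^{8})_{\infty}(q^5,q^7;q^{12})_{\infty}}.$$
   Context: $(a;q)_n=\prod_{k=0}^{n-1}(1-aq^k)$, $(a;q)_\infty=\prod_{k=0}^\infty(1-aq^k)$ for $|q|<1$, and $(a_1,\dots,a_m;q)_\infty=(a_1;q)_\infty\cdots(a_m;q)_\infty$. The sums run over all nonnegative integers $n_1,n_2,n_3$. *)

theory Defs
  imports "HOL-Analysis.Analysis"
begin

definition qpoch :: "complex \<Rightarrow> complex \<Rightarrow> nat \<Rightarrow> complex"
  where "qpoch a q n = (\<Prod>k<n. 1 - a * q ^ k)"

definition qpoch_inf :: "complex \<Rightarrow> complex \<Rightarrow> complex"
  where "qpoch_inf a q = (\<Prod>k. 1 - a * q ^ k)"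

definition qpochs_inf :: "complex list \<Rightarrow> complex \<Rightarrow> complex"
  where "qpochs_inf as q = (\<Prod>a\<leftarrow>as. qpoch_inf a q)"

text \<open>The library's infinite product is a definite description, so it is meaningful only
  for convergent products; for \<open>norm q < 1\<close> this is always the case.\<close>

lemma has_prod_qpoch_inf:
  assumes "norm q < 1"
  shows "(\<lambda>k. 1 - a * q ^ k) has_prod qpoch_inf a q"
proof -
  have "summable (\<lambda>k. norm a * norm q ^ k)"
    using assms by (intro summable_mult summable_geometric) auto
  hence "summable (\<lambda>k. norm ((1 - a * q ^ k) - 1))"
    by (simp add: norm_mult norm_power)
  hence "abs_convergent_prod (\<lambda>k. 1 - a * q ^ k)"
    by (rule summable_imp_abs_convergent_prod)
  hence "convergent_prod (\<lambda>k. 1 - a * q ^ k)"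
    by (rule abs_convergent_prod_imp_convergent_prod)
  thus ?thesis
    unfolding qpoch_inf_def by (rule convergent_prod_has_prod)
qed

text \<open>The exponents are integers because of the term \<open>- 2 * n2 * n3\<close>.  They are nonnegative in
  all four series, since the quadratic form equals \<open>(2*n1 + n2)^2 + (n2 - n3)^2 + n2^2\<close> and
  \<open>(n2 - n3)^2 + n2^2 - 2*n2 + 2*n3 = (n2 - n3 - 1)^2 + n2^2 - 1\<close> is nonnegative for natural
  \<open>n2\<close> and \<open>n3\<close>.  So no negative power of \<open>q\<close> occurs, and \<open>q = 0\<close> needs no exclusion.\<close>

definition quad_form :: "nat \<Rightarrow> nat \<Rightarrow> nat \<Rightarrow> int"
  where "quad_form n1 n2 n3 =
    4 * int n1 ^ 2 + 4 * int n1 * int n2 + 3 * int n2 ^ 2 - 2 * int n2 * int n3 + int n3 ^ 2"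

definition summand :: "complex \<Rightarrow> int \<Rightarrow> nat \<Rightarrow> nat \<Rightarrow> nat \<Rightarrow> complex"
  where "summand q e n1 n2 n3 =
    q powi e / (qpoch (q ^ 4) (q ^ 4) n1 * qpoch (q ^ 4) (q ^ 4) n2 * qpoch (q ^ 4) (q ^ 4) n3)"

end

theory Submission
  imports Defs
begin

text \<open>Put \<open>p = q^4\<close> and \<open>\<phi>(x) = (\<Sum>n\<in>\<int>. x^(n^2))\<close>. The quadratic form is
\<open>(2 n\<^sub>1 + n\<^sub>2)^2 + n\<^sub>2^2 + (n\<^sub>3 - n\<^sub>2)^2\<close>, so the summation over \<open>n\<^sub>1\<close> would produce a theta series if it ran
over all integers. It can be made to: \<open>1/(p;p)\<^sub>m = (p^(m+1);p)\<^sub>\<infinity> / (p;p)\<^sub>\<infinity>\<close> vanishes for negative \<open>m\<close>, and when the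
numerator is expanded by Euler's theorem with a new index \<open>r\<close>, the square can be completed. The sum over
\<open>n\<^sub>1\<close> is then a theta series over one residue class modulo 2, that is, half of \<open>\<phi>(q) \<plusminus> \<phi>(-q)\<close>
(\<open>nahm_sum_reduction\<close>). What remains is a sum over \<open>r, n\<^sub>2, n\<^sub>3\<close> in which \<open>n\<^sub>2\<close> is summed by Euler's
theorem and \<open>r + n\<^sub>3 = l\<close> by the finite q-binomial theorem (\<open>reduced_sum_single_series\<close>). One of the
two resulting products has a zero factor for every second \<open>l\<close> (apart from \<open>l = 0\<close> in one case), and the surviving terms form basic
hypergeometric series \<open>\<^sub>2\<phi>\<^sub>1(a, 0; c; p, z)\<close>.

These series are summable. A limiting case of Heine's transformation (\<open>heine_has_sum\<close>) turns them into
\<open>\<Sum>\<^sub>n p^(n^2 + s n) (-x;p)\<^bsub>n+s\<^esub> (-p/x;p)\<^sub>n / (p;p)\<^bsub>2n+s\<^esub>\<close> with \<open>s \<le> 1\<close>, and the finite Jacobi triple product together with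
Cauchy's identity evaluates this as a theta series (\<open>bailey_has_sum\<close>, the simplest instance of Bailey's lemma).
Each of the four sums has thus become \<open>\<phi>(q) A + \<phi>(-q) B\<close>, where \<open>A\<close> and \<open>B\<close> are products of a theta series and
infinite products, with one more infinite product added to \<open>A\<close> in the first and the fourth case. The two terms collapse into one because \<open>m^2 + 3 n^2\<close> is the norm form of the
Eisenstein integers: the substitution \<open>m = n + 2 v\<close> in a product of two theta series rotates the lattice, and it expresses
the theta series in \<open>A\<close> and \<open>B\<close> by \<open>\<phi>(\<plusminus>q) \<phi>(\<plusminus>q^3)\<close>, or by \<open>\<phi>(\<plusminus>q) C(\<plusminus>q)\<close> with
\<open>C(q) = (\<Sum>n\<in>\<int>. q^(3n^2 - 2n))\<close>. If \<open>S\<^sub>1, \<dots>, S\<^sub>4\<close> are the four sums, the outcome is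

  \<open>S\<^sub>1 = (-q^2;q^4)\<^sub>\<infinity> / (2 (q^4;q^4)\<^sub>\<infinity>) (\<phi>(q) + \<phi>(q^3))\<close>,
  \<open>q S\<^sub>4 = (-q^2;q^4)\<^sub>\<infinity> / (2 (q^4;q^4)\<^sub>\<infinity>) (\<phi>(q) - \<phi>(q^3))\<close>,

  \<open>S\<^sub>2 = (-q^2;q^4)\<^sub>\<infinity> / (q^4;q^4)\<^sub>\<infinity> C(q)\<close>,
  \<open>S\<^sub>3 = (-q^4;q^4)\<^sub>\<infinity> / (q^4;q^4)\<^sub>\<infinity> \<phi>(q^3)\<close>,

and the Jacobi triple product converts these into the stated products; for \<open>S\<^sub>1\<close> and \<open>S\<^sub>4\<close> it is applied
after splitting the pentagonal number series by the parity of its index. Negative powers of \<open>q\<close> are used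
freely, so \<open>q = 0\<close> is treated apart: only the term with all indices zero survives.\<close>

section \<open>q-shifted factorials\<close>

lemma qpoch_0 [simp]: "qpoch a q 0 = 1"
  by (simp add: qpoch_def)

lemma qpoch_Suc: "qpoch a q (Suc n) = qpoch a q n * (1 - a * q^n)"
  by (simp add: qpoch_def)

lemma qpoch_Suc_left: "qpoch a q (Suc n) = (1 - a) * qpoch (a * q) q n"
  unfolding qpoch_def by (subst prod.lessThan_Suc_shift) (simp add: mult_ac)

lemma qpoch_add: "qpoch a q (m + n) = qpoch a q m * qpoch (a * q^m) q n"
  by (induction n) (simp_all add: qpoch_Suc power_add mult_ac)

lemma qpoch_tendsto:
  assumes "norm q < 1"
  shows "(\<lambda>n. qpoch a q n) \<longlonglongrightarrow> qpoch_inf a q"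
  unfolding qpoch_def using has_prod_imp_tendsto'[OF has_prod_qpoch_inf[OF assms]] .

lemma qpoch_inf_split:
  assumes "norm q < 1"
  shows "qpoch_inf a q = qpoch a q n * qpoch_inf (a * q^n) q"
proof (rule LIMSEQ_unique)
  show "(\<lambda>m. qpoch a q (n + m)) \<longlonglongrightarrow> qpoch_inf a q"
    using LIMSEQ_ignore_initial_segment[OF qpoch_tendsto[OF assms], of a n] by (simp add: add.commute)
  show "(\<lambda>m. qpoch a q (n + m)) \<longlonglongrightarrow> qpoch a q n * qpoch_inf (a * q^n) q"
    unfolding qpoch_add by (intro tendsto_mult tendsto_const qpoch_tendsto assms)
qed

lemma qpoch_inf_0 [simp]: "qpoch_inf 0 q = 1"
  by (simp add: qpoch_inf_def)

lemma qpoch_inf_eq_0_iff: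
  assumes "norm q < 1"
  shows "qpoch_inf a q = 0 \<longleftrightarrow> (\<exists>k. a * q^k = 1)"
proof -
  have "0 \<in> range (\<lambda>k. 1 - a * q^k) \<longleftrightarrow> (\<exists>k. a * q^k = 1)"
    by (metis (no_types, lifting) UNIV_I eq_iff_diff_eq_0 imageE image_eqI)
  thus ?thesis using has_prod_eq_0_iff[OF has_prod_qpoch_inf[OF assms, of a]] by simp
qed

lemma qpoch_inf_nonzero:
  assumes "norm q < 1" "norm a < 1"
  shows "qpoch_inf a q \<noteq> 0"
proof -
  have "norm (a * q^k) < 1" for k
  proof -
    have "norm (a * q^k) \<le> norm a * 1"
      unfolding norm_mult norm_power using assms by (intro mult_left_mono power_le_one) auto
    with assms show ?thesis by simp
  qed
  hence "a * q^k \<noteq> 1" for k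
    by (metis less_irrefl norm_one)
  thus ?thesis using qpoch_inf_eq_0_iff[OF assms(1)] by blast
qed

lemma qpoch_nonzero:
  assumes "norm q < 1" "qpoch_inf a q \<noteq> 0"
  shows "qpoch a q n \<noteq> 0"
  using qpoch_inf_split[OF assms(1), of a n] assms(2) by auto

lemma qpoch_qq_nonzero:
  assumes "norm q < 1"
  shows "qpoch q q n \<noteq> 0"
  using qpoch_nonzero qpoch_inf_nonzero assms by blast

text \<open>Convergence to a nonzero limit is all that the summability estimates below need to know about the denominators.\<close>

lemma inverse_qpoch_bounded:
  assumes "norm q < 1" "qpoch_inf a q \<noteq> 0"
  obtains C where "C > 0" "\<And>n. norm (1 / qpoch a q n) \<le> C"
proof -
  have "(\<lambda>n. 1 / qpoch a q n) \<longlonglongrightarrow> 1 / qpoch_inf a q"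
    using assms by (intro tendsto_intros qpoch_tendsto) auto
  hence "Bseq (\<lambda>n. 1 / qpoch a q n)"
    by (intro convergent_imp_Bseq convergentI)
  thus ?thesis using that by (auto simp: Bseq_def)
qed

lemma qpoch_bounded:
  assumes "norm q < 1"
  obtains C where "C > 0" "\<And>n. norm (qpoch a q n) \<le> C"
proof -
  have "Bseq (\<lambda>n. qpoch a q n)"
    using qpoch_tendsto[OF assms] by (intro convergent_imp_Bseq convergentI)
  thus ?thesis using that by (auto simp: Bseq_def)
qed

lemma qpoch_inf_dissect2:
  assumes "norm q < 1"
  shows "qpoch_inf a q = qpoch_inf a (q^2) * qpoch_inf (a * q) (q^2)"
proof (rule LIMSEQ_unique)
  have q2: "norm (q^2) < 1" using assms by (simp add: norm_power power_less_one_iff)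
  have eq: "qpoch a q (2 * n) = qpoch a (q^2) n * qpoch (a * q) (q^2) n" for n
    by (induction n) (simp_all add: qpoch_Suc power_mult mult_ac flip: power_Suc power_mult)
  show "(\<lambda>n. qpoch a q (2 * n)) \<longlonglongrightarrow> qpoch_inf a q"
    using LIMSEQ_subseq_LIMSEQ[OF qpoch_tendsto[OF assms, of a], of "\<lambda>n. 2 * n"]
    by (simp add: strict_mono_def o_def)
  show "(\<lambda>n. qpoch a q (2 * n)) \<longlonglongrightarrow> qpoch_inf a (q^2) * qpoch_inf (a * q) (q^2)"
    unfolding eq by (intro tendsto_mult qpoch_tendsto q2)
qed

lemma qpoch_inf_dissect3:
  assumes "norm q < 1"
  shows "qpoch_inf a q = qpoch_inf a (q^3) * qpoch_inf (a * q) (q^3) * qpoch_inf (a * q^2) (q^3)"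
proof (rule LIMSEQ_unique)
  have q2: "norm (q^3) < 1" using assms by (simp add: norm_power power_less_one_iff)
  have eq: "qpoch a q (3 * n) = qpoch a (q^3) n * qpoch (a * q) (q^3) n * qpoch (a * q^2) (q^3) n" for n
  proof (induction n)
    case (Suc n)
    have "3 * Suc n = Suc (Suc (Suc (3 * n)))" by simp
    hence "qpoch a q (3 * Suc n) = qpoch a q (3 * n) * (1 - a * q^(3*n)) * (1 - a * q^Suc (3*n))
        * (1 - a * q^Suc (Suc (3*n)))"
      by (simp only: qpoch_Suc mult.assoc)
    thus ?case unfolding Suc.IH qpoch_Suc
      by (simp add: power_mult power2_eq_square mult_ac flip: power_mult)
  qed simp
  show "(\<lambda>n. qpoch a q (3 * n)) \<longlonglongrightarrow> qpoch_inf a q"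
    using LIMSEQ_subseq_LIMSEQ[OF qpoch_tendsto[OF assms, of a], of "\<lambda>n. 3 * n"]
    by (simp add: strict_mono_def o_def)
  show "(\<lambda>n. qpoch a q (3 * n)) \<longlonglongrightarrow> qpoch_inf a (q^3) * qpoch_inf (a * q) (q^3) * qpoch_inf (a * q^2) (q^3)"
    unfolding eq by (intro tendsto_mult qpoch_tendsto q2)
qed

text \<open>The factors pair up as \<open>(1 - u)(1 + u) = 1 - u^2\<close>.\<close>

lemma qpoch_inf_pm:
  assumes "norm q < 1"
  shows "qpoch_inf a q * qpoch_inf (- a) q = qpoch_inf (a^2) (q^2)"
proof (rule LIMSEQ_unique)
  have q2: "norm (q^2) < 1" using assms by (simp add: norm_power power_less_one_iff)
  have eq: "qpoch a q n * qpoch (- a) q n = qpoch (a^2) (q^2) n" for n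
    by (induction n) (simp_all add: qpoch_Suc algebra_simps power2_eq_square power_mult_distrib)
  show "(\<lambda>n. qpoch a q n * qpoch (- a) q n) \<longlonglongrightarrow> qpoch_inf a q * qpoch_inf (- a) q"
    by (intro tendsto_mult qpoch_tendsto assms)
  show "(\<lambda>n. qpoch a q n * qpoch (- a) q n) \<longlonglongrightarrow> qpoch_inf (a^2) (q^2)"
    unfolding eq by (intro qpoch_tendsto q2)
qed

lemma choose_two_Suc: "Suc n choose 2 = (n choose 2) + n"
  by (simp add: numeral_2_eq_2)

lemma mult_pred_eq_choose: "n * (n - 1) = 2 * (n choose 2)"
proof (induction n)
  case (Suc n)
  have "Suc n * (Suc n - 1) = n * (n - 1) + 2 * n" by (cases n) auto
  thus ?case using Suc by (simp add: choose_two_Suc)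
qed simp

lemma two_choose_two: "2 * int (k choose 2) = int k * (int k - 1)"
  using mult_pred_eq_choose[of k] by (cases k) (auto simp: algebra_simps simp flip: of_nat_mult)

lemma choose_two_int: "int n * (int n - 1) div 2 = int (n choose 2)"
proof (cases n)
  case (Suc m)
  have "int n * (int n - 1) = int (n * (n - 1))" by (simp add: Suc algebra_simps)
  thus ?thesis by (simp only: choose_two zdiv_int of_nat_numeral)
qed (simp add: binomial_eq_0)

lemma choose_two_int_neg: "(- int n) * (- int n - 1) div 2 = int (n choose 2) + int n"
proof -
  have "(- int n) * (- int n - 1) = int (Suc n) * (int (Suc n) - 1)"
    by (simp add: algebra_simps)
  thus ?thesis by (simp only: choose_two_int choose_two_Suc of_nat_add)
qed

text \<open>Reading the factors \<open>1 - a p^(-j)\<close>, \<open>1 \<le> j \<le> e\<close>, as \<open>-a p^(-j) (1 - p^j / a)\<close>. This is how products with a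
base point that moves with the summation index are brought to standard form.\<close>

lemma qpoch_reflect:
  assumes "p \<noteq> 0" "a \<noteq> 0"
  shows "qpoch (a / p^e) p e * p^(Suc e choose 2) = (- a)^e * qpoch (p / a) p e"
proof (induction e)
  case (Suc e)
  have "a / p^Suc e * p = a / p^e" using assms by simp
  hence "qpoch (a / p^Suc e) p (Suc e) * p^(Suc (Suc e) choose 2)
    = (1 - a / p^Suc e) * p^Suc e * (qpoch (a / p^e) p e * p^(Suc e choose 2))"
    unfolding qpoch_Suc_left choose_two_Suc[of "Suc e"] power_add by simp
  also have "(1 - a / p^Suc e) * p^Suc e = (- a) * (1 - p / a * p^e)"
    using assms by (simp add: field_simps)
  finally show ?case unfolding Suc by (simp add: qpoch_Suc mult_ac)
qed (simp add: binomial_eq_0)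
section \<open>Rearranging double and bilateral series\<close>

lemma has_sum_product_complex:
  fixes f :: "'a \<Rightarrow> complex" and g :: "'b \<Rightarrow> complex"
  assumes "(f has_sum a) A" "(g has_sum b) B"
  shows "((\<lambda>(x, y). f x * g y) has_sum (a * b)) (A \<times> B)"
proof (rule has_sum_SigmaI)
  show "((\<lambda>y. case (x, y) of (x, y) \<Rightarrow> f x * g y) has_sum (f x * b)) B" for x
    using has_sum_cmult_right[OF assms(2)] by simp
  show "((\<lambda>x. f x * b) has_sum (a * b)) A"
    using has_sum_cmult_left[OF assms(1)] by simp
  have f: "(\<lambda>x. norm (f x)) summable_on A" and g: "(\<lambda>x. norm (g x)) summable_on B"
    using assms summable_on_iff_abs_summable_on_complex by (auto dest: has_sum_imp_summable)
  have "(\<lambda>(x, y). norm (f x) * norm (g y)) summable_on A \<times> B"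
  proof (rule summable_on_SigmaI)
    show "((\<lambda>y. case (x, y) of (x, y) \<Rightarrow> norm (f x) * norm (g y)) has_sum (norm (f x) * infsum (\<lambda>y. norm (g y)) B)) B" for x
      using has_sum_cmult_right[OF has_sum_infsum[OF g]] by simp
    show "(\<lambda>x. norm (f x) * infsum (\<lambda>y. norm (g y)) B) summable_on A"
      by (rule summable_on_cmult_left[OF f])
  qed auto
  hence "(\<lambda>z. norm ((\<lambda>(x, y). f x * g y) z)) summable_on A \<times> B"
    by (simp add: case_prod_unfold norm_mult)
  thus "(\<lambda>(x, y). f x * g y) summable_on A \<times> B"
    using summable_on_iff_abs_summable_on_complex by blast
qed

lemma summable_on_product_complex:
  fixes f :: "'a \<Rightarrow> complex" and g :: "'b \<Rightarrow> complex"
  assumes "f summable_on A" "g summable_on B"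
  shows "(\<lambda>(x, y). f x * g y) summable_on (A \<times> B)"
  using has_sum_product_complex[OF has_sum_infsum[OF assms(1)] has_sum_infsum[OF assms(2)]]
  by (rule has_sum_imp_summable)

lemma summable_on_bounded_factor:
  fixes f g :: "'a \<Rightarrow> complex"
  assumes "f summable_on A" "\<And>x. x \<in> A \<Longrightarrow> norm (g x) \<le> C * norm (f x)"
  shows "g summable_on A"
proof -
  have "(\<lambda>x. norm (f x)) summable_on A"
    using assms(1) summable_on_iff_abs_summable_on_complex by blast
  hence "(\<lambda>x. C * norm (f x)) summable_on A"
    by (rule summable_on_cmult_right)
  hence "(\<lambda>x. norm (g x)) summable_on A"
    by (rule summable_on_comparison_test) (use assms(2) in auto)
  thus ?thesis using summable_on_iff_abs_summable_on_complex by blast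
qed

lemma has_sum_antidiagonal:
  fixes f :: "nat \<times> nat \<Rightarrow> complex"
  assumes "(f has_sum S) UNIV"
  shows "((\<lambda>e. \<Sum>n\<le>e. f (n, e - n)) has_sum S) UNIV"
proof (rule has_sum_SigmaD)
  have "((\<lambda>(e, n). f (n, e - n)) has_sum S) (SIGMA e:UNIV. {..e}) \<longleftrightarrow> (f has_sum S) UNIV"
    by (rule has_sum_reindex_bij_witness[of _ "\<lambda>(n, j). (n + j, n)" "\<lambda>(e, n). (n, e - n)"]) auto
  thus "((\<lambda>(e, n). f (n, e - n)) has_sum S) (SIGMA e:UNIV. {..e})" using assms by simp
  show "((\<lambda>n. case (e, n) of (e, n) \<Rightarrow> f (n, e - n)) has_sum (\<Sum>n\<le>e. f (n, e - n))) {..e}" for e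
    by (simp add: has_sum_finiteI)
qed

lemma summable_on_int:
  fixes f :: "int \<Rightarrow> complex"
  assumes "(\<lambda>n. f (int n)) summable_on UNIV" "(\<lambda>n. f (- int n)) summable_on UNIV"
  shows "f summable_on UNIV"
proof -
  have "f summable_on range int"
    using assms(1) by (subst summable_on_reindex) (auto simp: o_def)
  moreover have "f summable_on range (\<lambda>n. - int n)"
    using assms(2) by (subst summable_on_reindex) (auto simp: o_def inj_on_def)
  ultimately have "f summable_on (range int \<union> range (\<lambda>n. - int n))"
    by (rule summable_on_union)
  also have "range int \<union> range (\<lambda>n. - int n) = UNIV"
    by (auto simp: image_iff) (metis int_cases2)
  finally show ?thesis .
qed

lemma summable_on_inj:
  fixes g :: "'b \<Rightarrow> complex"
  assumes "g summable_on UNIV" "inj h"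
  shows "(\<lambda>x. g (h x)) summable_on UNIV"
proof -
  have "g summable_on range h" using assms(1) by (rule summable_on_subset) auto
  thus ?thesis using assms(2) by (simp add: summable_on_reindex o_def)
qed

text \<open>Half of the sum of \<open>f\<close> and of its twist by the alternating character isolates one residue class modulo 2.\<close>

lemma has_sum_parity:
  fixes f :: "int \<Rightarrow> complex"
  assumes "(f has_sum A) UNIV" "((\<lambda>n. (-1) powi n * f n) has_sum B) UNIV"
  shows "((\<lambda>m. f (2 * m + j)) has_sum ((A + (-1) powi j * B) / 2)) UNIV"
proof -
  have "((\<lambda>n. (1/2) * (f n + (-1) powi j * ((-1) powi n * f n))) has_sum ((1/2) * (A + (-1) powi j * B))) UNIV"
    using assms by (intro has_sum_add has_sum_cmult_right)
  also have "?this \<longleftrightarrow> (f has_sum ((1/2) * (A + (-1) powi j * B))) (range (\<lambda>m. 2 * m + j))"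
  proof (rule has_sum_cong_neutral)
    fix n :: int assume "n \<in> UNIV - range (\<lambda>m. 2 * m + j)"
    hence "n \<noteq> 2 * m + j" for m by blast
    hence "\<not> 2 dvd n - j" unfolding dvd_def by (metis diff_add_cancel)
    hence "even j \<noteq> even n" by simp
    thus "(1/2) * (f n + (-1) powi j * ((-1) powi n * f n)) = 0"
      by (cases "even j") auto
  next
    fix n :: int assume "n \<in> UNIV \<inter> range (\<lambda>m. 2 * m + j)"
    hence "even j = even n" by auto
    thus "(1/2) * (f n + (-1) powi j * ((-1) powi n * f n)) = f n"
      by (cases "even j") auto
  qed auto
  also have "\<dots> \<longleftrightarrow> ?thesis"
    by (subst has_sum_reindex) (auto simp: inj_on_def o_def)
  finally show ?thesis .
qed

lemma has_sum_even_int: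
  fixes f :: "int \<Rightarrow> complex"
  assumes "\<And>v. odd v \<Longrightarrow> f v = 0"
  shows "(f has_sum S) UNIV \<longleftrightarrow> ((\<lambda>w. f (2 * w)) has_sum S) UNIV"
proof -
  have "(f has_sum S) UNIV \<longleftrightarrow> (f has_sum S) (range (\<lambda>w. 2 * w))"
  proof (rule has_sum_cong_neutral)
    fix n :: int assume "n \<in> UNIV - range (\<lambda>w. 2 * w)"
    hence "odd n" by (auto elim!: evenE)
    thus "f n = 0" by (rule assms)
  qed auto
  also have "\<dots> \<longleftrightarrow> ((\<lambda>w. f (2 * w)) has_sum S) UNIV"
    by (subst has_sum_reindex) (auto simp: inj_on_def o_def)
  finally show ?thesis .
qed

lemma has_sum_shift:
  fixes f :: "int \<Rightarrow> complex"
  assumes "(f has_sum A) UNIV"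
  shows "((\<lambda>n. f (n + v)) has_sum A) UNIV"
proof -
  have "((\<lambda>n. f (n + v)) has_sum A) UNIV \<longleftrightarrow> (f has_sum A) UNIV"
    by (rule has_sum_reindex_bij_witness[of _ "\<lambda>n. n - v" "\<lambda>n. n + v"]) auto
  thus ?thesis using assms by simp
qed

lemma has_sum_even_index:
  fixes f :: "nat \<Rightarrow> complex"
  assumes "\<And>e. f (2 * e + 1) = 0"
  shows "(f has_sum S) UNIV \<longleftrightarrow> ((\<lambda>e. f (2 * e)) has_sum S) UNIV"
proof -
  have "(f has_sum S) UNIV \<longleftrightarrow> (f has_sum S) (range (\<lambda>e. 2 * e))"
  proof (rule has_sum_cong_neutral)
    fix n assume "n \<in> UNIV - range (\<lambda>e::nat. 2 * e)"
    hence "odd n" by (auto elim!: evenE)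
    thus "f n = 0" using assms by (auto elim!: oddE)
  qed auto
  also have "\<dots> \<longleftrightarrow> ((\<lambda>e. f (2 * e)) has_sum S) UNIV"
    by (subst has_sum_reindex) (auto simp: inj_on_def o_def)
  finally show ?thesis .
qed

text \<open>The term at 0 is kept apart because it can survive although all other even terms vanish.\<close>

lemma has_sum_odd_index:
  fixes f :: "nat \<Rightarrow> complex"
  assumes "\<And>e. f (2 * e + 2) = 0" and "((\<lambda>e. f (2 * e + 1)) has_sum S) UNIV"
  shows "(f has_sum (f 0 + S)) UNIV"
proof -
  have "(f has_sum S) (range (\<lambda>e. 2 * e + 1))"
    using assms(2) by (subst has_sum_reindex) (auto simp: inj_on_def o_def)
  hence "(f has_sum (f 0 + S)) (insert 0 (range (\<lambda>e. 2 * e + 1)))"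
    by (intro has_sum_insert) auto
  also have "?this \<longleftrightarrow> (f has_sum (f 0 + S)) UNIV"
  proof (rule has_sum_cong_neutral)
    fix n :: nat assume n: "n \<in> UNIV - insert 0 (range (\<lambda>e. 2 * e + 1))"
    hence "n \<noteq> 2 * e + 1" for e by blast
    hence "even n" by (meson oddE)
    then obtain m where m: "n = 2 * m" by (auto elim!: evenE)
    with n obtain e where "m = Suc e" by (cases m) auto
    thus "f n = 0" using assms(1)[of e] m by simp
  qed auto
  finally show ?thesis .
qed
lemma double_of_half: "X / 2 = Y \<Longrightarrow> X = 2 * (Y :: complex)"
  by simp

section \<open>Euler's expansions and the q-binomial theorem\<close>

text \<open>The recursion for the coefficients says that \<open>f(w) = \<Sum> c\<^sub>n w^n\<close> satisfies \<open>(1 - b w) f(w) = (1 - a w) f(q w)\<close>. Iterating and letting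
\<open>q^n z \<longlonglongrightarrow> 0\<close>, where \<open>f\<close> is continuous with value 1, gives the product. The case \<open>b = 1\<close> is the q-binomial
theorem and \<open>a = -1\<close>, \<open>b = 0\<close> is Euler's second expansion.\<close>

lemma sums_of_q_difference:
  fixes c :: "nat \<Rightarrow> complex"
  assumes q: "norm q < 1" and c0: "c 0 = 1"
    and rec: "\<And>n. c (Suc n) * (1 - q^Suc n) = c n * (b - a * q^n)"
    and summ: "\<And>w. norm w \<le> norm z \<Longrightarrow> summable (\<lambda>n. c n * w^n)"
    and summ': "summable (\<lambda>n. c n * K^n)" "norm K > 0"
    and nz: "qpoch_inf (b * z) q \<noteq> 0"
  shows "(\<lambda>n. c n * z^n) sums (qpoch_inf (a * z) q / qpoch_inf (b * z) q)"
proof -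
  define f where "f w = (\<Sum>n. c n * w^n)" for w
  have fe: "(1 - b * w) * f w = (1 - a * w) * f (q * w)" if w: "norm w \<le> norm z" for w
  proof -
    have qw: "norm (q * w) \<le> norm z"
      using w q by (simp add: norm_mult) (meson less_imp_le mult_left_le_one_le norm_ge_zero order_trans)
    have s1: "(\<lambda>n. c n * w^n) sums f w" and s2: "(\<lambda>n. c n * (q * w)^n) sums f (q * w)"
      using summ[OF w] summ[OF qw] unfolding f_def by (simp_all add: summable_sums)
    have "(\<lambda>n. c n * w^n - c n * (q * w)^n) sums (f w - f (q * w))"
      by (intro sums_diff s1 s2)
    hence "(\<lambda>n. c (Suc n) * w^Suc n - c (Suc n) * (q * w)^Suc n) sums (f w - f (q * w))"
      by (subst sums_Suc_iff) simp
    also have "(\<lambda>n. c (Suc n) * w^Suc n - c (Suc n) * (q * w)^Suc n)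
        = (\<lambda>n. w * (b * (c n * w^n) - a * (c n * (q * w)^n)))"
    proof
      fix n
      have "c (Suc n) * w^Suc n - c (Suc n) * (q * w)^Suc n = (c (Suc n) * (1 - q^Suc n)) * w^Suc n"
        by (simp add: power_mult_distrib algebra_simps)
      also have "\<dots> = c n * (b - a * q^n) * w^Suc n"
        by (simp only: rec)
      finally show "c (Suc n) * w^Suc n - c (Suc n) * (q * w)^Suc n
        = w * (b * (c n * w^n) - a * (c n * (q * w)^n))"
        by (simp add: power_mult_distrib algebra_simps)
    qed
    finally have "(\<lambda>n. w * (b * (c n * w^n) - a * (c n * (q * w)^n))) sums (f w - f (q * w))" .
    moreover have "(\<lambda>n. w * (b * (c n * w^n) - a * (c n * (q * w)^n))) sums (w * (b * f w - a * f (q * w)))"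
      by (intro sums_mult sums_diff s1 s2)
    ultimately have "f w - f (q * w) = w * (b * f w - a * f (q * w))"
      by (rule sums_unique2)
    thus ?thesis by (simp add: algebra_simps)
  qed
  (* iterating the functional equation along z, q z, q^2 z, ... *)
  have it: "qpoch (b * z) q n * f z = qpoch (a * z) q n * f (q^n * z)" for n
  proof (induction n)
    case (Suc n)
    have "norm (q^n * z) \<le> norm z"
      using q by (simp add: norm_mult norm_power mult_left_le_one_le power_le_one)
    from fe[OF this] have *: "(1 - b * z * q^n) * f (q^n * z) = (1 - a * z * q^n) * f (q^Suc n * z)"
      by (simp add: mult_ac)
    have "qpoch (b * z) q (Suc n) * f z = (1 - b * z * q^n) * (qpoch (b * z) q n * f z)"
      by (simp add: qpoch_Suc)
    also have "\<dots> = qpoch (a * z) q n * ((1 - b * z * q^n) * f (q^n * z))"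
      by (simp add: Suc)
    also have "\<dots> = qpoch (a * z) q (Suc n) * f (q^Suc n * z)"
      unfolding * by (simp add: qpoch_Suc)
    finally show ?case .
  qed simp
  have "isCont f 0"
    unfolding f_def by (rule isCont_powser[OF summ'(1)]) (use summ'(2) in simp)
  moreover have "(\<lambda>n. q^n * z) \<longlonglongrightarrow> 0"
    using q by (intro tendsto_mult_left_zero LIMSEQ_power_zero)
  ultimately have "(\<lambda>n. f (q^n * z)) \<longlonglongrightarrow> f 0"
    by (rule isCont_tendsto_compose)
  hence "(\<lambda>n. qpoch (a * z) q n * f (q^n * z)) \<longlonglongrightarrow> qpoch_inf (a * z) q * f 0"
    by (intro tendsto_mult qpoch_tendsto q)
  moreover have "(\<lambda>n. qpoch (b * z) q n * f z) \<longlonglongrightarrow> qpoch_inf (b * z) q * f z"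
    by (intro tendsto_mult qpoch_tendsto q tendsto_const)
  ultimately have "qpoch_inf (b * z) q * f z = qpoch_inf (a * z) q * f 0"
    unfolding it using LIMSEQ_unique by blast
  moreover have "f 0 = 1" unfolding f_def using c0 by (simp add: powser_zero)
  ultimately have "f z = qpoch_inf (a * z) q / qpoch_inf (b * z) q"
    using nz by (simp add: field_simps)
  thus ?thesis using summ[of z] unfolding f_def by (simp add: summable_sums sums_iff)
qed

lemma q_binomial_has_sum:
  assumes q: "norm q < 1" and z: "norm z < 1"
  shows "((\<lambda>n. qpoch a q n / qpoch q q n * z^n) has_sum (qpoch_inf (a * z) q / qpoch_inf z q)) UNIV"
proof (rule norm_summable_imp_has_sum)
  obtain C where C: "\<And>n. norm (1 / qpoch q q n) \<le> C" "C > 0"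
    using inverse_qpoch_bounded[OF q qpoch_inf_nonzero[OF q q]] by blast
  obtain D where D: "\<And>n. norm (qpoch a q n) \<le> D" "D > 0"
    using qpoch_bounded[OF q] by blast
  have sn: "summable (\<lambda>n. norm (qpoch a q n / qpoch q q n * w^n))" if "norm w < 1" for w
  proof (rule summable_comparison_test')
    show "summable (\<lambda>n. D * C * norm w^n)"
      using that by (intro summable_mult summable_geometric) auto
    show "norm (norm (qpoch a q n / qpoch q q n * w^n)) \<le> D * C * norm w^n" for n
    proof -
      have "norm (qpoch a q n / qpoch q q n * w^n) = norm (qpoch a q n) * norm (1 / qpoch q q n) * norm w^n"
        by (simp add: norm_mult norm_divide norm_power)
      also have "\<dots> \<le> D * C * norm w^n"
        using C D by (intro mult_right_mono mult_mono) (auto intro: less_imp_le)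
      finally show ?thesis by simp
    qed
  qed
  show "summable (\<lambda>n. norm (qpoch a q n / qpoch q q n * z^n))" by (rule sn[OF z])
  have "(\<lambda>n. qpoch a q n / qpoch q q n * z^n) sums (qpoch_inf (a * z) q / qpoch_inf (1 * z) q)"
  proof (rule sums_of_q_difference[OF q])
    show "qpoch a q (Suc n) / qpoch q q (Suc n) * (1 - q^Suc n) = qpoch a q n / qpoch q q n * (1 - a * q^n)" for n
      using qpoch_qq_nonzero[OF q, of "Suc n"] by (simp add: qpoch_Suc field_simps)
    show "summable (\<lambda>n. qpoch a q n / qpoch q q n * w^n)" if "norm w \<le> norm z" for w
      using sn[of w] that z by (intro summable_norm_cancel[OF sn]) auto
    show "summable (\<lambda>n. qpoch a q n / qpoch q q n * (1/2)^n)"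
      by (intro summable_norm_cancel[OF sn]) (auto simp: norm_divide)
    show "0 < norm (1/2 :: complex)" by (simp add: norm_divide)
    show "qpoch_inf (1 * z) q \<noteq> 0" using qpoch_inf_nonzero[OF q z] by simp
  qed auto
  thus "(\<lambda>n. qpoch a q n / qpoch q q n * z^n) sums (qpoch_inf (a * z) q / qpoch_inf z q)" by simp
qed

text \<open>Euler's expansion of \<open>(-z;q)\<^sub>\<infinity>\<close>, valid for every \<open>z\<close> because of the Gaussian decay of the coefficients.\<close>

lemma euler_has_sum:
  assumes q: "norm q < 1"
  shows "((\<lambda>n. q^(n choose 2) * z^n / qpoch q q n) has_sum qpoch_inf (- z) q) UNIV"
proof (rule norm_summable_imp_has_sum)
  define c where "c n = q^(n choose 2) / qpoch q q n" for n
  have rec: "c (Suc n) * (1 - q^Suc n) = c n * (0 - (-1) * q^n)" for n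
    using qpoch_qq_nonzero[OF q, of "Suc n"]
    by (simp add: qpoch_Suc field_simps c_def choose_two_Suc power_add)
  have sn: "summable (\<lambda>n. norm (c n * w^n))" for w
  proof -
    have "(\<lambda>n. norm (q^n / (1 - q^Suc n) * w)) \<longlonglongrightarrow> norm (0 / (1 - 0) * w)"
      using q by (intro tendsto_intros LIMSEQ_power_zero LIMSEQ_Suc) auto
    hence "eventually (\<lambda>n. norm (q^n / (1 - q^Suc n) * w) < 1/2) sequentially"
      by (rule order_tendstoD) auto
    then obtain N where N: "\<And>n. n \<ge> N \<Longrightarrow> norm (q^n / (1 - q^Suc n) * w) < 1/2"
      unfolding eventually_sequentially by blast
    show ?thesis
    proof (rule summable_ratio_test[where c = "1/2" and N = N])
    show "norm (norm (c (Suc n) * w^Suc n)) \<le> 1/2 * norm (norm (c n * w^n))" if "n \<ge> N" for n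
    proof -
      have "c (Suc n) = c n * (q^n / (1 - q^Suc n))"
        using rec[of n] qpoch_qq_nonzero[OF q, of "Suc n"] by (simp add: qpoch_Suc field_simps)
      hence "norm (c (Suc n) * w^Suc n) = norm (q^n / (1 - q^Suc n) * w) * norm (c n * w^n)"
        by (simp add: norm_mult norm_divide norm_power)
      also have "\<dots> \<le> 1/2 * norm (c n * w^n)"
        using N[OF that] by (intro mult_right_mono) auto
      finally show ?thesis by simp
    qed
    qed simp
  qed
  show "summable (\<lambda>n. norm (q^(n choose 2) * z^n / qpoch q q n))"
    using sn[of z] by (simp add: c_def)
  have "(\<lambda>n. c n * z^n) sums (qpoch_inf (-1 * z) q / qpoch_inf (0 * z) q)"
  proof (rule sums_of_q_difference[OF q _ rec])
    show "summable (\<lambda>n. c n * w^n)" for w by (rule summable_norm_cancel[OF sn])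
    show "summable (\<lambda>n. c n * 1^n)" by (rule summable_norm_cancel[OF sn])
  qed (auto simp: c_def binomial_eq_0)
  thus "(\<lambda>n. q^(n choose 2) * z^n / qpoch q q n) sums qpoch_inf (- z) q"
    by (simp add: c_def)
qed
text \<open>The terms are those of Euler's expansion up to a bounded factor, so nothing new has to be estimated.\<close>

lemma summable_power_choose:
  fixes p w :: complex
  assumes "norm p < 1"
  shows "(\<lambda>n. w^n * p^(n choose 2)) summable_on UNIV"
proof -
  have 1: "(\<lambda>n. p^(n choose 2) * w^n / qpoch p p n) summable_on UNIV"
    using euler_has_sum[OF assms] by (rule has_sum_imp_summable)
  obtain C where C: "\<And>n. norm (qpoch p p n) \<le> C" "C > 0"
    using qpoch_bounded[OF assms] by blast
  have 2: "norm (w^n * p^(n choose 2)) \<le> C * norm (p^(n choose 2) * w^n / qpoch p p n)" for n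
  proof -
    have "norm (w^n * p^(n choose 2)) = norm (qpoch p p n) * norm (p^(n choose 2) * w^n / qpoch p p n)"
      using qpoch_qq_nonzero[OF assms] by (simp add: norm_mult norm_divide mult_ac)
    also have "\<dots> \<le> C * norm (p^(n choose 2) * w^n / qpoch p p n)"
      using C by (intro mult_right_mono) auto
    finally show ?thesis .
  qed
  show ?thesis by (rule summable_on_bounded_factor[OF 1 2])
qed

text \<open>The recursion behind both finite identities below: the weight \<open>1 - p^(n+1)\<close> is split as \<open>(1 - p^(n+1-k)) + p^(n+1-k) (1 - p^k)\<close>,
and each part cancels one factor of a product \<open>(p;p)\<^sub>k (p;p)\<^bsub>n+1-k\<^esub>\<close> in the denominator.\<close>

lemma q_pascal_sum:
  fixes p :: complex
  shows "(1 - p^Suc n) * (\<Sum>k\<le>Suc n. A k) = (\<Sum>k\<le>n. (1 - p^Suc (n - k)) * A k)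
    + (\<Sum>k\<le>n. p^(n - k) * (1 - p^Suc k) * A (Suc k))"
proof -
  have "(1 - p^Suc n) * (\<Sum>k\<le>Suc n. A k) = (\<Sum>k\<le>Suc n. (1 - p^(Suc n - k)) * A k + p^(Suc n - k) * (1 - p^k) * A k)"
  proof (subst sum_distrib_left, rule sum.cong)
    fix k assume "k \<in> {..Suc n}"
    hence "p^(Suc n - k) * p^k = p^Suc n" by (simp flip: power_add)
    thus "(1 - p^Suc n) * A k = (1 - p^(Suc n - k)) * A k + p^(Suc n - k) * (1 - p^k) * A k"
      by (simp add: algebra_simps)
  qed simp
  also have "\<dots> = (\<Sum>k\<le>Suc n. (1 - p^(Suc n - k)) * A k) + (\<Sum>k\<le>Suc n. p^(Suc n - k) * (1 - p^k) * A k)"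
    by (rule sum.distrib)
  also have "(\<Sum>k\<le>Suc n. (1 - p^(Suc n - k)) * A k) = (\<Sum>k\<le>n. (1 - p^Suc (n - k)) * A k)"
    by (simp add: Suc_diff_le)
  also have "(\<Sum>k\<le>Suc n. p^(Suc n - k) * (1 - p^k) * A k) = (\<Sum>k\<le>n. p^(n - k) * (1 - p^Suc k) * A (Suc k))"
    unfolding sum.atMost_Suc_shift by simp
  finally show ?thesis .
qed

text \<open>The q-binomial theorem for \<open>(-y;p)\<^sub>n\<close>, with the Gaussian coefficients divided by \<open>(p;p)\<^sub>n\<close> so that no quotient polynomials appear.\<close>

lemma finite_q_binomial:
  assumes "norm p < 1"
  shows "(\<Sum>k\<le>n. p^(k choose 2) * y^k / (qpoch p p k * qpoch p p (n - k))) = qpoch (- y) p n / qpoch p p n"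
proof (induction n)
  case 0
  show ?case by (simp add: binomial_eq_0)
next
  case (Suc n)
  note nz = qpoch_qq_nonzero[OF assms]
  define c where "c k = p^(k choose 2) * y^k" for k
  define A where "A k = c k / (qpoch p p k * qpoch p p (Suc n - k))" for k
  have nzS: "1 - p^Suc k \<noteq> 0" for k using nz[of "Suc k"] by (simp add: qpoch_Suc)
  note q_pascal_sum[of p n A]
  also have "(\<Sum>k\<le>n. (1 - p^Suc (n - k)) * A k) = (\<Sum>k\<le>n. c k / (qpoch p p k * qpoch p p (n - k)))"
  proof (rule sum.cong)
    fix k assume "k \<in> {..n}"
    hence "Suc n - k = Suc (n - k)" by auto
    thus "(1 - p^Suc (n - k)) * A k = c k / (qpoch p p k * qpoch p p (n - k))"
      unfolding A_def using nz nzS[of "n - k"] by (simp add: qpoch_Suc)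
  qed simp
  also have "(\<Sum>k\<le>n. p^(n - k) * (1 - p^Suc k) * A (Suc k)) = (\<Sum>k\<le>n. y * p^n * (c k / (qpoch p p k * qpoch p p (n - k))))"
  proof (rule sum.cong)
    fix k assume "k \<in> {..n}"
    hence e: "p^(n - k) * p^k = p^n" by (simp flip: power_add)
    have "p^(n - k) * (1 - p^Suc k) * A (Suc k) = p^(n - k) * (p^(k choose 2) * p^k * (y * y^k)) / (qpoch p p k * qpoch p p (n - k))"
      unfolding A_def c_def using nz nzS[of k] by (simp add: qpoch_Suc choose_two_Suc power_add)
    also have "\<dots> = y * (p^(n - k) * p^k) * c k / (qpoch p p k * qpoch p p (n - k))"
      by (simp add: c_def)
    finally show "p^(n - k) * (1 - p^Suc k) * A (Suc k) = y * p^n * (c k / (qpoch p p k * qpoch p p (n - k)))"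
      by (simp add: e)
  qed simp
  also have "\<dots> = y * p^n * (\<Sum>k\<le>n. c k / (qpoch p p k * qpoch p p (n - k)))"
    by (simp only: sum_distrib_left)
  also have "(\<Sum>k\<le>n. c k / (qpoch p p k * qpoch p p (n - k))) = qpoch (- y) p n / qpoch p p n"
    using Suc by (simp only: c_def)
  finally have "(1 - p^Suc n) * (\<Sum>k\<le>Suc n. A k) = (1 + y * p^n) * (qpoch (- y) p n / qpoch p p n)"
    by (simp only: distrib_right mult_1_left)
  hence "(\<Sum>k\<le>Suc n. A k) = (1 + y * p^n) * (qpoch (- y) p n / qpoch p p n) / (1 - p^Suc n)"
    using nzS[of n] by (metis nonzero_mult_div_cancel_left)
  hence "(\<Sum>k\<le>Suc n. A k) = qpoch (- y) p (Suc n) / qpoch p p (Suc n)"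
    by (simp add: qpoch_Suc mult_ac)
  thus ?case by (simp add: A_def c_def)
qed

text \<open>A q-analogue of Vandermonde's identity going back to Cauchy. In the inductive step the second part of the split sum is the same
sum with \<open>c p\<close> for \<open>c\<close>, which is why \<open>c\<close> varies in the induction.\<close>

lemma finite_cauchy:
  assumes "norm p < 1" and "\<And>k. qpoch c p k \<noteq> 0"
  shows "(\<Sum>k\<le>n. p^(k * (k - 1)) * c^k / (qpoch p p k * qpoch p p (n - k) * qpoch c p k))
    = 1 / (qpoch p p n * qpoch c p n)"
  using assms(2)
proof (induction n arbitrary: c)
  case 0
  show ?case by simp
next
  case (Suc n)
  note nz = qpoch_qq_nonzero[OF assms(1)]
  have c1: "1 - c \<noteq> 0" using Suc.prems[of 1] by (simp add: qpoch_Suc)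
  have cp: "qpoch (c * p) p k \<noteq> 0" for k using Suc.prems[of "Suc k"] by (simp add: qpoch_Suc_left)
  define A where "A k = p^(k * (k - 1)) * c^k / (qpoch p p k * qpoch p p (Suc n - k) * qpoch c p k)" for k
  have nzS: "1 - p^Suc k \<noteq> 0" for k using nz[of "Suc k"] by (simp add: qpoch_Suc)
  note q_pascal_sum[of p n A]
  also have "(\<Sum>k\<le>n. (1 - p^Suc (n - k)) * A k)
      = (\<Sum>k\<le>n. p^(k * (k - 1)) * c^k / (qpoch p p k * qpoch p p (n - k) * qpoch c p k))"
  proof (rule sum.cong)
    fix k assume "k \<in> {..n}"
    hence "Suc n - k = Suc (n - k)" by auto
    thus "(1 - p^Suc (n - k)) * A k = p^(k * (k - 1)) * c^k / (qpoch p p k * qpoch p p (n - k) * qpoch c p k)"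
      unfolding A_def using nz nzS[of "n - k"] by (simp add: qpoch_Suc)
  qed simp
  also have "\<dots> = 1 / (qpoch p p n * qpoch c p n)" by (rule Suc.IH[OF Suc.prems])
  also have "(\<Sum>k\<le>n. p^(n - k) * (1 - p^Suc k) * A (Suc k))
      = (\<Sum>k\<le>n. c * p^n / (1 - c) * (p^(k * (k - 1)) * (c * p)^k / (qpoch p p k * qpoch p p (n - k) * qpoch (c * p) p k)))"
  proof (rule sum.cong)
    fix k assume "k \<in> {..n}"
    hence e: "p^(n - k) * p^k = p^n" by (simp flip: power_add)
    have e2: "p^(Suc k * k) = p^k * (p^(k * (k - 1)) * p^k)"
      by (cases k) (simp_all flip: power_add add: algebra_simps)
    have "p^(n - k) * (1 - p^Suc k) * A (Suc k)
      = p^(n - k) * (p^(Suc k * k) * (c * c^k)) / (qpoch p p k * qpoch p p (n - k) * ((1 - c) * qpoch (c * p) p k))"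
      unfolding A_def qpoch_Suc_left[of c] using nz nzS[of k] by (simp add: qpoch_Suc)
    also have "\<dots> = c * (p^(n - k) * p^k) / (1 - c) * (p^(k * (k - 1)) * (c * p)^k / (qpoch p p k * qpoch p p (n - k) * qpoch (c * p) p k))"
      unfolding e2 by (simp add: power_mult_distrib mult_ac)
    finally show "p^(n - k) * (1 - p^Suc k) * A (Suc k)
       = c * p^n / (1 - c) * (p^(k * (k - 1)) * (c * p)^k / (qpoch p p k * qpoch p p (n - k) * qpoch (c * p) p k))"
      by (simp add: e)
  qed simp
  also have "\<dots> = c * p^n / (1 - c) * (1 / (qpoch p p n * qpoch (c * p) p n))"
    by (simp only: Suc.IH[OF cp] flip: sum_distrib_left)
  also have "1 / (qpoch p p n * qpoch c p n) + c * p^n / (1 - c) * (1 / (qpoch p p n * qpoch (c * p) p n))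
     = 1 / (qpoch p p n * qpoch c p (Suc n))"
  proof -
    have 1: "qpoch c p n * (1 - c * p^n) = qpoch c p (Suc n)" by (simp add: qpoch_Suc)
    have 2: "(1 - c) * qpoch (c * p) p n = qpoch c p (Suc n)" by (simp add: qpoch_Suc_left)
    have "1 / (qpoch p p n * qpoch c p n) = (1 - c * p^n) / (qpoch p p n * qpoch c p (Suc n))"
      using Suc.prems[of "Suc n"] nz[of n] unfolding 1[symmetric] by simp
    moreover have "c * p^n / (1 - c) * (1 / (qpoch p p n * qpoch (c * p) p n)) = c * p^n / (qpoch p p n * qpoch c p (Suc n))"
      unfolding 2[symmetric] by (simp add: mult_ac)
    ultimately have "1 / (qpoch p p n * qpoch c p n) + c * p^n / (1 - c) * (1 / (qpoch p p n * qpoch (c * p) p n))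
      = (1 - c * p^n) / (qpoch p p n * qpoch c p (Suc n)) + c * p^n / (qpoch p p n * qpoch c p (Suc n))"
      by (simp only:)
    thus ?thesis by (simp flip: add_divide_distrib)
  qed
  finally have "(1 - p^Suc n) * (\<Sum>k\<le>Suc n. A k) = 1 / (qpoch p p n * qpoch c p (Suc n))" .
  hence "(\<Sum>k\<le>Suc n. A k) = 1 / (qpoch p p n * qpoch c p (Suc n)) / (1 - p^Suc n)"
    using nzS[of n] by (metis nonzero_mult_div_cancel_left)
  hence "(\<Sum>k\<le>Suc n. A k) = 1 / (qpoch p p (Suc n) * qpoch c p (Suc n))"
    by (simp add: qpoch_Suc[of p] mult_ac)
  thus ?case by (simp add: A_def)
qed

section \<open>Theta series and the Jacobi triple product\<close>

text \<open>In Ramanujan's notation this is \<open>f(x, p/x)\<close>. For nonzero \<open>x\<close> and \<open>0 < |p| < 1\<close> it converges absolutely; the two-variable form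
covers all theta series below, since \<open>a n^2 + d n = (a + d) n + 2 a (n (n - 1) / 2)\<close>.\<close>

definition theta :: "complex \<Rightarrow> complex \<Rightarrow> complex"
  where "theta x p = (\<Sum>\<^sub>\<infinity>n::int. x powi n * p powi (n * (n - 1) div 2))"

lemma theta_summable:
  fixes p x :: complex
  assumes "norm p < 1" "p \<noteq> 0" "x \<noteq> 0"
  shows "(\<lambda>n::int. x powi n * p powi (n * (n - 1) div 2)) summable_on UNIV"
proof (rule summable_on_int)
  show "(\<lambda>n. x powi int n * p powi (int n * (int n - 1) div 2)) summable_on UNIV"
    unfolding choose_two_int using summable_power_choose[OF assms(1), of x] by simp
  have "(\<lambda>n. x powi (- int n) * p powi (- int n * (- int n - 1) div 2)) = (\<lambda>n. (p / x)^n * p^(n choose 2))"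
    unfolding choose_two_int_neg using assms
    by (auto simp: fun_eq_iff power_int_add power_int_minus field_simps)
  thus "(\<lambda>n. x powi (- int n) * p powi (- int n * (- int n - 1) div 2)) summable_on UNIV"
    using summable_power_choose[OF assms(1), of "p / x"] by simp
qed

lemma theta_has_sum:
  assumes "norm p < 1" "p \<noteq> 0" "x \<noteq> 0"
  shows "((\<lambda>n::int. x powi n * p powi (n * (n - 1) div 2)) has_sum theta x p) UNIV"
  unfolding theta_def by (rule has_sum_infsum[OF theta_summable[OF assms]])

lemma theta_quadratic_has_sum:
  fixes q e :: complex and a :: nat
  assumes "norm q < 1" "q \<noteq> 0" "e \<noteq> 0" "a > 0"
  shows "((\<lambda>n::int. e powi n * q powi (int a * n^2 + d * n)) has_sum theta (e * q powi (int a + d)) (q^(2 * a))) UNIV"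
proof -
  have "norm (q^(2 * a)) < 1" using assms by (simp add: norm_power power_less_one_iff)
  hence "((\<lambda>n::int. (e * q powi (int a + d)) powi n * (q^(2 * a)) powi (n * (n - 1) div 2)) has_sum theta (e * q powi (int a + d)) (q^(2 * a))) UNIV"
    using assms by (intro theta_has_sum) auto
  also have "(\<lambda>n::int. (e * q powi (int a + d)) powi n * (q^(2 * a)) powi (n * (n - 1) div 2)) = (\<lambda>n. e powi n * q powi (int a * n^2 + d * n))"
  proof
    fix n :: int
    have "2 * (n * (n - 1) div 2) = n^2 - n" by (simp add: power2_eq_square algebra_simps)
    moreover have "int (2 * a) * (n * (n - 1) div 2) = int a * (2 * (n * (n - 1) div 2))" by simp
    ultimately have "int (2 * a) * (n * (n - 1) div 2) = int a * (n^2 - n)" by (simp only:)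
    moreover have "int a * n^2 + d * n = (int a + d) * n + int a * (n^2 - n)"
      by (simp add: algebra_simps)
    ultimately have "int a * n^2 + d * n = (int a + d) * n + int (2 * a) * (n * (n - 1) div 2)"
      by (simp only:)
    hence "q powi (int a * n^2 + d * n) = (q powi (int a + d)) powi n * (q^(2 * a)) powi (n * (n - 1) div 2)"
      using assms(2) by (simp only: power_int_add power_int_mult power_int_of_nat simp_thms)
    thus "(e * q powi (int a + d)) powi n * (q^(2 * a)) powi (n * (n - 1) div 2) = e powi n * q powi (int a * n^2 + d * n)"
      by (simp only: power_int_mult_distrib mult.assoc)
  qed
  finally show ?thesis .
qed

text \<open>Euler's expansion of \<open>(p^(i+1);p)\<^sub>\<infinity>\<close>. The product contains the factor \<open>1 - p^0\<close> exactly for negative \<open>i\<close>, so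
dividing by \<open>(p;p)\<^sub>\<infinity>\<close> extends \<open>1/(p;p)\<^sub>i\<close> by zero to all integers \<open>i\<close>. This turns one-sided sums into bilateral ones.\<close>

lemma euler_shifted_has_sum:
  assumes "norm p < 1" "p \<noteq> 0"
  shows "((\<lambda>m. (-1)^m * p powi (int (m choose 2) + (i + 1) * int m) / qpoch p p m) has_sum
     (if i < 0 then 0 else qpoch_inf p p / qpoch p p (nat i))) UNIV"
proof -
  have "((\<lambda>m. p^(m choose 2) * (- (p powi (i + 1)))^m / qpoch p p m) has_sum
        qpoch_inf (- (- (p powi (i + 1)))) p) UNIV"
    by (rule euler_has_sum[OF assms(1)])
  also have "(\<lambda>m. p^(m choose 2) * (- (p powi (i + 1)))^m / qpoch p p m)
     = (\<lambda>m. (-1)^m * p powi (int (m choose 2) + (i + 1) * int m) / qpoch p p m)"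
  proof
    fix m
    have "(- (p powi (i + 1)))^m = (-1)^m * (p powi (i + 1))^m"
      by (rule power_minus)
    moreover have "p powi (int (m choose 2) + (i + 1) * int m) = p^(m choose 2) * (p powi (i + 1))^m"
      using assms by (subst power_int_add) (simp_all only: power_int_power' power_int_of_nat simp_thms)
    ultimately show "p^(m choose 2) * (- (p powi (i + 1)))^m / qpoch p p m
      = (-1)^m * p powi (int (m choose 2) + (i + 1) * int m) / qpoch p p m"
      by (simp only: mult_ac)
  qed
  also have "qpoch_inf (- (- (p powi (i + 1)))) p = (if i < 0 then 0 else qpoch_inf p p / qpoch p p (nat i))"
  proof (cases "i < 0")
    case True
    have "p powi (i + 1) * p^nat (- i - 1) = p powi (i + 1 + int (nat (- i - 1)))"
      using assms by (subst power_int_add) (simp_all only: power_int_of_nat simp_thms)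
    also have "\<dots> = 1" using True by simp
    finally have "qpoch_inf (p powi (i + 1)) p = 0"
      using qpoch_inf_eq_0_iff[OF assms(1)] by blast
    thus ?thesis using True by simp
  next
    case False
    then obtain n where i: "i = int n" by (metis nonneg_int_cases not_less)
    have "p powi (int n + 1) = p * p^n"
      using assms by (simp add: power_int_add)
    thus ?thesis using i qpoch_inf_split[OF assms(1), of p n] qpoch_qq_nonzero[OF assms(1), of n] by simp
  qed
  finally show ?thesis .
qed

text \<open>Euler's series for \<open>(-x;p)\<^sub>\<infinity>\<close> is extended to a bilateral series by the preceding expansion. In the double series over \<open>i\<close>
and \<open>m\<close> the exponent of \<open>p\<close> becomes \<open>v (v - 1) / 2 + m\<close> with \<open>v = i + m\<close>, so the series factors into \<open>theta x p\<close> and the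
geometric-type series of \<open>1 / (-p/x;p)\<^sub>\<infinity>\<close>; convergence of the latter is the reason for the condition on \<open>x\<close>.\<close>

lemma jacobi_triple_product:
  assumes "norm p < 1" "p \<noteq> 0" "norm p < norm x"
  shows "theta x p = qpoch_inf (- x) p * qpoch_inf (- p / x) p * qpoch_inf p p"
proof -
  let ?a = "\<lambda>i. x powi i * p powi (i * (i - 1) div 2)"
  let ?S = "theta x p / qpoch_inf (- p / x) p"
  let ?w = "\<lambda>i. if i < 0 then 0 else qpoch_inf p p / qpoch p p (nat i)"
  have x: "x \<noteq> 0" using assms by auto
  have px: "norm (p / x) < 1" using assms x by (simp add: norm_divide field_simps)
  define F where "F = (\<lambda>(i :: int, m :: nat). ?a i *
      ((-1)^m * p powi (int (m choose 2) + (i + 1) * int m) / qpoch p p m))"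
  define G where "G = (\<lambda>(v :: int, m :: nat). (x powi v * p powi (v * (v - 1) div 2)) * (qpoch 0 p m / qpoch p p m * (- p / x)^m))"
  have q0: "qpoch 0 p m = 1" for m by (simp add: qpoch_def)
  have G: "(G has_sum (theta x p * (qpoch_inf (0 * (- p / x)) p / qpoch_inf (- p / x) p))) (UNIV \<times> UNIV)"
    unfolding G_def using px
    by (intro has_sum_product_complex theta_has_sum q_binomial_has_sum assms x) auto
  have FG: "F (i, m) = G (i + int m, m)" for i m
  proof -
    have e: "(i + int m) * (i + int m - 1) div 2 + int m = i * (i - 1) div 2 + (int (m choose 2) + (i + 1) * int m)"
    proof -
      have "(i + int m) * (i + int m - 1) = i * (i - 1) + (int m * (int m - 1) + 2 * (i * int m))"
        by (simp add: algebra_simps)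
      also have "\<dots> div 2 = i * (i - 1) div 2 + (int m * (int m - 1) + 2 * (i * int m)) div 2"
        by (rule div_plus_div_distrib_dvd_left) simp
      also have "(int m * (int m - 1) + 2 * (i * int m)) div 2 = int (m choose 2) + i * int m"
        unfolding choose_two_int[symmetric] by (subst div_plus_div_distrib_dvd_left) auto
      finally show ?thesis by (simp add: algebra_simps)
    qed
    have "G (i + int m, m) = x powi i * x^m * p powi ((i + int m) * (i + int m - 1) div 2) * ((-1)^m * p^m / x^m / qpoch p p m)"
      using x by (simp add: G_def q0 power_int_add power_divide power_minus[of "p / x"])
    also have "\<dots> = x powi i * (-1)^m * (p powi ((i + int m) * (i + int m - 1) div 2) * p powi int m) / qpoch p p m"
      using x by simp
    also have "p powi ((i + int m) * (i + int m - 1) div 2) * p powi int m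
      = p powi ((i + int m) * (i + int m - 1) div 2 + int m)"
      using assms by (simp add: power_int_add)
    also have "\<dots> = p powi (i * (i - 1) div 2) * p powi (int (m choose 2) + (i + 1) * int m)"
      unfolding e using assms by (simp only: power_int_add simp_thms)
    finally show ?thesis by (simp add: F_def mult_ac)
  qed
  have "(F has_sum ?S) (UNIV \<times> UNIV)"
  proof -
    have "(F has_sum ?S) (UNIV \<times> UNIV) \<longleftrightarrow>
      (G has_sum ?S) (UNIV \<times> UNIV)"
      by (rule has_sum_reindex_bij_witness[of _ "\<lambda>(v, m). (v - int m, m)" "\<lambda>(i, m). (i + int m, m)"])
        (auto simp: FG)
    thus ?thesis using G by simp
  qed
  hence "((\<lambda>i. ?a i * ?w i)
     has_sum ?S) UNIV"
    by (rule has_sum_SigmaD)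
      (unfold F_def prod.case, intro has_sum_cmult_right euler_shifted_has_sum assms)
  also have "?this \<longleftrightarrow> ((\<lambda>i. ?a i * ?w i)
     has_sum ?S) (range int)"
  proof (rule has_sum_cong_neutral)
    fix i :: int assume "i \<in> UNIV - range int"
    hence "i < 0" by (metis DiffD2 not_less rangeI zero_le_imp_eq_int)
    thus "?a i * ?w i = 0"
      by simp
  qed auto
  also have "\<dots> \<longleftrightarrow> ((\<lambda>n. qpoch_inf p p * (p^(n choose 2) * x^n / qpoch p p n)) has_sum ?S) UNIV"
    by (subst has_sum_reindex) (auto simp: o_def choose_two_int mult_ac)
  finally have "((\<lambda>n. qpoch_inf p p * (p^(n choose 2) * x^n / qpoch p p n)) has_sum ?S) UNIV" .
  moreover have "((\<lambda>n. qpoch_inf p p * (p^(n choose 2) * x^n / qpoch p p n)) has_sum (qpoch_inf p p * qpoch_inf (- x) p)) UNIV"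
    by (intro has_sum_cmult_right euler_has_sum assms)
  ultimately have "theta x p / qpoch_inf (- p / x) p = qpoch_inf p p * qpoch_inf (- x) p"
    by (rule has_sum_unique)
  moreover have "qpoch_inf (- p / x) p \<noteq> 0"
    using px assms by (intro qpoch_inf_nonzero) auto
  ultimately show ?thesis by (simp add: field_simps)
qed

text \<open>At \<open>x = -1\<close> the triple product contains the factor \<open>(1;p)\<^sub>\<infinity> = 0\<close>; equivalently, \<open>n \<mapsto> 1 - n\<close> changes the sign of the terms.\<close>

lemma theta_minus_one: "norm p < 1 \<Longrightarrow> p \<noteq> 0 \<Longrightarrow> theta (- 1) p = 0"
  using jacobi_triple_product[of p "-1"] qpoch_inf_eq_0_iff[of p 1] by (auto intro!: exI[of _ 0])

section \<open>Heine's transformation and Bailey's lemma\<close>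

text \<open>The case \<open>b = 0\<close> of Heine's transformation of \<open>\<^sub>2\<phi>\<^sub>1(a, b; c; p, z)\<close> into a \<open>\<^sub>2\<phi>\<^sub>2\<close>. The q-binomial theorem expands
\<open>(a z p^n;p)\<^sub>\<infinity> / (z;p)\<^sub>\<infinity>\<close> with an index \<open>j\<close>; since \<open>(a)\<^sub>n (a p^n)\<^sub>j\<close> depends only on \<open>n + j\<close>, the terms can be collected along
antidiagonals, where the finite Cauchy identity sums them. The hypothesis is stated for the product of the series with
\<open>(a z;p)\<^sub>\<infinity>\<close>, so no denominator \<open>(a z;p)\<^sub>n\<close> has to be nonzero.\<close>

lemma heine_has_sum:
  assumes p: "norm p < 1" and z: "norm z < 1" and c: "qpoch_inf c p \<noteq> 0"
    and S: "((\<lambda>n. qpoch a p n * ((c * z)^n * p^(n * (n - 1))) * qpoch_inf (a * z * p^n) p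
       / (qpoch p p n * qpoch c p n)) has_sum S) UNIV"
  shows "((\<lambda>e. qpoch a p e * z^e / (qpoch p p e * qpoch c p e)) has_sum (S / qpoch_inf z p)) UNIV"
proof -
  note nz = qpoch_qq_nonzero[OF p] and nzc = qpoch_nonzero[OF p c]
  define F where "F = (\<lambda>(n, j). qpoch a p (n + j) * z^(n + j) * (c^n * p^(n * (n - 1)))
      / (qpoch p p n * qpoch c p n * qpoch p p j))"
  obtain A where A: "\<And>n. norm (qpoch a p n) \<le> A" "A > 0" using qpoch_bounded[OF p] by blast
  obtain B where B: "\<And>n. norm (1 / qpoch p p n) \<le> B" "B > 0"
    using inverse_qpoch_bounded[OF p qpoch_inf_nonzero[OF p p]] by blast
  obtain D where D: "\<And>n. norm (1 / qpoch c p n) \<le> D" "D > 0"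
    using inverse_qpoch_bounded[OF p c] by blast
  have "F summable_on UNIV \<times> UNIV"
  proof (rule summable_on_bounded_factor)
    show "(\<lambda>(n, j). ((c * z)^n * (p^2)^(n choose 2)) * (qpoch 0 p j / qpoch p p j * z^j)) summable_on UNIV \<times> UNIV"
    proof (rule summable_on_product_complex)
      show "(\<lambda>n. (c * z)^n * (p^2)^(n choose 2)) summable_on UNIV"
        using p by (intro summable_power_choose) (simp add: norm_power power_less_one_iff)
      show "(\<lambda>j. qpoch 0 p j / qpoch p p j * z^j) summable_on UNIV"
        by (rule has_sum_imp_summable[OF q_binomial_has_sum[OF p z]])
    qed
    fix u :: "nat \<times> nat"
    obtain n j where u: "u = (n, j)" by (cases u)
    have pc: "p^(n * (n - 1)) = (p^2)^(n choose 2)"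
      by (simp only: mult_pred_eq_choose power_mult)
    have "norm (F (n, j)) = norm (qpoch a p (n + j)) * norm (1 / qpoch p p n) * norm (1 / qpoch c p n)
        * norm (((c * z)^n * (p^2)^(n choose 2)) * (qpoch 0 p j / qpoch p p j * z^j))"
      unfolding F_def prod.case pc
      by (simp add: qpoch_def[of 0] norm_mult norm_divide power_add power_mult_distrib mult_ac)
    also have "\<dots> \<le> A * B * D * norm (((c * z)^n * (p^2)^(n choose 2)) * (qpoch 0 p j / qpoch p p j * z^j))"
      using A B D by (intro mult_right_mono mult_mono) (auto intro: less_imp_le)
    finally show "norm (F u) \<le> A * B * D * norm (case u of (n, j) \<Rightarrow> ((c * z)^n * (p^2)^(n choose 2)) * (qpoch 0 p j / qpoch p p j * z^j))"
      by (simp add: u)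
  qed
  then obtain T where T: "(F has_sum T) (UNIV \<times> UNIV)" by (auto simp: summable_on_def)
  have "((\<lambda>n. qpoch a p n * (c * z)^n * p^(n * (n - 1)) / (qpoch p p n * qpoch c p n)
      * (qpoch_inf (a * p^n * z) p / qpoch_inf z p)) has_sum T) UNIV"
  proof (rule has_sum_SigmaD[OF T])
    fix n
    have "(\<lambda>j. F (n, j)) = (\<lambda>j. qpoch a p n * (c * z)^n * p^(n * (n - 1)) / (qpoch p p n * qpoch c p n)
        * (qpoch (a * p^n) p j / qpoch p p j * z^j))"
      by (simp add: F_def fun_eq_iff qpoch_add power_add power_mult_distrib)
    thus "((\<lambda>j. F (n, j)) has_sum qpoch a p n * (c * z)^n * p^(n * (n - 1)) / (qpoch p p n * qpoch c p n)
      * (qpoch_inf (a * p^n * z) p / qpoch_inf z p)) UNIV"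
      by (simp only:) (intro has_sum_cmult_right q_binomial_has_sum p z)
  qed
  moreover have "((\<lambda>n. 1 / qpoch_inf z p * (qpoch a p n * ((c * z)^n * p^(n * (n - 1))) * qpoch_inf (a * z * p^n) p
       / (qpoch p p n * qpoch c p n))) has_sum (1 / qpoch_inf z p * S)) UNIV"
    by (intro has_sum_cmult_right S)
  ultimately have TS: "T = S / qpoch_inf z p"
    using has_sum_unique by (fastforce simp: mult_ac)
  have "((\<lambda>e. \<Sum>n\<le>e. F (n, e - n)) has_sum T) UNIV"
    using T by (intro has_sum_antidiagonal) simp
  also have "(\<lambda>e. \<Sum>n\<le>e. F (n, e - n)) = (\<lambda>e. qpoch a p e * z^e / (qpoch p p e * qpoch c p e))"
  proof
    fix e
    have "(\<Sum>n\<le>e. F (n, e - n)) = (\<Sum>n\<le>e. qpoch a p e * z^e * (p^(n * (n - 1)) * c^n / (qpoch p p n * qpoch p p (e - n) * qpoch c p n)))"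
      by (rule sum.cong) (auto simp: F_def mult_ac)
    also have "\<dots> = qpoch a p e * z^e * (1 / (qpoch p p e * qpoch c p e))"
      by (simp only: finite_cauchy[OF p nzc] flip: sum_distrib_left)
    finally show "(\<Sum>n\<le>e. F (n, e - n)) = qpoch a p e * z^e / (qpoch p p e * qpoch c p e)" by simp
  qed
  finally show ?thesis unfolding TS .
qed

text \<open>Durfee rectangles: the sum over \<open>j\<close> counts partitions by their largest \<open>j \<times> (j + d)\<close> rectangle. Analytically, expand
\<open>(p^(j+d+1);p)\<^sub>\<infinity>\<close> by Euler; the antidiagonal sums are multiples of \<open>(1;p)\<^sub>e\<close> and vanish except for \<open>e = 0\<close>.\<close>

lemma cauchy_has_sum:
  assumes p: "norm p < 1"
  shows "((\<lambda>j. p^(j * (j + d)) / (qpoch p p j * qpoch p p (j + d))) has_sum (1 / qpoch_inf p p)) UNIV"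
proof -
  note nz = qpoch_qq_nonzero[OF p] and nzi = qpoch_inf_nonzero[OF p p]
  define F where "F = (\<lambda>(j, m). p^(j * (j + d)) / qpoch p p j * (p^(m choose 2) * (- (p^(j + d + 1)))^m / qpoch p p m))"
  obtain B where B: "\<And>n. norm (1 / qpoch p p n) \<le> B" "B > 0"
    using inverse_qpoch_bounded[OF p nzi] by blast
  have "F summable_on UNIV \<times> UNIV"
  proof (rule summable_on_bounded_factor)
    show "(\<lambda>(j, m). (1^j * p^(j choose 2)) * (1^m * p^(m choose 2))) summable_on UNIV \<times> UNIV"
      by (intro summable_on_product_complex summable_power_choose p)
    fix u :: "nat \<times> nat"
    obtain j m where u: "u = (j, m)" by (cases u)
    have 1: "j choose 2 \<le> j * (j + d)"
      using mult_pred_eq_choose[of j] by (metis diff_le_self le_add1 mult_2 mult_le_mono2 order_trans)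
    have "norm (F (j, m)) = (norm p^(j * (j + d)) * norm (1 / qpoch p p j)) * (norm p^(m choose 2) * norm p^((j + d + 1) * m) * norm (1 / qpoch p p m))"
    proof -
      have "norm ((- (p^N))^m) = norm p^(N * m)" for N
        by (simp add: norm_power power_mult)
      thus ?thesis unfolding F_def prod.case by (simp only: norm_mult norm_divide norm_power norm_one mult_1_left times_divide_eq_right divide_inverse mult_ac)
    qed
    also have "\<dots> \<le> (norm p^(j choose 2) * B) * (norm p^(m choose 2) * 1 * B)"
      using B p 1 by (intro mult_mono power_decreasing power_le_one mult_nonneg_nonneg) (auto intro: less_imp_le)
    finally show "norm (F u) \<le> (B * B) * norm (case u of (j, m) \<Rightarrow> (1^j * p^(j choose 2)) * (1^m * p^(m choose 2)))"
      by (simp add: u norm_mult norm_power mult_ac)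
  qed
  then obtain T where T: "(F has_sum T) (UNIV \<times> UNIV)" by (auto simp: summable_on_def)
  have "((\<lambda>e. \<Sum>j\<le>e. F (j, e - j)) has_sum T) UNIV"
    using T by (intro has_sum_antidiagonal) simp
  also have "(\<lambda>e. \<Sum>j\<le>e. F (j, e - j)) = (\<lambda>e. if e = 0 then 1 else 0)"
  proof
    fix e
    have "(\<Sum>j\<le>e. F (j, e - j)) = (\<Sum>j\<le>e. (-1)^e * p^(d * e + e + (e choose 2)) * (p^(j choose 2) * (-1)^j / (qpoch p p j * qpoch p p (e - j))))"
    proof (rule sum.cong)
      fix j assume "j \<in> {..e}"
      then obtain m where e: "e = j + m" by (metis atMost_iff le_Suc_ex)
      have ch: "(j + m) choose 2 = (j choose 2) + (m choose 2) + j * m"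
        by (induction m) (simp_all add: choose_two_Suc binomial_eq_0)
      have jj: "j * j = j + 2 * (j choose 2)"
        using mult_pred_eq_choose[of j] by (cases j) auto
      have ex: "j * (j + d) + ((m choose 2) + (j + d + 1) * m) = d * (j + m) + (j + m) + ((j + m) choose 2) + (j choose 2)"
        unfolding ch add_mult_distrib2 jj by (simp add: algebra_simps)
      have sg: "(-1 :: complex)^m = (-1)^(j + m) * (-1)^j"
        by (simp add: power_add)
      have N: "(- (p^(j + d + 1)))^m = (-1)^m * p^((j + d + 1) * m)"
        by (simp only: power_minus[of "p^(j + d + 1)"] power_mult)
      have "F (j, m) = (-1)^m * p^(j * (j + d) + ((m choose 2) + (j + d + 1) * m)) / (qpoch p p j * qpoch p p m)"
        unfolding F_def prod.case N power_add[of p "j * (j + d)"] power_add[of p "m choose 2"]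
        by (simp only: times_divide_eq_right times_divide_eq_left divide_divide_eq_left mult_ac)
      also have "\<dots> = (-1)^(j + m) * (-1)^j * p^(j * (j + d) + ((m choose 2) + (j + d + 1) * m)) / (qpoch p p j * qpoch p p m)"
        by (simp only: sg)
      also have "\<dots> = (-1)^e * p^(d * e + e + (e choose 2)) * (p^(j choose 2) * (-1)^j / (qpoch p p j * qpoch p p m))"
        unfolding ex e by (simp add: power_add)
      finally show "F (j, e - j) = (-1)^e * p^(d * e + e + (e choose 2)) * (p^(j choose 2) * (-1)^j / (qpoch p p j * qpoch p p (e - j)))"
        using e by simp
    qed simp
    also have "\<dots> = (-1)^e * p^(d * e + e + (e choose 2)) * (qpoch (- (-1)) p e / qpoch p p e)"
      by (simp only: finite_q_binomial[OF p] flip: sum_distrib_left)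
    also have "\<dots> = (if e = 0 then 1 else 0)"
      by (cases e) (simp_all add: qpoch_Suc_left binomial_eq_0)
    finally show "(\<Sum>j\<le>e. F (j, e - j)) = (if e = 0 then 1 else 0)" .
  qed
  finally have "((\<lambda>e::nat. if e = 0 then 1 else 0 :: complex) has_sum T) UNIV" .
  moreover have "((\<lambda>e::nat. if e = 0 then 1 else 0 :: complex) has_sum 1) UNIV"
    by (rule has_sum_finite_neutralI[of "{0}"]) auto
  ultimately have T1: "T = 1" by (rule has_sum_unique)
  have "((\<lambda>j. p^(j * (j + d)) / qpoch p p j * qpoch_inf (- (- (p^(j + d + 1)))) p) has_sum 1) UNIV"
    using T unfolding T1 by (rule has_sum_SigmaD) (unfold F_def prod.case, intro has_sum_cmult_right euler_has_sum p)
  hence "((\<lambda>j. 1 / qpoch_inf p p * (p^(j * (j + d)) / qpoch p p j * qpoch_inf (- (- (p^(j + d + 1)))) p)) has_sum (1 / qpoch_inf p p * 1)) UNIV"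
    by (rule has_sum_cmult_right)
  also have "(\<lambda>j. 1 / qpoch_inf p p * (p^(j * (j + d)) / qpoch p p j * qpoch_inf (- (- (p^(j + d + 1)))) p))
     = (\<lambda>j. p^(j * (j + d)) / (qpoch p p j * qpoch p p (j + d)))"
  proof
    fix j
    have "qpoch_inf p p = qpoch p p (j + d) * qpoch_inf (p^(j + d + 1)) p"
      using qpoch_inf_split[OF p, of p "j + d"] by simp
    hence "qpoch_inf (- (- (p^(j + d + 1)))) p = qpoch_inf p p / qpoch p p (j + d)"
      using nz[of "j + d"] by simp
    thus "1 / qpoch_inf p p * (p^(j * (j + d)) / qpoch p p j * qpoch_inf (- (- (p^(j + d + 1)))) p)
     = p^(j * (j + d)) / (qpoch p p j * qpoch p p (j + d))"
      using nzi by simp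
  qed
  finally show ?thesis by simp
qed

text \<open>Extension by zero to negative indices lets finite bilateral sums be written over all integers.\<close>

definition recip_qpoch :: "complex \<Rightarrow> int \<Rightarrow> complex"
  where "recip_qpoch p k = (if k < 0 then 0 else 1 / qpoch p p (nat k))"

text \<open>The summation range starts at the larger of \<open>-r\<close> and \<open>r - s\<close>; after the shift to this starting point it is Cauchy's identity
with rectangle difference \<open>|2 r - s|\<close>. The bound on \<open>s\<close> makes the starting point nonnegative in both cases.\<close>

lemma cauchy_bilateral_has_sum:
  assumes p: "norm p < 1" "p \<noteq> 0" and s: "s \<le> 1"
  shows "((\<lambda>n. p^(n * n + s * n) * (recip_qpoch p (int n + int s - r) * recip_qpoch p (int n + r)))
     has_sum (p powi (r * r - int s * r) / qpoch_inf p p)) UNIV" (is "(?f has_sum _) _")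
proof -
  have main: "(?f has_sum (p powi (r * r - int s * r) / qpoch_inf p p)) UNIV"
    if k: "\<And>j. ?f (k + j) = p powi (r * r - int s * r) * (p^(j * (j + d)) / (qpoch p p j * qpoch p p (j + d)))"
      "\<And>n. n < k \<Longrightarrow> ?f n = 0" for k d
  proof -
    have "((\<lambda>j. ?f (k + j)) has_sum (p powi (r * r - int s * r) * (1 / qpoch_inf p p))) UNIV"
      unfolding k by (intro has_sum_cmult_right cauchy_has_sum p)
    also have "?this \<longleftrightarrow> (?f has_sum (p powi (r * r - int s * r) * (1 / qpoch_inf p p))) (range (\<lambda>j. k + j))"
      by (subst has_sum_reindex) (auto simp: o_def)
    also have "\<dots> \<longleftrightarrow> (?f has_sum (p powi (r * r - int s * r) * (1 / qpoch_inf p p))) UNIV"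
    proof (rule has_sum_cong_neutral)
      fix n assume "n \<in> UNIV - range (\<lambda>j. k + j)"
      hence "n < k" by (metis DiffD2 le_Suc_ex not_less rangeI)
      thus "?f n = 0" by (rule k)
    qed auto
    finally show ?thesis by simp
  qed
  have pw: "p^n = p powi m * p^k" if "int n = m + int k" for n k m
    using that p(2) by (simp flip: power_int_of_nat power_int_add)
  show ?thesis
  proof (cases "2 * r \<le> int s")
    case True
    hence r: "r \<le> 0" using s by linarith
    define k where "k = nat (- r)"
    have rk: "r = - int k" using r by (simp add: k_def)
    show ?thesis
    proof (rule main[of k "s + 2 * k"])
      show "?f n = 0" if "n < k" for n
        using that by (simp add: recip_qpoch_def rk)
      fix j
      have 1: "nat (int (k + j) + int s - r) = j + (s + 2 * k)" "\<not> int (k + j) + int s - r < 0"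
          "nat (int (k + j) + r) = j" "\<not> int (k + j) + r < 0"
        by (auto simp: rk)
      have "p^((k + j) * (k + j) + s * (k + j)) = p powi (r * r - int s * r) * p^(j * (j + (s + 2 * k)))"
        by (rule pw) (simp add: rk algebra_simps)
      thus "?f (k + j) = p powi (r * r - int s * r) * (p^(j * (j + (s + 2 * k))) / (qpoch p p j * qpoch p p (j + (s + 2 * k))))"
        unfolding recip_qpoch_def 1 if_False using 1 by simp
    qed
  next
    case False
    hence r: "r \<ge> 1" using s by linarith
    define k where "k = nat (r - int s)"
    have rk: "r = int k + int s" using r s by (simp add: k_def)
    have ks: "s \<le> 2 * k + s" by simp
    show ?thesis
    proof (rule main[of k "2 * k + s"])
      show "?f n = 0" if "n < k" for n
        using that by (simp add: recip_qpoch_def rk)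
      fix j
      have 1: "nat (int (k + j) + int s - r) = j" "\<not> int (k + j) + int s - r < 0"
          "nat (int (k + j) + r) = j + (2 * k + s)" "\<not> int (k + j) + r < 0"
        by (auto simp: rk)
      have "p^((k + j) * (k + j) + s * (k + j)) = p powi (r * r - int s * r) * p^(j * (j + (2 * k + s)))"
        by (rule pw) (simp add: rk algebra_simps)
      thus "?f (k + j) = p powi (r * r - int s * r) * (p^(j * (j + (2 * k + s))) / (qpoch p p j * qpoch p p (j + (2 * k + s))))"
        unfolding recip_qpoch_def 1 if_False using 1 by simp
    qed
  qed
qed

text \<open>The finite q-binomial theorem of order \<open>2 n + s\<close> with \<open>y = x / p^n\<close>, whose index is centred by \<open>k = n + r\<close>, followed by reflection
of the first \<open>n\<close> factors of the product.\<close>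

lemma finite_jacobi_has_sum:
  assumes p: "norm p < 1" "p \<noteq> 0" and x: "x \<noteq> 0"
  shows "((\<lambda>r. x powi r * p powi (r * (r - 1) div 2) * (recip_qpoch p (int n + int s - r) * recip_qpoch p (int n + r)))
     has_sum (qpoch (- x) p (n + s) * qpoch (- p / x) p n / qpoch p p (2 * n + s))) UNIV" (is "(?f has_sum _) _")
proof (rule has_sum_finite_neutralI)
  define B where "B = (\<lambda>k. int k - int n) ` {..2 * n + s}"
  show "finite B" "B \<subseteq> UNIV" by (auto simp: B_def)
  show "?f r = 0" if "r \<in> UNIV - B" for r
  proof (rule ccontr)
    assume "?f r \<noteq> 0"
    hence "\<not> int n + int s - r < 0" "\<not> int n + r < 0" by (auto simp: recip_qpoch_def)
    hence "r = int (nat (r + int n)) - int n" "nat (r + int n) \<in> {..2 * n + s}" by auto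
    hence "r \<in> B" unfolding B_def by blast
    thus False using that by simp
  qed
  have "x^n * (\<Sum>r\<in>B. ?f r) = (\<Sum>k\<le>2 * n + s. p^(Suc n choose 2) * (p^(k choose 2) * (x / p^n)^k / (qpoch p p k * qpoch p p (2 * n + s - k))))"
    unfolding B_def sum_distrib_left
  proof (subst sum.reindex, goal_cases)
    case 2
    show ?case
    proof (rule sum.cong)
      fix k assume "k \<in> {..2 * n + s}"
      hence 1: "nat (int n + int s - (int k - int n)) = 2 * n + s - k" "\<not> int n + int s - (int k - int n) < 0"
          "nat (int n + (int k - int n)) = k" "\<not> int n + (int k - int n) < 0" by auto
      have ch: "int (j choose 2) = int j * (int j - 1) div 2" for j by (simp add: choose_two_int)
      have 2: "(int k - int n) * ((int k - int n) - 1) div 2 = int (Suc n choose 2) + int (k choose 2) - int n * int k"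
      proof -
        have "2 * (int (Suc n choose 2) + int (k choose 2) - int n * int k) = (int k - int n) * ((int k - int n) - 1)"
        proof -
          have "2 * int (j choose 2) = int j * (int j - 1)" for j
            using mult_pred_eq_choose[of j] by (cases j) (auto simp: algebra_simps simp flip: of_nat_mult)
          note this[of k] this[of "Suc n"]
          thus ?thesis by (simp add: algebra_simps)
        qed
        thus ?thesis by (metis nonzero_mult_div_cancel_left zero_neq_numeral)
      qed
      have A: "x^n * x powi (int k - int n) = x^k"
        using x by (simp add: power_int_diff)
      have B: "p powi ((int k - int n) * ((int k - int n) - 1) div 2) = p^(Suc n choose 2) * p^(k choose 2) / (p^n)^k"
        unfolding 2 using p by (simp add: power_int_diff power_int_add power_mult flip: of_nat_mult)
      have "x^n * ?f (int k - int n) = (x^n * x powi (int k - int n)) * p powi ((int k - int n) * ((int k - int n) - 1) div 2)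
          * (recip_qpoch p (int n + int s - (int k - int n)) * recip_qpoch p (int n + (int k - int n)))"
        by (simp only: mult_ac)
      also have "\<dots> = x^k * (p^(Suc n choose 2) * p^(k choose 2) / (p^n)^k) * (1 / qpoch p p (2 * n + s - k) * (1 / qpoch p p k))"
        unfolding A B recip_qpoch_def 1 using 1 by (simp only: if_False)
      finally show "((\<lambda>r. x^n * ?f r) \<circ> (\<lambda>k. int k - int n)) k = p^(Suc n choose 2) * (p^(k choose 2) * (x / p^n)^k / (qpoch p p k * qpoch p p (2 * n + s - k)))"
        by (simp add: power_divide mult_ac)
    qed simp
  qed (auto simp: inj_on_def)
  also have "\<dots> = p^(Suc n choose 2) * (qpoch (- (x / p^n)) p (2 * n + s) / qpoch p p (2 * n + s))"
    by (simp only: finite_q_binomial[OF p(1)] flip: sum_distrib_left)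
  also have "qpoch (- (x / p^n)) p (2 * n + s) = qpoch (- x / p^n) p n * qpoch (- x) p (n + s)"
    using qpoch_add[of "- x / p^n" p n "n + s"] p by (simp add: mult_2 add.assoc)
  also have "p^(Suc n choose 2) * (qpoch (- x / p^n) p n * qpoch (- x) p (n + s) / qpoch p p (2 * n + s))
     = (qpoch (- x / p^n) p n * p^(Suc n choose 2)) * qpoch (- x) p (n + s) / qpoch p p (2 * n + s)"
    by simp
  also have "qpoch (- x / p^n) p n * p^(Suc n choose 2) = x^n * qpoch (- p / x) p n"
    using qpoch_reflect[of p "- x" n] p x by simp
  finally have "x^n * (\<Sum>r\<in>B. ?f r) = x^n * (qpoch (- x) p (n + s) * qpoch (- p / x) p n / qpoch p p (2 * n + s))"
    by (simp only: mult_ac times_divide_eq_right)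
  thus "qpoch (- x) p (n + s) * qpoch (- p / x) p n / qpoch p p (2 * n + s) = (\<Sum>r\<in>B. ?f r)"
    by (subst (asm) mult_left_cancel) (use x in auto)
qed

text \<open>Insert the finite Jacobi triple product and sum over \<open>n\<close> first: Cauchy's identity multiplies the coefficient of \<open>x^r\<close> by
\<open>p^(r^2 - s r) / (p;p)\<^sub>\<infinity>\<close>, which triples the quadratic part of the exponent and gives a theta series with nome \<open>p^3\<close>.\<close>

lemma bailey_has_sum:
  assumes p: "norm p < 1" "p \<noteq> 0" and x: "x \<noteq> 0" and s: "s \<le> 1"
  shows "((\<lambda>n. p^(n * n + s * n) * qpoch (- x) p (n + s) * qpoch (- p / x) p n / qpoch p p (2 * n + s))
    has_sum (theta (x * p^(1 - s)) (p^3) / qpoch_inf p p)) UNIV"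
proof -
  let ?a = "\<lambda>r. x powi r * p powi (r * (r - 1) div 2)"
  let ?y = "x * p^(1 - s)"
  let ?b = "\<lambda>n. qpoch (- x) p (n + s) * qpoch (- p / x) p n / qpoch p p (2 * n + s)"
  let ?R = "\<lambda>r n. recip_qpoch p (int n + int s - r) * recip_qpoch p (int n + r)"
  have p3: "norm (p^3) < 1" using p by (simp add: norm_power power_less_one_iff)
  obtain B where B: "\<And>n. norm (1 / qpoch p p n) \<le> B" "B > 0"
    using inverse_qpoch_bounded[OF p(1) qpoch_inf_nonzero[OF p(1) p(1)]] by blast
  have B': "norm (recip_qpoch p k) \<le> B" for k using B by (auto simp: recip_qpoch_def intro: less_imp_le)
  define F where "F = (\<lambda>(r, n). ?a r * (p^(n * n + s * n) *
    (?R r n)))"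
  have "F summable_on UNIV \<times> UNIV"
  proof (rule summable_on_bounded_factor)
    show "(\<lambda>(r, n). (?a r) * (1^n * p^(n choose 2))) summable_on UNIV \<times> UNIV"
      by (intro summable_on_product_complex summable_power_choose theta_summable p x)
    fix u :: "int \<times> nat"
    obtain r n where u: "u = (r, n)" by (cases u)
    have 1: "n choose 2 \<le> n * n + s * n"
      using mult_pred_eq_choose[of n] by (metis diff_le_self le_add1 mult_2 mult_le_mono2 order_trans)
    have "norm (F (r, n)) = norm (?a r) * (norm p^(n * n + s * n) * (norm (recip_qpoch p (int n + int s - r)) * norm (recip_qpoch p (int n + r))))"
      unfolding F_def by (simp add: norm_mult norm_power)
    also have "\<dots> \<le> norm (?a r) * (norm p^(n choose 2) * (B * B))"
      using B' p 1 \<open>B > 0\<close> by (intro mult_mono power_decreasing mult_nonneg_nonneg) (auto intro: less_imp_le)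
    finally show "norm (F u) \<le> (B * B) * norm (case u of (r, n) \<Rightarrow> (?a r) * (1^n * p^(n choose 2)))"
      by (simp add: u norm_mult norm_power mult_ac)
  qed
  then obtain T where T: "(F has_sum T) (UNIV \<times> UNIV)" by (auto simp: summable_on_def)
  have "((\<lambda>r. ?a r * (p powi (r * r - int s * r) / qpoch_inf p p)) has_sum T) UNIV"
    using T by (rule has_sum_SigmaD) (unfold F_def prod.case, intro has_sum_cmult_right cauchy_bilateral_has_sum p s)
  also have "(\<lambda>r. ?a r * (p powi (r * r - int s * r) / qpoch_inf p p))
     = (\<lambda>r. 1 / qpoch_inf p p * (?y powi r * (p^3) powi (r * (r - 1) div 2)))"
  proof
    fix r :: int
    have s': "int (1 - s) = 1 - int s" using s by simp
    have "r * r - int s * r = 2 * (r * (r - 1) div 2) + (1 - int s) * r"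
      by (simp add: algebra_simps)
    hence "r * (r - 1) div 2 + (r * r - int s * r) = (1 - int s) * r + 3 * (r * (r - 1) div 2)"
      by linarith
    hence "p powi (r * (r - 1) div 2) * p powi (r * r - int s * r) = p powi ((1 - int s) * r + 3 * (r * (r - 1) div 2))"
      using p(2) by (metis power_int_add)
    also have "\<dots> = (p^(1 - s)) powi r * (p^3) powi (r * (r - 1) div 2)"
      using p by (simp only: power_int_add power_int_power s' simp_thms of_nat_numeral)
    finally have e: "p powi (r * (r - 1) div 2) * p powi (r * r - int s * r) = (p^(1 - s)) powi r * (p^3) powi (r * (r - 1) div 2)" .
    have "?a r * (p powi (r * r - int s * r) / qpoch_inf p p)
      = 1 / qpoch_inf p p * (x powi r * (p powi (r * (r - 1) div 2) * p powi (r * r - int s * r)))" by simp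
    also have "\<dots> = 1 / qpoch_inf p p * (?y powi r * (p^3) powi (r * (r - 1) div 2))"
      unfolding e by (simp only: power_int_mult_distrib mult.assoc)
    finally show "?a r * (p powi (r * r - int s * r) / qpoch_inf p p)
      = 1 / qpoch_inf p p * (?y powi r * (p^3) powi (r * (r - 1) div 2))" .
  qed
  finally have "((\<lambda>r. 1 / qpoch_inf p p * (?y powi r * (p^3) powi (r * (r - 1) div 2))) has_sum T) UNIV" .
  moreover have "((\<lambda>r. 1 / qpoch_inf p p * (?y powi r * (p^3) powi (r * (r - 1) div 2)))
     has_sum (1 / qpoch_inf p p * theta ?y (p^3))) UNIV"
    using p x p3 by (intro has_sum_cmult_right theta_has_sum) auto
  ultimately have T': "T = theta ?y (p^3) / qpoch_inf p p"
    using has_sum_unique by fastforce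
  have "((\<lambda>(n, r). F (r, n)) has_sum T) (UNIV \<times> UNIV)"
    using T has_sum_swap by blast
  hence "((\<lambda>n. p^(n * n + s * n) * (?b n)) has_sum T) UNIV"
  proof (rule has_sum_SigmaD)
    fix n
    have "((\<lambda>r. p^(n * n + s * n) * (?a r * (?R r n)))
      has_sum (p^(n * n + s * n) * (?b n))) UNIV"
      by (intro has_sum_cmult_right finite_jacobi_has_sum p x)
    thus "((\<lambda>r. case (n, r) of (n, r) \<Rightarrow> F (r, n)) has_sum
      (p^(n * n + s * n) * (?b n))) UNIV"
      by (simp add: F_def mult_ac)
  qed
  thus ?thesis unfolding T' by (simp add: mult.assoc)
qed
section \<open>Summing over the first index by a theta series\<close>

text \<open>With \<open>x = q^2\<close> and \<open>p = x^2\<close> these are \<open>(p;p)\<^sub>n\<close>, \<open>(p;p)\<^sub>\<infinity>\<close>, \<open>(x;p)\<^sub>\<infinity>\<close>, \<open>(-x;p)\<^sub>\<infinity>\<close> and \<open>(-p;p)\<^sub>\<infinity>\<close>. All infinite products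
of the reduction are monomials in the last four, and the last three multiply to 1. The theta series
are \<open>\<phi>(q)\<close>, \<open>\<phi>(-q)\<close>, \<open>\<phi>(q^3)\<close> and \<open>\<phi>(-q^3)\<close>.\<close>

abbreviation (input) poch4 :: "complex \<Rightarrow> nat \<Rightarrow> complex" where "poch4 q n \<equiv> qpoch (q^4) (q^4) n"
abbreviation (input) prod_p :: "complex \<Rightarrow> complex" where "prod_p q \<equiv> qpoch_inf (q^4) (q^4)"
abbreviation (input) prod_a :: "complex \<Rightarrow> complex" where "prod_a q \<equiv> qpoch_inf (q^2) (q^4)"
abbreviation (input) prod_b :: "complex \<Rightarrow> complex" where "prod_b q \<equiv> qpoch_inf (- (q^2)) (q^4)"
abbreviation (input) prod_c :: "complex \<Rightarrow> complex" where "prod_c q \<equiv> qpoch_inf (- (q^4)) (q^4)"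

abbreviation (input) phi :: "complex \<Rightarrow> complex" where "phi q \<equiv> theta q (q^2)"
abbreviation (input) phi_neg :: "complex \<Rightarrow> complex" where "phi_neg q \<equiv> theta (- q) (q^2)"
abbreviation (input) phi3 :: "complex \<Rightarrow> complex" where "phi3 q \<equiv> theta (q^3) (q^6)"
abbreviation (input) phi3_neg :: "complex \<Rightarrow> complex" where "phi3_neg q \<equiv> theta (- (q^3)) (q^6)"

lemma power4_choose:
  fixes q :: complex
  assumes "q \<noteq> 0"
  shows "(q^4)^(k choose 2) = q powi (2 * (int k)^2 - 2 * int k)"
proof -
  have "2 * (int k)^2 - 2 * int k = int (4 * (k choose 2))"
    using two_choose_two[of k] by (simp add: power2_eq_square algebra_simps)
  thus ?thesis by (simp only: power_int_of_nat power_mult)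
qed

lemma quadratic_theta_has_sum:
  fixes q e :: complex
  assumes "norm q < 1" "q \<noteq> 0" "e \<noteq> 0"
  shows "((\<lambda>n::int. e powi n * q powi (n^2 + d * n)) has_sum theta (e * q powi (1 + d)) (q^2)) UNIV"
  using theta_quadratic_has_sum[OF assms, of 1 d] by simp

lemma theta_parity_has_sum:
  fixes q :: complex
  assumes "norm q < 1" "q \<noteq> 0"
  shows "((\<lambda>m::int. q powi ((2 * m + j)^2)) has_sum
    ((phi q + (-1) powi j * phi_neg q) / 2)) UNIV"
  by (rule has_sum_parity)
    (use quadratic_theta_has_sum[OF assms, of 1 0] quadratic_theta_has_sum[OF assms, of "-1" 0] in simp_all)

text \<open>What is left of the summand after the sum over \<open>n\<^sub>1\<close>: \<open>r\<close> is the index of the Euler expansion, \<open>k\<close> and \<open>n\<close> stand for \<open>n\<^sub>2\<close> and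
\<open>n\<^sub>3\<close>, and \<open>e = \<plusminus>1\<close> records whether the term is multiplied by \<open>\<phi>(q)\<close> or \<open>\<phi>(-q)\<close>.\<close>

definition reduced_term :: "complex \<Rightarrow> int \<Rightarrow> int \<Rightarrow> int \<Rightarrow> complex \<Rightarrow> nat \<times> nat \<times> nat \<Rightarrow> complex" where
  "reduced_term q b c d e = (\<lambda>(r, k, n). (- e)^r * e^k *
     q powi ((int r - int k)^2 + (int n - int k)^2 + d * int r + b * int k + c * int n)
     / (poch4 q r * poch4 q k * poch4 q n))"

definition reduced_sum :: "complex \<Rightarrow> int \<Rightarrow> int \<Rightarrow> int \<Rightarrow> complex \<Rightarrow> complex" where
  "reduced_sum q b c d e = infsum (reduced_term q b c d e) UNIV"

text \<open>The map from \<open>(r, k, n)\<close> to \<open>(r - k, n - k, k)\<close> is injective, and in these coordinates the exponent splits into two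
one-variable quadratics and a linear term with slope \<open>b + c + d\<close>.\<close>

lemma reduced_term_summable:
  assumes q: "norm q < 1" "q \<noteq> 0" and e: "norm e = 1" and pos: "b + c + d > 0"
  shows "reduced_term q b c d e summable_on UNIV"
proof -
  have Q: "norm (q^4) < 1" using q by (simp add: norm_power power_less_one_iff)
  obtain B where B: "\<And>n. norm (1 / poch4 q n) \<le> B" "B > 0"
    using inverse_qpoch_bounded[OF Q qpoch_inf_nonzero[OF Q Q]] by blast
  define sg where "sg = nat (b + c + d)"
  have qs: "norm (q^sg) < 1" using q pos by (simp add: norm_power power_less_one_iff sg_def)
  (* the factor qpoch 0 0 k / qpoch 0 0 k is 1; it matches the q-binomial series, which here is the geometric one *)
  define g where "g = (\<lambda>(a::int, b'::int, k::nat). (1 powi a * q powi (a^2 + d * a)) *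
     ((1 powi b' * q powi (b'^2 + c * b')) * (qpoch 0 0 k / qpoch 0 0 k * (q^sg)^k)))"
  have "g summable_on UNIV \<times> (UNIV \<times> UNIV)"
    unfolding g_def case_prod_unfold
  proof (intro summable_on_product_complex[unfolded case_prod_unfold, where g = "\<lambda>y. (1 powi fst y * q powi ((fst y)^2 + c * fst y)) * (qpoch 0 0 (snd y) / qpoch 0 0 (snd y) * (q^sg)^snd y)"]
      summable_on_product_complex[unfolded case_prod_unfold, where g = "\<lambda>k. qpoch 0 0 k / qpoch 0 0 k * (q^sg)^k"])
    show "(\<lambda>a. 1 powi a * q powi (a^2 + d * a)) summable_on UNIV"
      using quadratic_theta_has_sum[OF q, of 1 d] by (auto dest: has_sum_imp_summable)
    show "(\<lambda>a. 1 powi a * q powi (a^2 + c * a)) summable_on UNIV"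
      using quadratic_theta_has_sum[OF q, of 1 c] by (auto dest: has_sum_imp_summable)
    show "(\<lambda>k. qpoch 0 0 k / qpoch 0 0 k * (q^sg)^k) summable_on UNIV"
      using q_binomial_has_sum[of 0 "q^sg" 0] qs by (auto dest: has_sum_imp_summable)
  qed
  hence g: "g summable_on UNIV" by simp
  have "(\<lambda>(r, k, n). g (int r - int k, int n - int k, k)) summable_on UNIV"
    using summable_on_inj[OF g, of "\<lambda>(r, k, n). (int r - int k, int n - int k, k)"]
    by (auto simp: inj_on_def case_prod_unfold prod_eq_iff)
  thus ?thesis
  proof (rule summable_on_bounded_factor)
    fix u :: "nat \<times> nat \<times> nat"
    obtain r k n where u: "u = (r, k, n)" by (cases u)
    have q1: "qpoch 0 0 k = 1" by (simp add: qpoch_def)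
    have "(int r - int k)^2 + (int n - int k)^2 + d * int r + b * int k + c * int n
      = ((int r - int k)^2 + d * (int r - int k)) + (((int n - int k)^2 + c * (int n - int k)) + int sg * int k)"
      using pos by (simp add: sg_def algebra_simps)
    hence "q powi ((int r - int k)^2 + (int n - int k)^2 + d * int r + b * int k + c * int n) = g (int r - int k, int n - int k, k)"
      unfolding g_def prod.case q1 using q(2)
      by (simp only: power_int_add power_int_mult power_int_of_nat simp_thms power_int_1_left mult_1_left div_self) simp
    hence "norm (reduced_term q b c d e (r, k, n)) = norm (g (int r - int k, int n - int k, k)) *
        (norm (1 / poch4 q r) * norm (1 / poch4 q k) * norm (1 / poch4 q n))"
      using e by (simp add: reduced_term_def norm_mult norm_divide norm_power)
    also have "\<dots> \<le> norm (g (int r - int k, int n - int k, k)) * (B * B * B)"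
      using B by (intro mult_left_mono mult_mono mult_nonneg_nonneg) (auto intro: less_imp_le)
    finally show "norm (reduced_term q b c d e u) \<le> (B * B * B) * norm (case u of (r, k, n) \<Rightarrow> g (int r - int k, int n - int k, k))"
      by (simp add: u mult_ac)
  qed
qed

text \<open>For fixed \<open>r\<close> and \<open>n\<close> the exponent is \<open>2 k (k - 1)\<close> plus a linear function of \<open>k\<close>, so Euler's expansion in base \<open>q^4\<close> applies and
the result depends only on \<open>l = r + n\<close>. The remaining sum over \<open>r + n = l\<close> is a finite q-binomial sum.\<close>

lemma reduced_sum_single_series:
  assumes q: "norm q < 1" "q \<noteq> 0" and e: "norm e = 1" and pos: "b + c + d > 0"
  shows "((\<lambda>l. q powi ((int l)^2 + c * int l) * qpoch (e * q powi (2 - 2 * int l + d - c)) (q^4) l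
     * qpoch_inf (- e * q powi (2 + b - 2 * int l)) (q^4) / poch4 q l) has_sum reduced_sum q b c d e) UNIV"
proof -
  let ?S = "reduced_sum q b c d e"
  let ?y = "\<lambda>l. e * q powi (2 + b - 2 * l)"
  let ?z = "\<lambda>l. q powi (2 - 2 * int l + d - c)"
  let ?u = "\<lambda>l. q powi ((int l)^2 + c * int l)"
  have Q: "norm (q^4) < 1" using q by (simp add: norm_power power_less_one_iff)
  have add: "q powi (x + y) = q powi x * q powi y" for x y using q(2) by (simp add: power_int_add)
  define h where "h = (\<lambda>(r, n). (- e)^r * q powi ((int r)^2 + (int n)^2 + d * int r + c * int n)
       / (poch4 q r * poch4 q n))"
  have "(reduced_term q b c d e has_sum ?S) UNIV"
    unfolding reduced_sum_def by (intro has_sum_infsum reduced_term_summable assms)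
  also have "?this \<longleftrightarrow> ((\<lambda>((r, n), k). reduced_term q b c d e (r, k, n)) has_sum ?S) (UNIV \<times> UNIV)"
    by (rule has_sum_reindex_bij_witness[of _ "\<lambda>((r, n), k). (r, k, n)" "\<lambda>(r, k, n). ((r, n), k)"]) auto
  finally have 1: "((\<lambda>((r, n), k). reduced_term q b c d e (r, k, n)) has_sum ?S) (UNIV \<times> UNIV)" .
  have 2: "((\<lambda>(r, n). h (r, n) * qpoch_inf (- (?y (int r + int n))) (q^4)) has_sum ?S) UNIV"
  proof (rule has_sum_SigmaD[OF 1])
    fix u :: "nat \<times> nat"
    obtain r n where u: "u = (r, n)" by (cases u)
    have "reduced_term q b c d e (r, k, n) = h (r, n) * ((q^4)^(k choose 2) * (?y (int r + int n))^k / poch4 q k)" for k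
    proof -
      have "(int r - int k)^2 + (int n - int k)^2 + d * int r + b * int k + c * int n
        = ((int r)^2 + (int n)^2 + d * int r + c * int n) + ((2 * (int k)^2 - 2 * int k) + (2 + b - 2 * (int r + int n)) * int k)"
        by (simp add: power2_eq_square algebra_simps)
      hence "q powi ((int r - int k)^2 + (int n - int k)^2 + d * int r + b * int k + c * int n)
        = q powi ((int r)^2 + (int n)^2 + d * int r + c * int n) * ((q^4)^(k choose 2) * (q powi (2 + b - 2 * (int r + int n)))^k)"
        by (simp only: add[of _ "(2 * (int k)^2 - 2 * int k) + _"] add[of "(2 * (int k)^2 - 2 * int k)"] power4_choose[OF q(2)] power_int_power')
      thus ?thesis
        by (simp only: reduced_term_def h_def prod.case power_mult_distrib times_divide_eq_right times_divide_eq_left divide_divide_eq_left mult_ac)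
    qed
    hence "((\<lambda>k. reduced_term q b c d e (r, k, n)) has_sum (h (r, n) * qpoch_inf (- (?y (int r + int n))) (q^4))) UNIV"
      by (simp only:) (intro has_sum_cmult_right euler_has_sum Q)
    thus "((\<lambda>y. (\<lambda>((r, n), k). reduced_term q b c d e (r, k, n)) (u, y)) has_sum
        (case u of (r, n) \<Rightarrow> h (r, n) * qpoch_inf (- (?y (int r + int n))) (q^4))) UNIV"
      by (simp add: u)
  qed
  have "((\<lambda>l. \<Sum>r\<le>l. h (r, l - r) * qpoch_inf (- (?y (int r + int (l - r)))) (q^4)) has_sum ?S) UNIV"
    using has_sum_antidiagonal[OF 2] by simp
  also have "(\<lambda>l. \<Sum>r\<le>l. h (r, l - r) * qpoch_inf (- (?y (int r + int (l - r)))) (q^4))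
    = (\<lambda>l. ?u l * qpoch (e * ?z l) (q^4) l
     * qpoch_inf (- e * q powi (2 + b - 2 * int l)) (q^4) / poch4 q l)"
  proof
    fix l
    have "(\<Sum>r\<le>l. h (r, l - r) * qpoch_inf (- (?y (int r + int (l - r)))) (q^4))
      = (\<Sum>r\<le>l. (?u l * qpoch_inf (- e * q powi (2 + b - 2 * int l)) (q^4)) *
          ((q^4)^(r choose 2) * (- e * ?z l)^r / (poch4 q r * poch4 q (l - r))))"
    proof (rule sum.cong)
      fix r assume "r \<in> {..l}"
      then obtain n where l: "l = r + n" by (metis atMost_iff le_Suc_ex)
      have "(int r)^2 + (int n)^2 + d * int r + c * int n = ((int l)^2 + c * int l) + ((2 * (int r)^2 - 2 * int r) + (2 - 2 * int l + d - c) * int r)"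
        by (simp add: l power2_eq_square algebra_simps)
      hence "q powi ((int r)^2 + (int n)^2 + d * int r + c * int n) = ?u l *
          ((q^4)^(r choose 2) * (?z l)^r)"
        by (simp only: add[of _ "(2 * (int r)^2 - 2 * int r) + _"] add[of "(2 * (int r)^2 - 2 * int r)"] power4_choose[OF q(2)] power_int_power')
      hence "h (r, n) = ?u l * ((q^4)^(r choose 2) * (- e * ?z l)^r / (poch4 q r * poch4 q n))"
        by (simp only: h_def prod.case power_mult_distrib times_divide_eq_right times_divide_eq_left mult_ac)
      moreover have "int r + int n = int l" "l - r = n" by (auto simp: l)
      ultimately show "h (r, l - r) * qpoch_inf (- (?y (int r + int (l - r)))) (q^4)
        = (?u l * qpoch_inf (- e * q powi (2 + b - 2 * int l)) (q^4)) *
          ((q^4)^(r choose 2) * (- e * ?z l)^r / (poch4 q r * poch4 q (l - r)))"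
        by (simp only: mult_ac mult_minus_left)
    qed simp
    also have "\<dots> = (?u l * qpoch_inf (- e * q powi (2 + b - 2 * int l)) (q^4)) *
       (qpoch (- (- e * ?z l)) (q^4) l / poch4 q l)"
      by (simp only: finite_q_binomial[OF Q] flip: sum_distrib_left)
    also have "- (- e * ?z l) = e * ?z l" by simp
    finally show "(\<Sum>r\<le>l. h (r, l - r) * qpoch_inf (- (?y (int r + int (l - r)))) (q^4))
      = ?u l * qpoch (e * ?z l) (q^4) l
     * qpoch_inf (- e * q powi (2 + b - 2 * int l)) (q^4) / poch4 q l"
      by (simp add: mult_ac)
  qed
  finally show ?thesis .
qed

text \<open>The parameter \<open>s\<close> (0 or 1 in the applications) covers the linear term \<open>4 n\<^sub>1\<close>, since \<open>(2 m + k + 1)^2\<close> contains \<open>4 m\<close>. The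
Euler index \<open>r\<close> contributes \<open>4 m r + 2 r^2 + 2 r\<close> to the exponent, and the square is completed by

  \<open>(2 m + k + s)^2 + k^2 + 4 m r + 2 r^2 + 2 r = (2 m + k + s + r)^2 + (r - k)^2 + (2 - 2 s) r\<close>.

Summing over all integers \<open>m\<close> gives a theta series over the residue class of \<open>k + s + r\<close> modulo 2; summing over \<open>r\<close> first gives back
the original summand.\<close>

lemma nahm_sum_reduction:
  assumes q: "norm q < 1" "q \<noteq> 0" and pos: "b + c + 2 - 2 * s > 0"
  shows "((\<lambda>(m, k, n). q powi ((2 * int m + int k + s)^2 + (int k)^2 + (int n - int k)^2 + b * int k + c * int n)
       / (poch4 q m * poch4 q k * poch4 q n))
     has_sum ((phi q * reduced_sum q b c (2 - 2 * s) 1 + (-1) powi s * phi_neg q * reduced_sum q b c (2 - 2 * s) (-1))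
        / (2 * prod_p q))) UNIV" (is "(?N has_sum _) _")
proof -
  let ?j = "\<lambda>u. int (fst (snd u)) + s + int (fst u)"
  let ?t = "\<lambda>j. (phi q + (-1) powi j * phi_neg q) / 2"
  let ?w = "\<lambda>v. if fst v < 0 then 0 else prod_p q / poch4 q (nat (fst v))"
  have Q: "norm (q^4) < 1" "q^4 \<noteq> 0" using q by (simp_all add: norm_power power_less_one_iff)
  note nzi = qpoch_inf_nonzero[OF Q(1) Q(1)]
  have add: "q powi (x + y) = q powi x * q powi y" for x y using q(2) by (simp add: power_int_add)
  define d where "d = 2 - 2 * s"
  let ?f = "\<lambda>u. phi q / 2 * reduced_term q b c d 1 u + (-1) powi s * phi_neg q / 2 * reduced_term q b c d (-1) u"
  have pos': "b + c + d > 0" using pos by (simp add: d_def)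
  note summ = reduced_term_summable[OF q _ pos', of 1] reduced_term_summable[OF q _ pos', of "-1"]
  define F where "F = (\<lambda>(m :: int, u). q powi ((2 * m + ?j u)^2) * reduced_term q b c d 1 u)"
  have F: "F summable_on UNIV"
  proof -
    have "(\<lambda>(V :: int, u). (1 powi V * q powi (V^2 + 0 * V)) * reduced_term q b c d 1 u) summable_on UNIV \<times> UNIV"
      using summ quadratic_theta_has_sum[OF q, of 1 0]
      by (intro summable_on_product_complex) (auto dest: has_sum_imp_summable)
    hence "(\<lambda>(V :: int, u). (1 powi V * q powi (V^2 + 0 * V)) * reduced_term q b c d 1 u) summable_on UNIV" by simp
    from summable_on_inj[OF this, of "\<lambda>(m, u). (2 * m + ?j u, u)"]
    show ?thesis by (auto simp: inj_on_def case_prod_unfold F_def prod_eq_iff)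
  qed
  then obtain T where T: "(F has_sum T) UNIV" by (auto simp: summable_on_def)
  (* summation over m first: a theta series over one residue class *)
  have T1: "T = (phi q * reduced_sum q b c d 1 + (-1) powi s * phi_neg q * reduced_sum q b c d (-1)) / 2"
  proof -
    have "(F has_sum T) (UNIV \<times> UNIV)" using T by simp
    hence "((\<lambda>(u, m). F (m, u)) has_sum T) (UNIV \<times> UNIV)" using has_sum_swap by blast
    hence "((\<lambda>u. reduced_term q b c d 1 u * ?t (?j u)) has_sum T) UNIV"
    proof (rule has_sum_SigmaD)
      fix u
      have "((\<lambda>m. reduced_term q b c d 1 u * q powi ((2 * m + ?j u)^2)) has_sum
         reduced_term q b c d 1 u * ?t (?j u)) UNIV"
        by (intro has_sum_cmult_right theta_parity_has_sum q)
      thus "((\<lambda>m. case (u, m) of (u, m) \<Rightarrow> F (m, u)) has_sum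
         reduced_term q b c d 1 u * ?t (?j u)) UNIV"
        by (simp add: F_def mult_ac)
    qed
    also have "(\<lambda>u. reduced_term q b c d 1 u * ?t (?j u))
      = (\<lambda>u. ?f u)"
    proof
      fix u :: "nat \<times> nat \<times> nat"
      obtain r k n where u: "u = (r, k, n)" by (cases u)
      have "reduced_term q b c d 1 u * (-1) powi (int k + s + int r) = (-1) powi s * reduced_term q b c d (-1) u"
        by (simp add: reduced_term_def u power_int_add flip: power_mult_distrib)
      thus "reduced_term q b c d 1 u * ?t (?j u)
        = ?f u"
        by (simp add: u algebra_simps add_divide_distrib)
    qed
    finally have "((\<lambda>u. ?f u) has_sum T) UNIV" .
    moreover have "((\<lambda>u. ?f u) has_sum
        (phi q / 2 * reduced_sum q b c d 1 + (-1) powi s * phi_neg q / 2 * reduced_sum q b c d (-1))) UNIV"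
      unfolding reduced_sum_def using summ by (intro has_sum_add has_sum_cmult_right has_sum_infsum) auto
    ultimately have "T = phi q / 2 * reduced_sum q b c d 1 + (-1) powi s * phi_neg q / 2 * reduced_sum q b c d (-1)"
      by (rule has_sum_unique)
    thus ?thesis by (simp add: add_divide_distrib)
  qed
  (* summation over r first: Euler's expansion, zero for negative m *)
  define base where "base = (\<lambda>(m :: int, k, n). q powi ((2 * m + int k + s)^2 + (int k)^2 + (int n - int k)^2 + b * int k + c * int n)
       / (poch4 q k * poch4 q n))"
  have "((\<lambda>((m, k, n), r). F (m, r, k, n)) has_sum T) (UNIV \<times> UNIV)"
  proof -
    have "(F has_sum T) UNIV \<longleftrightarrow> ((\<lambda>((m, k, n), r). F (m, r, k, n)) has_sum T) (UNIV \<times> UNIV)"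
      by (rule has_sum_reindex_bij_witness[of _ "\<lambda>((m, k, n), r). (m, r, k, n)" "\<lambda>(m, r, k, n). ((m, k, n), r)"]) auto
    thus ?thesis using T by simp
  qed
  hence "((\<lambda>v. base v * ?w v) has_sum T) UNIV"
  proof (rule has_sum_SigmaD)
    fix v :: "int \<times> nat \<times> nat"
    obtain m k n where v: "v = (m, k, n)" by (cases v)
    have "F (m, r, k, n) = base v * ((-1)^r * (q^4) powi (int (r choose 2) + (m + 1) * int r) / poch4 q r)" for r
    proof -
      have "(q^4) powi (int (r choose 2) + (m + 1) * int r) = q powi ((2 * (int r)^2 - 2 * int r) + 4 * (m + 1) * int r)"
      proof -
        have "4 * (int (r choose 2) + (m + 1) * int r) = (2 * (int r)^2 - 2 * int r) + 4 * (m + 1) * int r"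
          using two_choose_two[of r] by (simp add: power2_eq_square algebra_simps)
        thus ?thesis by (metis power_int_mult power_int_numeral)
      qed
      moreover have "(2 * m + (int k + s + int r))^2 + ((int r - int k)^2 + (int n - int k)^2 + d * int r + b * int k + c * int n)
        = ((2 * m + int k + s)^2 + (int k)^2 + (int n - int k)^2 + b * int k + c * int n) + ((2 * (int r)^2 - 2 * int r) + 4 * (m + 1) * int r)"
        by (simp add: d_def power2_eq_square algebra_simps)
      ultimately have "q powi ((2 * m + (int k + s + int r))^2) * q powi ((int r - int k)^2 + (int n - int k)^2 + d * int r + b * int k + c * int n)
        = q powi ((2 * m + int k + s)^2 + (int k)^2 + (int n - int k)^2 + b * int k + c * int n) * (q^4) powi (int (r choose 2) + (m + 1) * int r)"
        by (simp only: add[symmetric])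
      thus ?thesis
        by (simp add: F_def base_def v reduced_term_def field_simps)
    qed
    hence "((\<lambda>r. F (m, r, k, n)) has_sum (base v * (if m < 0 then 0 else prod_p q / poch4 q (nat m)))) UNIV"
      by (simp only:) (intro has_sum_cmult_right euler_shifted_has_sum Q)
    thus "((\<lambda>r. (\<lambda>((m, k, n), r). F (m, r, k, n)) (v, r)) has_sum
        (base v * ?w v)) UNIV"
      by (cases "m < 0") (simp_all add: v)
  qed
  also have "?this \<longleftrightarrow> ((\<lambda>v. base v * ?w v) has_sum T)
      (range (\<lambda>(m, k, n). (int m, k, n)))"
  proof (rule has_sum_cong_neutral)
    fix v :: "int \<times> nat \<times> nat" assume v: "v \<in> UNIV - range (\<lambda>(m, k, n). (int m, k, n))"
    have "fst v < 0"
    proof (rule ccontr)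
      assume "\<not> fst v < 0"
      hence "v = (\<lambda>(m, k, n). (int m, k, n)) (nat (fst v), fst (snd v), snd (snd v))" by (simp add: prod_eq_iff)
      thus False using v by blast
    qed
    thus "base v * ?w v = 0" by simp
  qed auto
  also have "\<dots> \<longleftrightarrow> ((\<lambda>v. prod_p q * ?N v) has_sum T) UNIV"
    by (subst has_sum_reindex) (auto simp: inj_on_def o_def case_prod_unfold base_def mult_ac)
  finally have "((\<lambda>v. prod_p q * ?N v) has_sum T) UNIV" .
  hence "(?N has_sum (T / prod_p q)) UNIV"
    by (subst (asm) has_sum_cmult_right_iff) (rule nzi)
  thus ?thesis unfolding T1 d_def by (simp add: divide_divide_eq_left)
qed
section \<open>Five basic hypergeometric series evaluated by theta series\<close>

text \<open>\<open>(p;p)\<^bsub>2n\<^esub> = (p;p^2)\<^sub>n (p^2;p^2)\<^sub>n\<close>, with both factors split further by the difference of two squares; this is what lets the denominators of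
Bailey's lemma cancel.\<close>

lemma qpoch_double:
  assumes "t^2 = p"
  shows "qpoch p p (2 * n) = qpoch t p n * qpoch (- t) p n * qpoch p p n * qpoch (- p) p n"
    and "qpoch p p (2 * n + 1) = qpoch t p (n + 1) * qpoch (- t) p (n + 1) * qpoch p p n * qpoch (- p) p n"
proof -
  have o: "1 - p * p^(2 * n) = (1 - t * p^n) * (1 + t * p^n)" for n
  proof -
    have "(t * p^n)^2 = p * p^(2 * n)"
      by (simp add: power_mult_distrib assms mult.commute flip: power_mult)
    moreover have "(1 - u) * (1 + u) = 1 - u^2" for u :: complex
      by (simp add: algebra_simps power2_eq_square)
    ultimately show ?thesis by simp
  qed
  have e: "1 - p * p^(2 * n + 1) = (1 - p * p^n) * (1 + p * p^n)" for n
    unfolding mult_2 power_add by (simp add: algebra_simps)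
  show 1: "qpoch p p (2 * n) = qpoch t p n * qpoch (- t) p n * qpoch p p n * qpoch (- p) p n" for n
  proof (induction n)
    case (Suc n)
    have "qpoch p p (2 * Suc n) = qpoch p p (2 * n) * (1 - p * p^(2 * n)) * (1 - p * p^(2 * n + 1))"
      by (simp add: qpoch_Suc)
    thus ?case unfolding Suc o e by (simp add: qpoch_Suc mult_ac)
  qed simp
  show "qpoch p p (2 * n + 1) = qpoch t p (n + 1) * qpoch (- t) p (n + 1) * qpoch p p n * qpoch (- p) p n"
    using 1[of n] o[of n] by (simp add: qpoch_Suc mult_ac)
qed

text \<open>Heine's transformation followed by Bailey's lemma; what remains to be checked in each application is a termwise identity.\<close>

lemma heine_bailey_has_sum:
  assumes p: "norm p < 1" "p \<noteq> 0" and z: "norm z < 1" and c: "qpoch_inf c p \<noteq> 0" and x: "x \<noteq> 0" and s: "s \<le> 1"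
    and eq: "\<And>n. qpoch a p n * ((c * z)^n * p^(n * (n - 1))) * qpoch_inf (a * z * p^n) p / (qpoch p p n * qpoch c p n)
       = K * (p^(n * n + s * n) * qpoch (- x) p (n + s) * qpoch (- p / x) p n / qpoch p p (2 * n + s))"
  shows "((\<lambda>e. qpoch a p e * z^e / (qpoch p p e * qpoch c p e)) has_sum
      (K * theta (x * p^(1 - s)) (p^3) / (qpoch_inf p p * qpoch_inf z p))) UNIV"
proof -
  have "((\<lambda>n. qpoch a p n * ((c * z)^n * p^(n * (n - 1))) * qpoch_inf (a * z * p^n) p / (qpoch p p n * qpoch c p n))
     has_sum (K * (theta (x * p^(1 - s)) (p^3) / qpoch_inf p p))) UNIV"
    unfolding eq by (intro has_sum_cmult_right bailey_has_sum p x s)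
  from heine_has_sum[OF p(1) z c this] show ?thesis by simp
qed

text \<open>The series below have base \<open>p\<close>, but their parameters involve a square root of \<open>p\<close>. Both \<open>t = -q^2\<close> and \<open>t = q^2\<close> occur for
\<open>p = q^4\<close>.\<close>

locale half_base =
  fixes t p :: complex
  assumes p: "norm p < 1" "p \<noteq> 0" and tp: "t^2 = p"
begin

lemma t: "norm t < 1" "t \<noteq> 0" "t * t = p" "p / t = t"
proof -
  have "norm t^2 < 1" using p tp by (simp flip: norm_power)
  thus "norm t < 1" by (simp add: power_less_one_iff)
  show 1: "t \<noteq> 0" using p tp by auto
  show 2: "t * t = p" using tp by (simp add: power2_eq_square)
  show "p / t = t" using 1 unfolding 2[symmetric] by simp
qed

lemma nz: "qpoch_inf t p \<noteq> 0" "qpoch_inf (- t) p \<noteq> 0" "qpoch_inf p p \<noteq> 0" "qpoch_inf (- p) p \<noteq> 0"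
  "qpoch_inf (t * p) p \<noteq> 0"
proof -
  have "norm (t * p) < 1" using t(1) p(1) mult_strict_mono[of "norm t" 1 "norm p" 1] by (simp add: norm_mult)
  thus "qpoch_inf (t * p) p \<noteq> 0" using p by (intro qpoch_inf_nonzero) auto
  show "qpoch_inf t p \<noteq> 0" "qpoch_inf (- t) p \<noteq> 0" "qpoch_inf p p \<noteq> 0" "qpoch_inf (- p) p \<noteq> 0"
    by (rule qpoch_inf_nonzero; use t(1) p in simp)+
qed

lemma nzf: "qpoch t p n \<noteq> 0" "qpoch (- t) p n \<noteq> 0" "qpoch p p n \<noteq> 0" "qpoch (- p) p n \<noteq> 0" "qpoch (t * p) p n \<noteq> 0"
  by (intro qpoch_nonzero[OF p(1)] nz)+

text \<open>The three values of \<open>c z\<close> that occur in Heine's transformation; they are \<open>p\<close>, \<open>p^2\<close> and \<open>p^2\<close>.\<close>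

lemma pw: "(t * t)^n * p^(n * (n - 1)) = p^(n * n)" "(t * p * t)^n * p^(n * (n - 1)) = p^(n * n + n)"
   "((- p) * (- p))^n * p^(n * (n - 1)) = p^(n * n + n)"
proof -
  have 1: "p^n * p^(n * (n - 1)) = p^(n * n)" by (cases n) (simp_all flip: power_add)
  thus "(t * t)^n * p^(n * (n - 1)) = p^(n * n)" by (simp only: t(3))
  have "(p * p)^n * p^(n * (n - 1)) = p^(n * n + n)"
    using 1 by (simp add: power_mult_distrib power_add mult_ac)
  thus "((- p) * (- p))^n * p^(n * (n - 1)) = p^(n * n + n)" by simp
  show "(t * p * t)^n * p^(n * (n - 1)) = p^(n * n + n)"
    using \<open>(p * p)^n * p^(n * (n - 1)) = p^(n * n + n)\<close> by (metis mult.assoc mult.commute t(3))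
qed

lemma inf_shift: "qpoch_inf (a * p^n) p = qpoch_inf a p / qpoch a p n" if "qpoch a p n \<noteq> 0"
  using qpoch_inf_split[OF p(1), of a n] that by simp

lemma tail_Suc: "qpoch t p (Suc n) = (1 - t) * qpoch (t * p) p n"
  by (rule qpoch_Suc_left)

lemma one_minus_t: "1 - t \<noteq> 0"
  using t(1) by auto

lemma sum_even_1:
  "((\<lambda>e. t^e * qpoch (- 1) p e / (qpoch p p e * qpoch t p e)) has_sum
    (qpoch_inf (- t) p * theta p (p^3) / (qpoch_inf p p * qpoch_inf t p))) UNIV"
proof -
  have "((\<lambda>e. qpoch (- 1) p e * t^e / (qpoch p p e * qpoch t p e)) has_sum
    (qpoch_inf (- t) p * theta (1 * p^(1 - 0)) (p^3) / (qpoch_inf p p * qpoch_inf t p))) UNIV"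
  proof (rule heine_bailey_has_sum[OF p t(1) nz(1)])
    fix n
    have 1: "qpoch_inf (- 1 * t * p^n) p = qpoch_inf (- t) p / qpoch (- t) p n"
      using inf_shift[OF nzf(2)] by simp
    show "qpoch (- 1) p n * ((t * t)^n * p^(n * (n - 1))) * qpoch_inf (- 1 * t * p^n) p / (qpoch p p n * qpoch t p n)
      = qpoch_inf (- t) p * (p^(n * n + 0 * n) * qpoch (- 1) p (n + 0) * qpoch (- p / 1) p n / qpoch p p (2 * n + 0))"
      unfolding 1 pw add_0_right qpoch_double(1)[OF tp] using nzf by (simp add: field_simps)
  qed auto
  thus ?thesis by (simp add: mult_ac)
qed

lemma sum_even_t:
  "((\<lambda>e. t^e * qpoch (- t) p e / (qpoch p p e * qpoch t p e)) has_sum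
    (qpoch_inf (- p) p * theta (t * p) (p^3) / (qpoch_inf p p * qpoch_inf t p))) UNIV"
proof -
  have "((\<lambda>e. qpoch (- t) p e * t^e / (qpoch p p e * qpoch t p e)) has_sum
    (qpoch_inf (- p) p * theta (t * p^(1 - 0)) (p^3) / (qpoch_inf p p * qpoch_inf t p))) UNIV"
  proof (rule heine_bailey_has_sum[OF p t(1) nz(1)])
    fix n
    have 1: "qpoch_inf (- t * t * p^n) p = qpoch_inf (- p) p / qpoch (- p) p n"
      using inf_shift[OF nzf(4)] t(3) by (metis mult_minus_left)
    have 2: "- p / t = - t" using t(4) by simp
    show "qpoch (- t) p n * ((t * t)^n * p^(n * (n - 1))) * qpoch_inf (- t * t * p^n) p / (qpoch p p n * qpoch t p n)
      = qpoch_inf (- p) p * (p^(n * n + 0 * n) * qpoch (- t) p (n + 0) * qpoch (- p / t) p n / qpoch p p (2 * n + 0))"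
      unfolding 1 2 pw add_0_right qpoch_double(1)[OF tp] using nzf by (simp add: field_simps)
  qed (use t in auto)
  thus ?thesis by (simp add: mult_ac)
qed

lemma sum_odd_t:
  "((\<lambda>e. t^e * qpoch (- t) p e / (qpoch p p e * qpoch t p (Suc e))) has_sum
    (qpoch_inf (- p) p * theta t (p^3) / (qpoch_inf p p * qpoch_inf t p))) UNIV"
proof -
  have "((\<lambda>e. qpoch (- t) p e * t^e / (qpoch p p e * qpoch (t * p) p e)) has_sum
    ((1 - t) * qpoch_inf (- p) p * theta (t * p^(1 - 1)) (p^3) / (qpoch_inf p p * qpoch_inf t p))) UNIV"
  proof (rule heine_bailey_has_sum[OF p t(1) nz(5)])
    fix n
    have 1: "qpoch_inf (- t * t * p^n) p = qpoch_inf (- p) p / qpoch (- p) p n"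
      using inf_shift[OF nzf(4)] t(3) by (metis mult_minus_left)
    have 2: "- p / t = - t" using t(4) by simp
    show "qpoch (- t) p n * ((t * p * t)^n * p^(n * (n - 1))) * qpoch_inf (- t * t * p^n) p / (qpoch p p n * qpoch (t * p) p n)
      = (1 - t) * qpoch_inf (- p) p * (p^(n * n + 1 * n) * qpoch (- t) p (n + 1) * qpoch (- p / t) p n / qpoch p p (2 * n + 1))"
      unfolding 1 2 pw qpoch_double(2)[OF tp] using nzf nzf(2)[of "Suc n"] one_minus_t
      by (simp add: tail_Suc field_simps)
  qed (use t in auto)
  from has_sum_cmult_right[OF this, of "1 / (1 - t)"] show ?thesis
    using one_minus_t by (simp add: tail_Suc mult_ac)
qed

lemma sum_odd_1:
  "((\<lambda>e. t^e * qpoch (- p) p e / (qpoch p p e * qpoch t p (Suc e))) has_sum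
    (qpoch_inf (- t) p * theta 1 (p^3) / (2 * qpoch_inf p p * qpoch_inf t p))) UNIV"
proof -
  have "((\<lambda>e. qpoch (- p) p e * t^e / (qpoch p p e * qpoch (t * p) p e)) has_sum
    ((1 - t) * qpoch_inf (- t) p / 2 * theta (1 * p^(1 - 1)) (p^3) / (qpoch_inf p p * qpoch_inf t p))) UNIV"
  proof (rule heine_bailey_has_sum[OF p t(1) nz(5)])
    fix n
    have "- p * t * p^n = - t * p^Suc n" by simp
    hence 1: "qpoch_inf (- p * t * p^n) p = qpoch_inf (- t) p / qpoch (- t) p (Suc n)"
      using inf_shift[OF nzf(2)[of "Suc n"]] by (simp only:)
    have 2: "qpoch (- 1) p (n + 1) = 2 * qpoch (- p) p n" by (simp add: qpoch_Suc_left)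
    show "qpoch (- p) p n * ((t * p * t)^n * p^(n * (n - 1))) * qpoch_inf (- p * t * p^n) p / (qpoch p p n * qpoch (t * p) p n)
      = (1 - t) * qpoch_inf (- t) p / 2 * (p^(n * n + 1 * n) * qpoch (- 1) p (n + 1) * qpoch (- p / 1) p n / qpoch p p (2 * n + 1))"
      unfolding 1 2 pw qpoch_double(2)[OF tp] using nzf nzf(2)[of "Suc n"] one_minus_t
      by (simp add: tail_Suc field_simps)
  qed (use t in auto)
  from has_sum_cmult_right[OF this, of "1 / (1 - t)"] show ?thesis
    using one_minus_t by (simp add: tail_Suc mult_ac)
qed

lemma sum_minus_p:
  "((\<lambda>e. (- p)^e * qpoch (- t) p e / (qpoch p p e * qpoch (- p) p e)) has_sum
    (qpoch_inf t p * theta t (p^3) / (qpoch_inf p p * qpoch_inf (- p) p))) UNIV"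
proof -
  have "((\<lambda>e. qpoch (- t) p e * (- p)^e / (qpoch p p e * qpoch (- p) p e)) has_sum
    (qpoch_inf t p * theta (t * p^(1 - 1)) (p^3) / (qpoch_inf p p * qpoch_inf (- p) p))) UNIV"
  proof (rule heine_bailey_has_sum[OF p _ nz(4)])
    fix n
    have "- t * - p * p^n = t * p^Suc n" by simp
    hence 1: "qpoch_inf (- t * - p * p^n) p = qpoch_inf t p / qpoch t p (Suc n)"
      using inf_shift[OF nzf(1)[of "Suc n"]] by (simp only:)
    have 2: "- p / t = - t" using t(4) by simp
    show "qpoch (- t) p n * (((- p) * (- p))^n * p^(n * (n - 1))) * qpoch_inf (- t * - p * p^n) p / (qpoch p p n * qpoch (- p) p n)
      = qpoch_inf t p * (p^(n * n + 1 * n) * qpoch (- t) p (n + 1) * qpoch (- p / t) p n / qpoch p p (2 * n + 1))"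
      unfolding 1 2 pw qpoch_double(2)[OF tp] using nzf nzf(2)[of "Suc n"]  nzf(1)[of "Suc n"]
      by (simp add: field_simps)
  qed (use t p in auto)
  thus ?thesis by (simp add: mult_ac)
qed

end

section \<open>The reduced sums in closed form\<close>

lemma qpoch_reflect_split:
  assumes "p \<noteq> 0" "a \<noteq> 0"
  shows "qpoch (a / p^e) p (e + j) = (- a)^e * qpoch (p / a) p e * qpoch a p j / p^(Suc e choose 2)"
  using qpoch_reflect[OF assms, of e] qpoch_add[of "a / p^e" p e j] assms by (simp add: field_simps)

text \<open>The infinite counterpart: only the factors with negative exponent are reflected.\<close>

lemma qpoch_inf_reflect_split:
  assumes "norm p < 1" "p \<noteq> 0" "a \<noteq> 0"
  shows "qpoch_inf (a / p^e) p = (- a)^e * qpoch (p / a) p e * qpoch_inf a p / p^(Suc e choose 2)"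
  using qpoch_reflect[OF assms(2,3), of e] qpoch_inf_split[OF assms(1), of "a / p^e" e] assms by (simp add: field_simps)

lemma qpoch_inf_minus_one: "norm p < 1 \<Longrightarrow> qpoch_inf (- 1) p = 2 * qpoch_inf (- p) p"
  using qpoch_inf_split[of p "-1" 1] by (simp add: qpoch_Suc)

lemma qpoch_eq_0: "a * p^k = 1 \<Longrightarrow> k < n \<Longrightarrow> qpoch a p n = 0"
  by (auto simp: qpoch_def intro!: bexI[of _ k])

context
  fixes q :: complex
  assumes q: "norm q < 1" "q \<noteq> 0"
begin

interpretation half_base "- (q^2)" "q^4"
  using q by unfold_locales (simp_all add: norm_power power_less_one_iff flip: power_mult)

lemma q_add: "q powi a * q powi b = q powi (a + b)"
  using q by (simp add: power_int_add)

lemma q_tri: "(q^4)^(Suc e choose 2) = q powi (2 * int e * int e + 2 * int e)"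
  unfolding power4_choose[OF q(2)] by (rule arg_cong[of _ _ "\<lambda>z. q powi z"]) (simp add: power2_eq_square algebra_simps)

text \<open>The base points that occur after the index \<open>l\<close> is specialised to \<open>2 e\<close> or \<open>2 e + 1\<close>.\<close>

lemma q_base:
  "q powi (2 - 4 * int e) = q^2 / (q^4)^e" "q powi (4 - 4 * int e) = q^4 / (q^4)^e"
  "q powi (- (4 * int e)) = 1 / (q^4)^e" "q powi (- 2 - 4 * int e) = q^2 / (q^4)^Suc e"
proof -
  have e: "q powi (4 * int e) = (q^4)^e" for e
    by (simp only: power_int_mult power_int_of_nat power_int_numeral)
  show q2: "q powi (2 - 4 * int e) = q^2 / (q^4)^e" for e
    using q by (simp only: power_int_diff e power_int_numeral simp_thms)
  show "q powi (4 - 4 * int e) = q^4 / (q^4)^e"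
    using q by (simp only: power_int_diff e power_int_numeral simp_thms)
  show "q powi (- (4 * int e)) = 1 / (q^4)^e"
    by (simp only: power_int_minus_divide e)
  have "- 2 - 4 * int e = 2 - 4 * int (Suc e)" by simp
  thus "q powi (- 2 - 4 * int e) = q^2 / (q^4)^Suc e"
    using q2[of "Suc e"] by (simp only:)
qed

lemma base_quot: "q^4 / q^2 = q^2" "q^4 / - (q^2) = - (q^2)" "q^4 / (- 1) = - (q^4)" "q^4 / - (q^4) = - 1"
  using q by (simp_all add: power2_eq_square eval_nat_numeral)

lemmas reflect = qpoch_reflect_split[OF p(2)] qpoch_inf_reflect_split[OF p]

text \<open>For even \<open>l > 0\<close> the finite product contains the factor \<open>1 - q^0\<close>. The term at \<open>l = 0\<close> gives the isolated product, and the
odd terms form a \<open>\<^sub>2\<phi>\<^sub>1\<close> series.\<close>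

lemma reduced_sum_first_plus:
  "reduced_sum q 0 0 2 1 = prod_b q + 2 * q * prod_c q *
     (prod_c q * theta (- (q^2)) ((q^4)^3) / (prod_p q * prod_b q))" (is "_ = _ + ?S")
proof -
  define f where "f l = q powi ((int l)^2 + 0 * int l) * qpoch (1 * q powi (2 - 2 * int l + 2 - 0)) (q^4) l
     * qpoch_inf (- 1 * q powi (2 + 0 - 2 * int l)) (q^4) / poch4 q l" for l
  have H1: "(f has_sum reduced_sum q 0 0 2 1) UNIV"
    unfolding f_def by (rule reduced_sum_single_series[OF q]) auto
  have H2: "(f has_sum (f 0 + ?S)) UNIV"
  proof (rule has_sum_odd_index)
    fix e
    have "2 - 2 * int (2 * e + 2) + 2 - 0 = - (4 * int e)" by simp
    hence "qpoch (1 * q powi (2 - 2 * int (2 * e + 2) + 2 - 0)) (q^4) (2 * e + 2) = 0"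
      using q by (intro qpoch_eq_0[of _ _ e]) (simp_all only: q_base, simp_all)
    thus "f (2 * e + 2) = 0" by (simp add: f_def)
  next
    have "f (2 * e + 1) = 2 * q * prod_c q *
       ((- (q^2))^e * qpoch (- (- (q^2))) (q^4) e / (poch4 q e * qpoch (- (q^2)) (q^4) (Suc e)))" for e
    proof -
      define c where "c = (q^4)^(Suc e choose 2)"
      have c: "c \<noteq> 0" using q by (simp add: c_def)
      have 1: "q powi ((int (2 * e + 1))^2 + 0 * int (2 * e + 1)) = q * c * c"
      proof -
        have "q * c * c = q powi 1 * q powi (2 * int e * int e + 2 * int e) * q powi (2 * int e * int e + 2 * int e)"
          by (simp add: c_def q_tri)
        thus ?thesis unfolding q_add by (simp add: power2_eq_square algebra_simps)
      qed
      have 2: "1 * q powi (2 - 2 * int (2 * e + 1) + 2 - 0) = q^2 / (q^4)^e"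
        unfolding q_base[symmetric] by simp
      have 3: "- 1 * q powi (2 + 0 - 2 * int (2 * e + 1)) = (- 1) / (q^4)^e"
        using q_base(3)[of e] by simp
      have 4: "qpoch (q^2 / (q^4)^e) (q^4) (2 * e + 1) = (- (q^2))^e * qpoch (q^2) (q^4) e * qpoch (q^2) (q^4) (Suc e) / c"
        using reflect(1)[of "q^2" e "Suc e"] q by (simp add: base_quot c_def mult_2)
      have 5: "qpoch_inf ((- 1) / (q^4)^e) (q^4) = qpoch (- (q^4)) (q^4) e * (2 * prod_c q) / c"
        using reflect(2)[of "- 1" e] unfolding base_quot qpoch_inf_minus_one[OF p(1)] c_def by simp
      show ?thesis
        unfolding f_def 1 2 3 4 5 qpoch_double(2)[OF tp] using c nzf nzf(1)[of "Suc e"] nzf(2)[of "Suc e"]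
        by (simp add: field_simps)
    qed
    thus "((\<lambda>e. f (2 * e + 1)) has_sum (?S)) UNIV"
      by (simp only:) (intro has_sum_cmult_right sum_odd_t)
  qed
  have "f 0 = prod_b q" by (simp add: f_def)
  thus ?thesis using has_sum_unique[OF H1 H2] by (simp only:)
qed

text \<open>Here the infinite product vanishes for odd \<open>l\<close>.\<close>

lemma reduced_sum_first_minus:
  "reduced_sum q 0 0 2 (-1) = prod_a q *
     (prod_a q * theta (q^4) ((q^4)^3) / (prod_p q * prod_b q))"
proof -
  define f where "f l = q powi ((int l)^2 + 0 * int l) * qpoch (- 1 * q powi (2 - 2 * int l + 2 - 0)) (q^4) l
     * qpoch_inf (- (- 1) * q powi (2 + 0 - 2 * int l)) (q^4) / poch4 q l" for l
  have H1: "(f has_sum reduced_sum q 0 0 2 (-1)) UNIV"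
    unfolding f_def by (rule reduced_sum_single_series[OF q]) auto
  have H2: "(f has_sum (prod_a q *
     (qpoch_inf (- (- (q^2))) (q^4) * theta (q^4) ((q^4)^3) / (prod_p q * prod_b q)))) UNIV"
  proof (subst has_sum_even_index)
    fix e
    have "2 + 0 - 2 * int (2 * e + 1) = - (4 * int e)" by simp
    hence "qpoch_inf (- (- 1) * q powi (2 + 0 - 2 * int (2 * e + 1))) (q^4) = 0"
      unfolding qpoch_inf_eq_0_iff[OF p(1)] using q by (intro exI[of _ e]) (simp only: q_base, simp)
    thus "f (2 * e + 1) = 0" by (simp add: f_def)
  next
    have "f (2 * e) = prod_a q *
       ((- (q^2))^e * qpoch (- 1) (q^4) e / (poch4 q e * qpoch (- (q^2)) (q^4) e))" for e
    proof -
      define c where "c = (q^4)^(Suc e choose 2)"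
      have c: "c \<noteq> 0" using q by (simp add: c_def)
      have 1: "q powi ((int (2 * e))^2 + 0 * int (2 * e)) * (q^4)^e = c * c"
      proof -
        have "(q^4)^e = q powi (4 * int e)" by (simp only: power_int_mult power_int_of_nat power_int_numeral)
        moreover have "c * c = q powi (2 * int e * int e + 2 * int e) * q powi (2 * int e * int e + 2 * int e)"
          by (simp add: c_def q_tri)
        ultimately show ?thesis unfolding q_add by (simp only: q_add) (simp add: power2_eq_square algebra_simps)
      qed
      have 2: "- 1 * q powi (2 - 2 * int (2 * e) + 2 - 0) = - (q^4) / (q^4)^e"
        using q_base(2)[of e] by simp
      have 3: "- (- 1) * q powi (2 + 0 - 2 * int (2 * e)) = q^2 / (q^4)^e"
        using q_base(1)[of e] by simp
      have 4: "qpoch (- (q^4) / (q^4)^e) (q^4) (2 * e) = (q^4)^e * qpoch (- 1) (q^4) e * qpoch (- (q^4)) (q^4) e / c"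
        using reflect(1)[of "- (q^4)" e e] q by (simp only: base_quot c_def mult_2 minus_minus) simp
      have 5: "qpoch_inf (q^2 / (q^4)^e) (q^4) = (- (q^2))^e * qpoch (q^2) (q^4) e * prod_a q / c"
        using reflect(2)[of "q^2" e] q by (simp add: base_quot c_def)
      have "f (2 * e) = (q powi ((int (2 * e))^2 + 0 * int (2 * e)) * (q^4)^e) * (qpoch (- 1) (q^4) e * qpoch (- (q^4)) (q^4) e / c)
         * ((- (q^2))^e * qpoch (q^2) (q^4) e * prod_a q / c) / poch4 q (2 * e)"
        unfolding f_def 2 3 4 5 by simp
      thus ?thesis
        unfolding 1 qpoch_double(1)[OF tp] using c nzf by (simp add: field_simps)
    qed
    thus "((\<lambda>e. f (2 * e)) has_sum (prod_a q *
     (qpoch_inf (- (- (q^2))) (q^4) * theta (q^4) ((q^4)^3) / (prod_p q * prod_b q)))) UNIV"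
      by (simp only:) (intro has_sum_cmult_right sum_even_1)
  qed
  show ?thesis using has_sum_unique[OF H1 H2] by (simp only: minus_minus)
qed

text \<open>Reversing the order of the factors in the finite product: the single series of the fourth identity is that of the first with the
sign \<open>(-e)^l\<close>. This corresponds to exchanging the roles of \<open>r\<close> and \<open>n\<close>.\<close>

lemma reduced_sum_fourth_term:
  assumes "e = 1 \<or> e = (-1 :: complex)"
  shows "q powi ((int l)^2 + 2 * int l) * qpoch (e * q powi (2 - 2 * int l + 0 - 2)) (q^4) l
     = (- e)^l * (q powi ((int l)^2 + 0 * int l) * qpoch (e * q powi (2 - 2 * int l + 2 - 0)) (q^4) l)"
proof -
  define a where "a = e * q powi (2 * int l)"
  have e: "e \<noteq> 0" "inverse e = e" using assms by auto
  have a: "a \<noteq> 0" using q e by (simp add: a_def)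
  have l4: "(q^4)^l = q powi (4 * int l)" by (simp only: power_int_mult power_int_of_nat power_int_numeral)
  have 1: "a / (q^4)^l = e * q powi (2 - 2 * int l + 0 - 2)"
  proof -
    have "a / (q^4)^l = e * (q powi (2 * int l) / q powi (4 * int l))" by (simp add: a_def l4)
    also have "q powi (2 * int l) / q powi (4 * int l) = q powi (2 * int l - 4 * int l)"
      using q by (simp only: power_int_diff simp_thms)
    finally show ?thesis by simp
  qed
  have 2: "q^4 / a = e * q powi (2 - 2 * int l + 2 - 0)"
  proof -
    have "q^4 / a = inverse e * (q powi 4 / q powi (2 * int l))" by (simp add: a_def field_simps)
    also have "q powi 4 / q powi (2 * int l) = q powi (4 - 2 * int l)"
      using q by (simp only: power_int_diff simp_thms)
    finally show ?thesis by (simp add: e)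
  qed
  have 3: "(- a)^l = (- e)^l * q powi (2 * int l * int l)"
  proof -
    have "- a = - e * q powi (2 * int l)" by (simp add: a_def)
    thus ?thesis by (simp only: power_mult_distrib power_int_power')
  qed
  have 4: "q powi ((int l)^2 + 2 * int l) * q powi (2 * int l * int l) = q powi ((int l)^2 + 0 * int l) * (q^4)^(Suc l choose 2)"
    unfolding q_tri q_add by (simp add: algebra_simps)
  have "q powi ((int l)^2 + 2 * int l) * (qpoch (a / (q^4)^l) (q^4) l * (q^4)^(Suc l choose 2))
      = q powi ((int l)^2 + 2 * int l) * ((- a)^l * qpoch (q^4 / a) (q^4) l)"
    by (simp only: qpoch_reflect[OF p(2) a])
  also have "\<dots> = (q powi ((int l)^2 + 2 * int l) * q powi (2 * int l * int l)) * ((- e)^l * qpoch (q^4 / a) (q^4) l)"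
    unfolding 3 by (simp only: mult_ac)
  finally have "(q^4)^(Suc l choose 2) * (q powi ((int l)^2 + 2 * int l) * qpoch (e * q powi (2 - 2 * int l + 0 - 2)) (q^4) l)
     = (q^4)^(Suc l choose 2) * ((- e)^l * (q powi ((int l)^2 + 0 * int l) * qpoch (e * q powi (2 - 2 * int l + 2 - 0)) (q^4) l))"
    unfolding 4 1 2 by (simp only: mult_ac)
  thus ?thesis by (subst (asm) mult_left_cancel) (use q in auto)
qed

lemma reduced_sum_fourth_minus: "reduced_sum q 0 2 0 (-1) = reduced_sum q 0 0 2 (-1)"
proof -
  have H1: "((\<lambda>l. q powi ((int l)^2 + 2 * int l) * qpoch (- 1 * q powi (2 - 2 * int l + 0 - 2)) (q^4) l
     * qpoch_inf (- (- 1) * q powi (2 + 0 - 2 * int l)) (q^4) / poch4 q l) has_sum reduced_sum q 0 2 0 (-1)) UNIV"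
    by (rule reduced_sum_single_series[OF q]) auto
  have H2: "((\<lambda>l. q powi ((int l)^2 + 0 * int l) * qpoch (- 1 * q powi (2 - 2 * int l + 2 - 0)) (q^4) l
     * qpoch_inf (- (- 1) * q powi (2 + 0 - 2 * int l)) (q^4) / poch4 q l) has_sum reduced_sum q 0 0 2 (-1)) UNIV"
    by (rule reduced_sum_single_series[OF q]) auto
  have H3: "q powi ((int l)^2 + 2 * int l) * qpoch (- 1 * q powi (2 - 2 * int l + 0 - 2)) (q^4) l
     = q powi ((int l)^2 + 0 * int l) * qpoch (- 1 * q powi (2 - 2 * int l + 2 - 0)) (q^4) l" for l
    by (subst reduced_sum_fourth_term) auto
  show ?thesis by (rule has_sum_unique[OF H1[unfolded H3] H2])
qed

text \<open>The series of the first and the fourth identity differ in the sign of the odd terms, and among the even ones only \<open>l = 0\<close> contributes.\<close>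

lemma reduced_sum_fourth_plus: "reduced_sum q 0 2 0 1 + reduced_sum q 0 0 2 1 = 2 * prod_b q"
proof -
  define f where "f l = q powi ((int l)^2 + 0 * int l) * qpoch (1 * q powi (2 - 2 * int l + 2 - 0)) (q^4) l
     * qpoch_inf (- 1 * q powi (2 + 0 - 2 * int l)) (q^4) / poch4 q l" for l
  have 1: "(f has_sum reduced_sum q 0 0 2 1) UNIV"
    unfolding f_def by (rule reduced_sum_single_series[OF q]) auto
  have "((\<lambda>l. q powi ((int l)^2 + 2 * int l) * qpoch (1 * q powi (2 - 2 * int l + 0 - 2)) (q^4) l
     * qpoch_inf (- 1 * q powi (2 + 0 - 2 * int l)) (q^4) / poch4 q l) has_sum reduced_sum q 0 2 0 1) UNIV"
    by (rule reduced_sum_single_series[OF q]) auto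
  also have "(\<lambda>l. q powi ((int l)^2 + 2 * int l) * qpoch (1 * q powi (2 - 2 * int l + 0 - 2)) (q^4) l
     * qpoch_inf (- 1 * q powi (2 + 0 - 2 * int l)) (q^4) / poch4 q l) = (\<lambda>l. (-1)^l * f l)"
    unfolding f_def by (subst reduced_sum_fourth_term) (auto simp: mult_ac)
  finally have 2: "((\<lambda>l. (-1)^l * f l + f l) has_sum (reduced_sum q 0 2 0 1 + reduced_sum q 0 0 2 1)) UNIV"
    using 1 by (rule has_sum_add)
  have "((\<lambda>l. (-1)^l * f l + f l) has_sum 2 * prod_b q) UNIV"
  proof (rule has_sum_finite_neutralI[of "{0}"])
    fix l :: nat assume l: "l \<in> UNIV - {0}"
    show "(-1)^l * f l + f l = 0"
    proof (cases "even l")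
      case True
      then obtain m where m: "l = 2 * m" by (auto elim!: evenE)
      with l obtain e where "m = Suc e" by (cases m) auto
      with m have le: "l = 2 * e + 2" by simp
      have "2 - 2 * int (2 * e + 2) + 2 - 0 = - (4 * int e)" by simp
      hence "qpoch (1 * q powi (2 - 2 * int (2 * e + 2) + 2 - 0)) (q^4) (2 * e + 2) = 0"
        using q by (intro qpoch_eq_0[of _ _ e]) (simp_all only: q_base, simp_all)
      thus ?thesis by (simp add: f_def le)
    qed simp
  qed (simp_all add: f_def)
  thus ?thesis by (rule has_sum_unique[OF 2])
qed

lemma reduced_sum_second_plus:
  "reduced_sum q (-2) 2 2 1 = 2 * prod_c q *
     (prod_c q * theta (- (q^2) * q^4) ((q^4)^3) / (prod_p q * prod_b q))" (is "_ = ?S")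
proof -
  define f where "f l = q powi ((int l)^2 + 2 * int l) * qpoch (1 * q powi (2 - 2 * int l + 2 - 2)) (q^4) l
     * qpoch_inf (- 1 * q powi (2 + (- 2) - 2 * int l)) (q^4) / poch4 q l" for l
  have H1: "(f has_sum reduced_sum q (-2) 2 2 1) UNIV"
    unfolding f_def by (rule reduced_sum_single_series[OF q]) auto
  have H2: "(f has_sum (?S)) UNIV"
  proof (subst has_sum_even_index)
    fix e
    have "2 - 2 * int (2 * e + 1) + 2 - 2 = - (4 * int e)" by simp
    hence "qpoch (1 * q powi (2 - 2 * int (2 * e + 1) + 2 - 2)) (q^4) (2 * e + 1) = 0"
      using q by (intro qpoch_eq_0[of _ _ e]) (simp_all only: q_base, simp_all)
    thus "f (2 * e + 1) = 0" by (simp add: f_def)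
  next
    have "f (2 * e) = 2 * prod_c q *
       ((- (q^2))^e * qpoch (- (- (q^2))) (q^4) e / (poch4 q e * qpoch (- (q^2)) (q^4) e))" for e
    proof -
      define c where "c = (q^4)^(Suc e choose 2)"
      have c: "c \<noteq> 0" using q by (simp add: c_def)
      have 1: "q powi ((int (2 * e))^2 + 2 * int (2 * e)) = c * c"
        unfolding c_def q_tri q_add by (simp add: power2_eq_square algebra_simps)
      have 2: "1 * q powi (2 - 2 * int (2 * e) + 2 - 2) = q^2 / (q^4)^e"
        using q_base(1)[of e] by simp
      have 3: "- 1 * q powi (2 + (- 2) - 2 * int (2 * e)) = (- 1) / (q^4)^e"
        using q_base(3)[of e] by simp
      have 4: "qpoch (q^2 / (q^4)^e) (q^4) (2 * e) = (- (q^2))^e * qpoch (q^2) (q^4) e * qpoch (q^2) (q^4) e / c"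
        using reflect(1)[of "q^2" e e] q by (simp add: base_quot c_def mult_2)
      have 5: "qpoch_inf ((- 1) / (q^4)^e) (q^4) = qpoch (- (q^4)) (q^4) e * (2 * prod_c q) / c"
        using reflect(2)[of "- 1" e] unfolding base_quot qpoch_inf_minus_one[OF p(1)] c_def by simp
      show ?thesis
        unfolding f_def 1 2 3 4 5 qpoch_double(1)[OF tp] using c nzf by (simp add: field_simps)
    qed
    thus "((\<lambda>e. f (2 * e)) has_sum (?S)) UNIV"
      by (simp only:) (intro has_sum_cmult_right sum_even_t)
  qed
  show ?thesis using has_sum_unique[OF H1 H2] .
qed

lemma reduced_sum_second_minus:
  "reduced_sum q (-2) 2 2 (-1) = - (2 * q) * prod_a q *
     (prod_a q * theta 1 ((q^4)^3) / (2 * prod_p q * prod_b q))"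
proof -
  define f where "f l = q powi ((int l)^2 + 2 * int l) * qpoch (- 1 * q powi (2 - 2 * int l + 2 - 2)) (q^4) l
     * qpoch_inf (- (- 1) * q powi (2 + (- 2) - 2 * int l)) (q^4) / poch4 q l" for l
  have ze: "qpoch_inf (- (- 1) * q powi (2 + (- 2) - 2 * int (2 * e))) (q^4) = 0" for e
  proof -
    have "2 + (- 2) - 2 * int (2 * e) = - (4 * int e)" by simp
    thus ?thesis
      unfolding qpoch_inf_eq_0_iff[OF p(1)] using q by (intro exI[of _ e]) (simp only: q_base, simp)
  qed
  have H1: "(f has_sum reduced_sum q (-2) 2 2 (-1)) UNIV"
    unfolding f_def by (rule reduced_sum_single_series[OF q]) auto
  have H2: "(f has_sum (f 0 + - (2 * q) * prod_a q *
     (qpoch_inf (- (- (q^2))) (q^4) * theta 1 ((q^4)^3) / (2 * prod_p q * prod_b q)))) UNIV"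
  proof (rule has_sum_odd_index)
    show "f (2 * e + 2) = 0" for e
      using ze[of "Suc e"] unfolding f_def by (simp only: mult_Suc_right add.commute[of 2] mult_zero_right div_0)
  next
    have "f (2 * e + 1) = - (2 * q) * prod_a q *
       ((- (q^2))^e * qpoch (- (q^4)) (q^4) e / (poch4 q e * qpoch (- (q^2)) (q^4) (Suc e)))" for e
    proof -
      define c where "c = (q^4)^(Suc e choose 2)"
      define c' where "c' = (q^4)^(Suc (Suc e) choose 2)"
      have c: "c \<noteq> 0" "c' \<noteq> 0" using q by (simp_all add: c_def c'_def)
      have 1: "q powi ((int (2 * e + 1))^2 + 2 * int (2 * e + 1)) * q = c * c'"
      proof -
        have "q powi ((int (2 * e + 1))^2 + 2 * int (2 * e + 1)) * q = q powi ((int (2 * e + 1))^2 + 2 * int (2 * e + 1)) * q powi 1" by simp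
        also have "\<dots> = c * c'" unfolding c_def c'_def q_tri q_add by (simp add: power2_eq_square algebra_simps)
        finally show ?thesis .
      qed
      have 2: "- 1 * q powi (2 - 2 * int (2 * e + 1) + 2 - 2) = (- 1) / (q^4)^e"
        using q_base(3)[of e] by simp
      have 3: "- (- 1) * q powi (2 + (- 2) - 2 * int (2 * e + 1)) = q^2 / (q^4)^Suc e"
        using q_base(4)[of e] by simp
      have 4: "qpoch ((- 1) / (q^4)^e) (q^4) (2 * e + 1) = qpoch (- (q^4)) (q^4) e * (2 * qpoch (- (q^4)) (q^4) e) / c"
      proof -
        have s: "qpoch (- 1) (q^4) (Suc e) = 2 * qpoch (- (q^4)) (q^4) e" "e + Suc e = 2 * e + 1"
          by (simp_all add: qpoch_Suc_left)
        show ?thesis using reflect(1)[of "- 1" e "Suc e"] unfolding s base_quot c_def by simp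
      qed
      have 5: "qpoch_inf (q^2 / (q^4)^Suc e) (q^4) = (- (q^2))^Suc e * qpoch (q^2) (q^4) (Suc e) * prod_a q / c'"
        using reflect(2)[of "q^2" "Suc e"] q unfolding c'_def base_quot by simp
      have "f (2 * e + 1) = (q powi ((int (2 * e + 1))^2 + 2 * int (2 * e + 1)) * q) * (qpoch (- (q^4)) (q^4) e * (2 * qpoch (- (q^4)) (q^4) e) / c)
          * (- q * (- (q^2))^e * qpoch (q^2) (q^4) (Suc e) * prod_a q / c') / poch4 q (2 * e + 1)"
        unfolding f_def 2 3 4 5 by (simp add: power2_eq_square)
      thus ?thesis
        unfolding 1 qpoch_double(2)[OF tp] using c nzf nzf(1)[of "Suc e"] nzf(2)[of "Suc e"]
        by (simp add: field_simps)
    qed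
    thus "((\<lambda>e. f (2 * e + 1)) has_sum (- (2 * q) * prod_a q *
     (qpoch_inf (- (- (q^2))) (q^4) * theta 1 ((q^4)^3) / (2 * prod_p q * prod_b q)))) UNIV"
      by (simp only:) (intro has_sum_cmult_right sum_odd_1)
  qed
  have "f 0 = 0" using ze[of 0] by (simp add: f_def)
  thus ?thesis using has_sum_unique[OF H1 H2] by (simp only: minus_minus add_0_left)
qed

text \<open>Either the finite or the infinite product vanishes for odd \<open>l\<close>, according to the sign of \<open>e\<close>.\<close>

lemma reduced_sum_third:
  assumes e: "e = 1 \<or> e = (-1 :: complex)"
  shows "reduced_sum q 0 2 2 e = qpoch_inf (- e * q^2) (q^4) *
     (qpoch_inf (- e * q^2) (q^4) * theta (- e * q^2) ((q^4)^3) / (prod_p q * prod_c q))" (is "_ = ?S")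
proof -
  have ee: "e * e = 1" "e \<noteq> 0" using e by auto
  interpret H: half_base "- e * q^2" "q^4"
  proof
    have "(- e * q^2)^2 = (e * e) * q^4" by (simp add: power2_eq_square eval_nat_numeral)
    thus "(- e * q^2)^2 = q^4" by (simp add: ee)
  qed (use p in auto)
  define f where "f l = q powi ((int l)^2 + 2 * int l) * qpoch (e * q powi (2 - 2 * int l + 2 - 2)) (q^4) l
     * qpoch_inf (- e * q powi (2 + 0 - 2 * int l)) (q^4) / poch4 q l" for l
  have H1: "(f has_sum reduced_sum q 0 2 2 e) UNIV"
    unfolding f_def by (rule reduced_sum_single_series[OF q]) (use e in auto)
  have H2: "(f has_sum (?S)) UNIV"
  proof (subst has_sum_even_index)
    fix j
    have "2 - 2 * int (2 * j + 1) + 2 - 2 = - (4 * int j)" "2 + 0 - 2 * int (2 * j + 1) = - (4 * int j)" by simp_all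
    hence 1: "q powi (2 - 2 * int (2 * j + 1) + 2 - 2) = 1 / (q^4)^j" "q powi (2 + 0 - 2 * int (2 * j + 1)) = 1 / (q^4)^j"
      by (simp_all only: q_base)
    show "f (2 * j + 1) = 0"
    proof (cases "e = 1")
      case True
      hence "qpoch (e * (1 / (q^4)^j)) (q^4) (2 * j + 1) = 0"
        using q by (intro qpoch_eq_0[of _ _ j]) auto
      thus ?thesis unfolding f_def 1 by simp
    next
      case False
      hence "e = -1" using e by simp
      hence "qpoch_inf (- e * (1 / (q^4)^j)) (q^4) = 0"
        unfolding qpoch_inf_eq_0_iff[OF p(1)] using q by (intro exI[of _ j]) auto
      thus ?thesis unfolding f_def 1 by simp
    qed
  next
    have "f (2 * j) = qpoch_inf (- e * q^2) (q^4) *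
       ((- (q^4))^j * qpoch (- (- e * q^2)) (q^4) j / (poch4 q j * qpoch (- (q^4)) (q^4) j))" for j
    proof -
      define c where "c = (q^4)^(Suc j choose 2)"
      have c: "c \<noteq> 0" using q by (simp add: c_def)
      have 1: "q powi ((int (2 * j))^2 + 2 * int (2 * j)) = c * c"
        unfolding c_def q_tri q_add by (simp add: power2_eq_square algebra_simps)
      have 2: "e * q powi (2 - 2 * int (2 * j) + 2 - 2) = (e * q^2) / (q^4)^j"
        using q_base(1)[of j] by simp
      have 3: "- e * q powi (2 + 0 - 2 * int (2 * j)) = (- e * q^2) / (q^4)^j"
        using q_base(1)[of j] by simp
      have b: "q^4 / (e * q^2) = e * q^2" "q^4 / (- e * q^2) = - e * q^2"
        using H.t(4) by (auto simp: field_simps)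
      have 4: "qpoch ((e * q^2) / (q^4)^j) (q^4) (2 * j) = (- (e * q^2))^j * qpoch (e * q^2) (q^4) j * qpoch (e * q^2) (q^4) j / c"
        using reflect(1)[of "e * q^2" j j] q ee unfolding b c_def mult_2 by simp
      have 5: "qpoch_inf ((- e * q^2) / (q^4)^j) (q^4) = (e * q^2)^j * qpoch (- e * q^2) (q^4) j * qpoch_inf (- e * q^2) (q^4) / c"
        using reflect(2)[of "- e * q^2" j] q ee unfolding b c_def by simp
      have 6: "(- (e * q^2))^j * (e * q^2)^j = (- (q^4))^j"
        using H.t(3) by (simp flip: power_mult_distrib)
      have "f (2 * j) = (c * c) * (qpoch (e * q^2) (q^4) j * qpoch (e * q^2) (q^4) j / c)
        * (((- (e * q^2))^j * (e * q^2)^j) * qpoch (- e * q^2) (q^4) j * qpoch_inf (- e * q^2) (q^4) / c) / poch4 q (2 * j)"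
        unfolding f_def 1 2 3 4 5 by simp
      thus ?thesis
        unfolding 6 qpoch_double(1)[OF H.tp] using c H.nzf(1)[of j] H.nzf(2)[of j] H.nzf(3)[of j] H.nzf(4)[of j] by (simp add: field_simps)
    qed
    thus "((\<lambda>j. f (2 * j)) has_sum (?S)) UNIV"
      by (simp only:) (intro has_sum_cmult_right H.sum_minus_p)
  qed
  show ?thesis using has_sum_unique[OF H1 H2] .
qed

end
section \<open>Theta identities from changes of lattice basis\<close>

text \<open>Adding or subtracting the product of the two series and that of their alternating twists restricts the double sum to \<open>m \<equiv> n\<close> or
\<open>m \<equiv> n + 1\<close> modulo 2. These cosets are parametrised by \<open>m = n + 2 v\<close> and \<open>m = n + 2 v - 1\<close>; the inner sum is taken over \<open>n\<close>.
In the applications it can be evaluated for each \<open>v\<close>, because \<open>(n + 2 v)^2 + 3 n^2 = (2 n + v)^2 + 3 v^2\<close>.\<close>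

lemma lattice_sums:
  fixes f h :: "int \<Rightarrow> complex"
  assumes f: "(f has_sum a) UNIV" and h: "(h has_sum b) UNIV"
    and f': "((\<lambda>n. (-1) powi n * f n) has_sum a') UNIV" and h': "((\<lambda>n. (-1) powi n * h n) has_sum b') UNIV"
  shows lattice_even: "(\<And>v. ((\<lambda>n. f (n + 2 * v) * h n) has_sum g v) UNIV) \<Longrightarrow> (g has_sum ((a * b + a' * b') / 2)) UNIV"
    and lattice_odd: "(\<And>v. ((\<lambda>n. f (n + 2 * v - 1) * h n) has_sum g v) UNIV) \<Longrightarrow> (g has_sum ((a * b - a' * b') / 2)) UNIV"
proof -
  have 1: "((\<lambda>(m, n). f m * h n) has_sum (a * b)) (UNIV \<times> UNIV)"
    by (rule has_sum_product_complex[OF f h])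
  have 2: "((\<lambda>(m, n). ((-1) powi m * f m) * ((-1) powi n * h n)) has_sum (a' * b')) (UNIV \<times> UNIV)"
    by (rule has_sum_product_complex[OF f' h'])
  have main: "(g has_sum ((a * b + (-1) powi j * (a' * b')) / 2)) UNIV"
    if g: "\<And>v. ((\<lambda>n. f (n + 2 * v + j) * h n) has_sum g v) UNIV" for j g
  proof -
    define F where "F = (\<lambda>(m, n). (1/2) * ((case (m, n) of (m, n) \<Rightarrow> f m * h n) +
        (-1) powi j * (case (m, n) of (m, n) \<Rightarrow> ((-1) powi m * f m) * ((-1) powi n * h n))))"
    have "(F has_sum ((1/2) * (a * b + (-1) powi j * (a' * b')))) (UNIV \<times> UNIV)"
      unfolding F_def case_prod_unfold
      using 1 2 unfolding case_prod_unfold by (intro has_sum_add has_sum_cmult_right) auto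
    also have "?this \<longleftrightarrow> ((\<lambda>(m, n). f m * h n) has_sum ((1/2) * (a * b + (-1) powi j * (a' * b')))) (range (\<lambda>(v, n). (n + 2 * v + j, n)))"
    proof (rule has_sum_cong_neutral)
      fix u :: "int \<times> int" assume u: "u \<in> UNIV \<times> UNIV - range (\<lambda>(v, n). (n + 2 * v + j, n))"
      obtain m n where mn: "u = (m, n)" by (cases u)
      have "m \<noteq> n + 2 * v + j" for v
      proof
        assume "m = n + 2 * v + j"
        hence "u = (\<lambda>(v, n). (n + 2 * v + j, n)) (v, n)" by (simp add: mn)
        thus False using u by blast
      qed
      hence "m - n - j \<noteq> 2 * v" for v by (metis add.commute add.left_commute diff_add_cancel)
      hence "odd (m - n - j)" by (auto simp: dvd_def)
      thus "F u = 0" unfolding mn F_def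
        by (cases "even j"; cases "even m"; cases "even n") auto
    next
      fix u :: "int \<times> int" assume u: "u \<in> UNIV \<times> UNIV \<inter> range (\<lambda>(v, n). (n + 2 * v + j, n))"
      then obtain v n where "u = (n + 2 * v + j, n)" by auto
      thus "F u = (case u of (m, n) \<Rightarrow> f m * h n)" unfolding F_def
        by (cases "even j"; cases "even n") auto
    qed auto
    also have "\<dots> \<longleftrightarrow> ((\<lambda>(v, n). f (n + 2 * v + j) * h n) has_sum ((1/2) * (a * b + (-1) powi j * (a' * b')))) (UNIV \<times> UNIV)"
      by (subst has_sum_reindex) (auto simp: inj_on_def o_def case_prod_unfold)
    finally have "(g has_sum ((1/2) * (a * b + (-1) powi j * (a' * b')))) UNIV"
      by (rule has_sum_SigmaD) (use g in simp)
    thus ?thesis by simp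
  qed
  show "(g has_sum ((a * b + a' * b') / 2)) UNIV" if "\<And>v. ((\<lambda>n. f (n + 2 * v) * h n) has_sum g v) UNIV" for g
    using main[of 0 g] that by simp
  show "(g has_sum ((a * b - a' * b') / 2)) UNIV" if "\<And>v. ((\<lambda>n. f (n + 2 * v - 1) * h n) has_sum g v) UNIV" for g
    using main[of "-1" g] that by simp
qed

context
  fixes q :: complex
  assumes q: "norm q < 1" "q \<noteq> 0"
begin

lemma q_sq: "norm (q^2) < 1" "q^2 \<noteq> 0" "norm (- (q^2)) < 1" "- (q^2) \<noteq> 0"
  using q by (simp_all add: norm_power power_less_one_iff)

lemma square_sums:
  "((\<lambda>n::int. q powi (n^2)) has_sum phi q) UNIV"
  "((\<lambda>n::int. (-1) powi n * q powi (n^2)) has_sum phi_neg q) UNIV"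
  using theta_quadratic_has_sum[OF q, of 1 1 0] theta_quadratic_has_sum[OF q, of "-1" 1 0] by simp_all

lemma triple_square_sums:
  "((\<lambda>n::int. q powi (3 * n^2)) has_sum phi3 q) UNIV"
  "((\<lambda>n::int. (-1) powi n * q powi (3 * n^2)) has_sum phi3_neg q) UNIV"
  using theta_quadratic_has_sum[OF q, of 1 3 0] theta_quadratic_has_sum[OF q, of "-1" 3 0] by simp_all

lemma pentagonal_like_sums:
  "((\<lambda>n::int. q powi (3 * n^2 - 2 * n)) has_sum theta q (q^6)) UNIV"
  "((\<lambda>n::int. (-1) powi n * q powi (3 * n^2 - 2 * n)) has_sum theta (- q) (q^6)) UNIV"
  using theta_quadratic_has_sum[OF q, of 1 3 "-2"] theta_quadratic_has_sum[OF q, of "-1" 3 "-2"] by simp_all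

lemma sign_twice: "((\<lambda>n::int. (-1) powi n * ((-1) powi n * f n)) has_sum (S::complex)) UNIV \<longleftrightarrow> (f has_sum S) UNIV"
  by (simp add: mult.assoc[symmetric])

text \<open>The reflection \<open>U \<mapsto> 1 - U\<close> preserves \<open>U (U - 1)\<close> and exchanges the residue classes modulo 2, so each class carries half of the
series.\<close>

lemma half_triangular_sum:
  fixes y :: complex
  assumes "norm y < 1" "y \<noteq> 0"
  shows "((\<lambda>n::int. y powi ((2 * n + v) * (2 * n + v - 1) div 2)) has_sum (theta 1 y / 2)) UNIV"
proof -
  have "((\<lambda>n. 1 powi n * y powi (n * (n - 1) div 2)) has_sum theta 1 y) UNIV"
    "((\<lambda>n. (-1) powi n * y powi (n * (n - 1) div 2)) has_sum theta (-1) y) UNIV"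
    by (rule theta_has_sum[OF assms], simp)+
  thus ?thesis
    using has_sum_parity[of "\<lambda>n. y powi (n * (n - 1) div 2)" "theta 1 y" "theta (-1) y" v] theta_minus_one[OF assms]
    by simp
qed

lemma triangular_sq: "(q^2) powi (n * (n - 1) div 2) = q powi (n^2 - n)"
proof -
  have "2 * (n * (n - 1) div 2) = n^2 - n" by (simp add: power2_eq_square algebra_simps)
  thus ?thesis by (metis power_int_mult power_int_numeral)
qed

lemma triangular_six: "(q^6) powi (n * (n - 1) div 2) = q powi (3 * n^2 - 3 * n)"
proof -
  have "2 * (n * (n - 1) div 2) = n^2 - n" by (simp add: power2_eq_square algebra_simps)
  hence "6 * (n * (n - 1) div 2) = 3 * n^2 - 3 * n" by linarith
  thus ?thesis by (metis power_int_mult power_int_numeral)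
qed

lemma cubic_difference_plus:
  "phi q * phi3 q - phi_neg q * phi3_neg q
   = q * theta 1 (q^2) * theta 1 (q^6)"
proof -
  define g where "g = (\<lambda>v::int. q * (theta 1 (q^2) / 2) * (1 powi v * (q^6) powi (v * (v - 1) div 2)))"
  have H1: "(g has_sum ((phi q * phi3 q - phi_neg q * phi3_neg q) / 2)) UNIV"
  proof (rule lattice_odd[OF square_sums(1) triple_square_sums(1) square_sums(2) triple_square_sums(2)])
    fix v :: int
    have "q powi ((n + 2 * v - 1)^2) * q powi (3 * n^2) = q * (q^6) powi (v * (v - 1) div 2) * (q^2) powi ((2 * n + v) * (2 * n + v - 1) div 2)" for n
    proof -
      have "q * (q^6) powi (v * (v - 1) div 2) * (q^2) powi ((2 * n + v) * (2 * n + v - 1) div 2)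
        = q powi 1 * q powi (3 * v^2 - 3 * v) * q powi ((2 * n + v)^2 - (2 * n + v))"
        by (simp only: triangular_sq triangular_six power_int_1_right)
      thus ?thesis unfolding q_add[OF q] by (simp add: power2_eq_square algebra_simps)
    qed
    thus "((\<lambda>n. q powi ((n + 2 * v - 1)^2) * q powi (3 * n^2)) has_sum g v) UNIV"
      using has_sum_cmult_right[OF half_triangular_sum[OF q_sq(1,2), of v], of "q * (q^6) powi (v * (v - 1) div 2)"]
      by (simp add: g_def mult_ac)
  qed
  have H2: "(g has_sum (q * (theta 1 (q^2) / 2) * theta 1 (q^6))) UNIV"
    unfolding g_def using q by (intro has_sum_cmult_right theta_has_sum) (auto simp: norm_power power_less_one_iff)
  from double_of_half[OF has_sum_unique[OF H1 H2]] show ?thesis by simp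
qed

text \<open>The same substitution with a sign: for \<open>U = 2 n + v\<close> the number \<open>U (U - 1) / 2 + v (v - 1) / 2\<close> has the parity of \<open>n\<close>, so the factor
\<open>(-1)^n\<close> is absorbed by replacing \<open>q^2\<close> and \<open>q^6\<close> by their negatives.\<close>

lemma cubic_difference_minus:
  "phi q * phi3_neg q - phi_neg q * phi3 q
   = q * theta 1 (- (q^2)) * theta 1 (- (q^6))"
proof -
  define g where "g = (\<lambda>v::int. q * (theta 1 (- (q^2)) / 2) * (1 powi v * (- (q^6)) powi (v * (v - 1) div 2)))"
  have H1: "(g has_sum ((phi q * phi3_neg q - phi_neg q * phi3 q) / 2)) UNIV"
  proof (rule lattice_odd[OF square_sums(1) triple_square_sums(2) square_sums(2)])
    show "((\<lambda>n::int. (-1) powi n * ((-1) powi n * q powi (3 * n^2))) has_sum phi3 q) UNIV"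
      unfolding sign_twice by (rule triple_square_sums)
    fix v :: int
    have "q powi ((n + 2 * v - 1)^2) * ((-1) powi n * q powi (3 * n^2))
      = q * (- (q^6)) powi (v * (v - 1) div 2) * (- (q^2)) powi ((2 * n + v) * (2 * n + v - 1) div 2)" for n
    proof -
      have sg: "(- y) powi k = (-1) powi k * y powi k" for y :: complex and k
        using power_int_mult_distrib[of "-1" y k] by simp
      have "(2 * n + v) * (2 * n + v - 1) = v * (v - 1) + 2 * (n * (2 * n + 2 * v - 1))"
        by (simp add: algebra_simps)
      hence d: "(2 * n + v) * (2 * n + v - 1) div 2 = v * (v - 1) div 2 + n * (2 * n + 2 * v - 1)"
        by simp
      have "(-1 :: complex) powi (v * (v - 1) div 2) * (-1) powi ((2 * n + v) * (2 * n + v - 1) div 2) = (-1) powi n"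
        unfolding d by (cases "even n"; cases "even (v * (v - 1) div 2)") (simp_all add: power_int_add)
      hence "q * (- (q^6)) powi (v * (v - 1) div 2) * (- (q^2)) powi ((2 * n + v) * (2 * n + v - 1) div 2)
        = (-1) powi n * (q powi 1 * q powi (3 * v^2 - 3 * v) * q powi ((2 * n + v)^2 - (2 * n + v)))"
        unfolding sg[of "q^6"] sg[of "q^2"] triangular_sq triangular_six by (simp add: mult_ac)
      thus ?thesis unfolding q_add[OF q] by (simp add: q_add[OF q] mult.left_commute) (simp add: power2_eq_square algebra_simps)
    qed
    thus "((\<lambda>n. q powi ((n + 2 * v - 1)^2) * ((-1) powi n * q powi (3 * n^2))) has_sum g v) UNIV"
      using has_sum_cmult_right[OF half_triangular_sum[OF q_sq(3,4), of v], of "q * (- (q^6)) powi (v * (v - 1) div 2)"]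
      by (simp add: g_def mult_ac)
  qed
  have H2: "(g has_sum (q * (theta 1 (- (q^2)) / 2) * theta 1 (- (q^6)))) UNIV"
    unfolding g_def using q by (intro has_sum_cmult_right theta_has_sum) (auto simp: norm_power power_less_one_iff)
  from double_of_half[OF has_sum_unique[OF H1 H2]] show ?thesis by simp
qed

text \<open>For odd \<open>v\<close> the numbers \<open>2 n + v\<close> run through all odd integers with alternating signs, and each cancels against its negative.\<close>

lemma alternating_square_sum:
  "((\<lambda>n::int. (-1) powi n * q powi ((2 * n + v)^2)) has_sum
     (if even v then (-1) powi (v div 2) * theta (- (q^4)) (q^8) else 0)) UNIV"
proof (cases "even v")
  case True
  then obtain w where v: "v = 2 * w" by (auto elim!: evenE)
  have "((\<lambda>n::int. (-1) powi n * q powi (4 * n^2)) has_sum theta (- (q^4)) (q^8)) UNIV"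
    using theta_quadratic_has_sum[OF q, of "-1" 4 0] by simp
  from has_sum_cmult_right[OF has_sum_shift[OF this, of w], of "(-1) powi w"]
  have "((\<lambda>n. (-1) powi w * ((-1) powi (n + w) * q powi (4 * (n + w)^2))) has_sum (-1) powi w * theta (- (q^4)) (q^8)) UNIV" .
  moreover have "(-1) powi w * ((-1) powi (n + w) * q powi (4 * (n + w)^2)) = (-1) powi n * q powi ((2 * n + v)^2)" for n
  proof -
    have "4 * (n + w)^2 = (2 * n + v)^2" by (simp add: v power2_eq_square algebra_simps)
    thus ?thesis by (cases "even n"; cases "even w") (simp_all add: power_int_add)
  qed
  ultimately show ?thesis by (simp add: v)
next
  case False
  hence "even (v + 1)" by simp
  then obtain w where v1: "v + 1 = 2 * w" by (rule evenE)
  hence v: "v = 2 * w - 1" by simp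
  have "((\<lambda>n::int. (-1) powi n * q powi (4 * n^2 - 4 * n)) has_sum theta (- 1) (q^8)) UNIV"
    using theta_quadratic_has_sum[OF q, of "-1" 4 "-4"] by simp
  also have "theta (- 1) (q^8) = 0"
    using q by (intro theta_minus_one) (auto simp: norm_power power_less_one_iff)
  finally have "((\<lambda>n. ((-1) powi w * q) * ((-1) powi (n + w) * q powi (4 * (n + w)^2 - 4 * (n + w)))) has_sum ((-1) powi w * q) * 0) UNIV"
    by (intro has_sum_cmult_right has_sum_shift[where f = "\<lambda>n. (-1) powi n * q powi (4 * n^2 - 4 * n)"])
  moreover have "((-1) powi w * q) * ((-1) powi (n + w) * q powi (4 * (n + w)^2 - 4 * (n + w))) = (-1) powi n * q powi ((2 * n + v)^2)" for n
  proof -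
    have e: "1 + (4 * (n + w)^2 - 4 * (n + w)) = (2 * n + v)^2" by (simp add: v power2_eq_square algebra_simps)
    have "((-1) powi w * q) * ((-1) powi (n + w) * q powi (4 * (n + w)^2 - 4 * (n + w)))
      = (-1) powi w * (-1) powi (n + w) * (q powi 1 * q powi (4 * (n + w)^2 - 4 * (n + w)))" by simp
    also have "\<dots> = (-1) powi w * (-1) powi (n + w) * q powi ((2 * n + v)^2)"
      by (simp only: q_add[OF q] e)
    finally show ?thesis by (cases "even n"; cases "even w") (simp_all add: power_int_add)
  qed
  ultimately show ?thesis using False by simp
qed

lemma cubic_sum:
  "phi q * phi3_neg q + phi_neg q * phi3 q
   = 2 * theta (- (q^4)) (q^8) * theta (- (q^12)) (q^24)"
proof -
  define g where "g = (\<lambda>v::int. (if even v then (-1) powi (v div 2) * theta (- (q^4)) (q^8) else 0) * q powi (3 * v^2))"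
  have H1: "(g has_sum ((phi q * phi3_neg q + phi_neg q * phi3 q) / 2)) UNIV"
  proof (rule lattice_even[OF square_sums(1) triple_square_sums(2) square_sums(2)])
    show "((\<lambda>n::int. (-1) powi n * ((-1) powi n * q powi (3 * n^2))) has_sum phi3 q) UNIV"
      unfolding sign_twice by (rule triple_square_sums)
    fix v :: int
    have "q powi ((n + 2 * v)^2) * ((-1) powi n * q powi (3 * n^2)) = (-1) powi n * q powi ((2 * n + v)^2) * q powi (3 * v^2)" for n
    proof -
      have "(n + 2 * v)^2 + 3 * n^2 = (2 * n + v)^2 + 3 * v^2" by (simp add: power2_eq_square algebra_simps)
      thus ?thesis by (simp add: mult.assoc mult.left_commute q_add[OF q])
    qed
    thus "((\<lambda>n. q powi ((n + 2 * v)^2) * ((-1) powi n * q powi (3 * n^2))) has_sum g v) UNIV"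
      using has_sum_cmult_left[OF alternating_square_sum[of v], of "q powi (3 * v^2)"] by (simp only: g_def)
  qed
  have H2: "(g has_sum (theta (- (q^4)) (q^8) * theta (- (q^12)) (q^24))) UNIV"
  proof (subst has_sum_even_int)
    have "((\<lambda>w::int. theta (- (q^4)) (q^8) * ((-1) powi w * q powi (12 * w^2))) has_sum
       (theta (- (q^4)) (q^8) * theta (- (q^12)) (q^24))) UNIV"
      using theta_quadratic_has_sum[OF q, of "-1" 12 0] by (intro has_sum_cmult_right) simp
    thus "((\<lambda>w. g (2 * w)) has_sum (theta (- (q^4)) (q^8) * theta (- (q^12)) (q^24))) UNIV"
      by (simp add: g_def power_mult_distrib mult_ac)
  qed (simp add: g_def)
  from double_of_half[OF has_sum_unique[OF H1 H2]] show ?thesis by simp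
qed

lemma pentagonal_sum:
  "phi q * theta q (q^6) + phi_neg q * theta (- q) (q^6) = theta 1 (q^2) * theta (q^4) (q^6)"
proof -
  define g where "g = (\<lambda>v::int. (theta 1 (q^2) / 2) * q powi (3 * v^2 + v))"
  have H1: "(g has_sum ((phi q * theta q (q^6) + phi_neg q * theta (- q) (q^6)) / 2)) UNIV"
  proof (rule lattice_even[OF square_sums(1) pentagonal_like_sums(1) square_sums(2) pentagonal_like_sums(2)])
    fix v :: int
    have "q powi ((n + 2 * v)^2) * q powi (3 * n^2 - 2 * n) = q powi (3 * v^2 + v) * (q^2) powi ((2 * n + v) * (2 * n + v - 1) div 2)" for n
      unfolding triangular_sq q_add[OF q] by (simp add: power2_eq_square algebra_simps)
    thus "((\<lambda>n. q powi ((n + 2 * v)^2) * q powi (3 * n^2 - 2 * n)) has_sum g v) UNIV"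
      using has_sum_cmult_right[OF half_triangular_sum[OF q_sq(1,2), of v], of "q powi (3 * v^2 + v)"]
      by (simp add: g_def mult_ac)
  qed
  have H2: "(g has_sum (theta 1 (q^2) / 2 * theta (q^4) (q^6))) UNIV"
    unfolding g_def using theta_quadratic_has_sum[OF q, of 1 3 1] by (intro has_sum_cmult_right) simp
  from double_of_half[OF has_sum_unique[OF H1 H2]] show ?thesis by simp
qed

text \<open>Only odd \<open>v\<close> contribute, hence the shift by one before the index is halved.\<close>

lemma pentagonal_difference:
  "phi q * theta (- q) (q^6) - phi_neg q * theta q (q^6) = 2 * q * theta (- (q^4)) (q^8) * theta (- (q^20)) (q^24)"
proof -
  define g where "g = (\<lambda>v::int. (if even (v - 1) then (-1) powi ((v - 1) div 2) * theta (- (q^4)) (q^8) else 0) * q powi (3 * v^2 - 2 * v))"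
  have H1: "(g has_sum ((phi q * theta (- q) (q^6) - phi_neg q * theta q (q^6)) / 2)) UNIV"
  proof (rule lattice_odd[OF square_sums(1) pentagonal_like_sums(2) square_sums(2)])
    show "((\<lambda>n::int. (-1) powi n * ((-1) powi n * q powi (3 * n^2 - 2 * n))) has_sum theta q (q^6)) UNIV"
      unfolding sign_twice by (rule pentagonal_like_sums)
    fix v :: int
    have "q powi ((n + 2 * v - 1)^2) * ((-1) powi n * q powi (3 * n^2 - 2 * n)) = (-1) powi n * q powi ((2 * n + (v - 1))^2) * q powi (3 * v^2 - 2 * v)" for n
    proof -
      have "(n + 2 * v - 1)^2 + (3 * n^2 - 2 * n) = (2 * n + (v - 1))^2 + (3 * v^2 - 2 * v)" by (simp add: power2_eq_square algebra_simps)
      thus ?thesis by (simp only: mult.assoc mult.left_commute[of _ "(-1) powi n"] q_add[OF q])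
    qed
    thus "((\<lambda>n. q powi ((n + 2 * v - 1)^2) * ((-1) powi n * q powi (3 * n^2 - 2 * n))) has_sum g v) UNIV"
      using has_sum_cmult_left[OF alternating_square_sum[of "v - 1"], of "q powi (3 * v^2 - 2 * v)"] by (simp only: g_def)
  qed
  have H2: "((\<lambda>v. g (v + 1)) has_sum ((q * theta (- (q^4)) (q^8)) * theta (- (q^20)) (q^24))) UNIV"
  proof (subst has_sum_even_int)
    have "((\<lambda>w::int. (q * theta (- (q^4)) (q^8)) * ((-1) powi w * q powi (12 * w^2 + 8 * w))) has_sum
       ((q * theta (- (q^4)) (q^8)) * theta (- (q^20)) (q^24))) UNIV"
      using theta_quadratic_has_sum[OF q, of "-1" 12 8] by (intro has_sum_cmult_right) simp
    moreover have "q powi (3 * (2 * w + 1)^2 - 2 * (2 * w + 1)) = q * q powi (12 * w^2 + 8 * w)" for w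
    proof -
      have "q * q powi (12 * w^2 + 8 * w) = q powi 1 * q powi (12 * w^2 + 8 * w)" by simp
      thus ?thesis unfolding q_add[OF q] by (simp add: power2_eq_square algebra_simps)
    qed
    ultimately show "((\<lambda>w. g (2 * w + 1)) has_sum ((q * theta (- (q^4)) (q^8)) * theta (- (q^20)) (q^24))) UNIV"
      by (simp add: g_def mult_ac)
  qed (simp add: g_def)
  from double_of_half[OF has_sum_unique[OF has_sum_shift[OF H1, of 1] H2]] show ?thesis by simp
qed

text \<open>The same argument for the form \<open>m^2 + n^2\<close>: \<open>m = n + 2 v\<close> turns it into \<open>2 (n + v)^2 + 2 v^2\<close>.\<close>

lemma two_squares_sum: "(phi q)^2 + (phi_neg q)^2 = 2 * (theta (q^2) (q^4))^2"
proof -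
  have s: "((\<lambda>n::int. q powi (2 * n^2)) has_sum theta (q^2) (q^4)) UNIV"
    using theta_quadratic_has_sum[OF q, of 1 2 0] by simp
  define g where "g = (\<lambda>v::int. theta (q^2) (q^4) * q powi (2 * v^2))"
  have H1: "(g has_sum ((phi q * phi q + phi_neg q * phi_neg q) / 2)) UNIV"
  proof (rule lattice_even[OF square_sums(1) square_sums(1) square_sums(2) square_sums(2)])
    fix v :: int
    have "q powi ((n + 2 * v)^2) * q powi (n^2) = q powi (2 * v^2) * q powi (2 * (n + v)^2)" for n
      unfolding q_add[OF q] by (simp add: power2_eq_square algebra_simps)
    thus "((\<lambda>n. q powi ((n + 2 * v)^2) * q powi (n^2)) has_sum g v) UNIV"
      using has_sum_cmult_right[OF has_sum_shift[OF s, of v], of "q powi (2 * v^2)"]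
      by (simp add: g_def mult_ac)
  qed
  have H2: "(g has_sum (theta (q^2) (q^4) * theta (q^2) (q^4))) UNIV"
    unfolding g_def by (intro has_sum_cmult_right s)
  from double_of_half[OF has_sum_unique[OF H1 H2]] show ?thesis by (simp add: power2_eq_square)
qed

lemma two_squares_difference: "(phi q)^2 - (phi_neg q)^2 = 2 * q * (theta 1 (q^4))^2"
proof -
  have s: "((\<lambda>n::int. q powi (2 * n^2 - 2 * n)) has_sum theta 1 (q^4)) UNIV"
    using theta_quadratic_has_sum[OF q, of 1 2 "-2"] by simp
  define g where "g = (\<lambda>v::int. (q * theta 1 (q^4)) * q powi (2 * v^2 - 2 * v))"
  have H1: "(g has_sum ((phi q * phi q - phi_neg q * phi_neg q) / 2)) UNIV"
  proof (rule lattice_odd[OF square_sums(1) square_sums(1) square_sums(2) square_sums(2)])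
    fix v :: int
    have "q powi ((n + 2 * v - 1)^2) * q powi (n^2) = (q * q powi (2 * v^2 - 2 * v)) * q powi (2 * (n + v)^2 - 2 * (n + v))" for n
    proof -
      have "(q * q powi (2 * v^2 - 2 * v)) * q powi (2 * (n + v)^2 - 2 * (n + v))
        = q powi 1 * q powi (2 * v^2 - 2 * v) * q powi (2 * (n + v)^2 - 2 * (n + v))" by simp
      thus ?thesis unfolding q_add[OF q] by (simp add: power2_eq_square algebra_simps)
    qed
    thus "((\<lambda>n. q powi ((n + 2 * v - 1)^2) * q powi (n^2)) has_sum g v) UNIV"
      using has_sum_cmult_right[OF has_sum_shift[OF s, of v], of "q * q powi (2 * v^2 - 2 * v)"]
      by (simp add: g_def mult_ac)
  qed
  have H2: "(g has_sum ((q * theta 1 (q^4)) * theta 1 (q^4))) UNIV"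
    unfolding g_def by (intro has_sum_cmult_right s)
  from double_of_half[OF has_sum_unique[OF H1 H2]] show ?thesis by (simp add: power2_eq_square)
qed

end
section \<open>Theta series as infinite products\<close>

text \<open>Euler's theorem that partitions into odd parts and into distinct parts are equinumerous.\<close>

lemma euler_odd:
  assumes "norm y < 1"
  shows "qpoch_inf y (y^2) * qpoch_inf (- y) y = 1"
proof -
  have y2: "norm (y^2) < 1" using assms by (simp add: norm_power power_less_one_iff)
  have "qpoch_inf y y = qpoch_inf y (y^2) * qpoch_inf (y^2) (y^2)"
    using qpoch_inf_dissect2[OF assms, of y] by (simp add: power2_eq_square)
  hence "(qpoch_inf y (y^2) * qpoch_inf (- y) y) * qpoch_inf (y^2) (y^2) = 1 * qpoch_inf (y^2) (y^2)"
    using qpoch_inf_pm[OF assms, of y] by (simp add: mult_ac)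
  thus ?thesis using qpoch_inf_nonzero[OF y2 y2] by (simp only: mult_cancel_right) simp
qed

lemma euler_three:
  assumes "norm y < 1"
  shows "qpoch_inf y (y^2) * qpoch_inf (- y) (y^2) * qpoch_inf (- (y^2)) (y^2) = 1"
proof -
  have y2: "norm (y^2) < 1" using assms by (simp add: norm_power power_less_one_iff)
  show ?thesis using qpoch_inf_pm[OF y2, of y] euler_odd[OF y2] by simp
qed

lemma theta_square_product:
  assumes "norm y < 1" "y \<noteq> 0"
  shows "theta y (y^2) = (qpoch_inf (- y) (y^2))^2 * qpoch_inf (y^2) (y^2)"
proof -
  have "norm (y^2) < 1" "norm (y^2) < norm y"
    using assms power_strict_decreasing[of 1 2 "norm y"] by (simp_all add: norm_power power_less_one_iff)
  moreover have "- (y^2) / y = - y" using assms by (simp add: power2_eq_square)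
  ultimately show ?thesis
    using jacobi_triple_product[of "y^2" y] assms by (simp add: power2_eq_square)
qed

lemma theta_minus_square_product:
  assumes "norm y < 1" "y \<noteq> 0"
  shows "theta (- y) (y^2) = qpoch_inf y (y^2) * qpoch_inf y y"
proof -
  have "qpoch_inf y y = qpoch_inf y (y^2) * qpoch_inf (y^2) (y^2)"
    using qpoch_inf_dissect2[of y y] assms by (simp add: power2_eq_square)
  thus ?thesis using theta_square_product[of "- y"] assms by (simp add: power2_eq_square)
qed

lemma theta_one_product:
  assumes "norm y < 1" "y \<noteq> 0"
  shows "theta 1 y = 2 * (qpoch_inf (- y) y)^2 * qpoch_inf y y"
    and "theta 1 y = 2 * qpoch_inf (y^2) (y^2) / qpoch_inf y (y^2)"
proof -
  show 1: "theta 1 y = 2 * (qpoch_inf (- y) y)^2 * qpoch_inf y y"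
    using jacobi_triple_product[of y 1] assms by (simp add: qpoch_inf_minus_one power2_eq_square)
  have "qpoch_inf y (y^2) \<noteq> 0" using euler_odd[OF assms(1)] by auto
  hence "qpoch_inf (- y) y = 1 / qpoch_inf y (y^2)"
    using euler_odd[OF assms(1)] by (simp add: field_simps)
  moreover have "theta 1 y = 2 * (qpoch_inf y y * qpoch_inf (- y) y) * qpoch_inf (- y) y"
    unfolding 1 by (simp add: power2_eq_square)
  ultimately show "theta 1 y = 2 * qpoch_inf (y^2) (y^2) / qpoch_inf y (y^2)"
    unfolding qpoch_inf_pm[OF assms(1)] by simp
qed

text \<open>The factors of \<open>(y;y^2)\<^sub>\<infinity>\<close> prime to 6 are those of the triple product; the remaining ones belong to the exponents divisible
by 3 and combine with Gauss's product for the triangular series.\<close>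

lemma theta_sixth_product:
  assumes "norm y < 1" "y \<noteq> 0"
  shows "theta (- y) (y^6) = qpoch_inf y (y^2) * theta 1 (y^3) / 2"
    and "theta (- (y^5)) (y^6) = theta (- y) (y^6)"
proof -
  have n: "norm (y^6) < 1" "norm (y^3) < 1" "norm (y^2) < 1" using assms by (auto simp: norm_power power_less_one_iff)
  have l: "norm (y^6) < norm (- y)" "norm (y^6) < norm (- (y^5))"
    using assms power_strict_decreasing[of 1 6 "norm y"] power_strict_decreasing[of 5 6 "norm y"]
    by (simp_all add: norm_power)
  have nz: "y^6 \<noteq> 0" using assms by simp
  have d: "- (y^6) / - y = y^5" "- (y^6) / - (y^5) = y"
    using assms by (simp_all add: eval_nat_numeral)
  have A: "theta (- y) (y^6) = qpoch_inf y (y^6) * qpoch_inf (y^5) (y^6) * qpoch_inf (y^6) (y^6)"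
    using jacobi_triple_product[OF n(1) nz l(1)] by (simp only: d minus_minus)
  have "theta (- (y^5)) (y^6) = qpoch_inf (y^5) (y^6) * qpoch_inf y (y^6) * qpoch_inf (y^6) (y^6)"
    using jacobi_triple_product[OF n(1) nz l(2)] by (simp only: d minus_minus)
  thus "theta (- (y^5)) (y^6) = theta (- y) (y^6)" unfolding A by simp
  have p: "(y^2)^3 = y^6" "y * y^2 = y^3" "y * (y^2)^2 = y^5" "(y^3)^2 = y^6"
    by (simp_all add: eval_nat_numeral)
  have B: "qpoch_inf y (y^2) = qpoch_inf y (y^6) * qpoch_inf (y^3) (y^6) * qpoch_inf (y^5) (y^6)"
    using qpoch_inf_dissect3[OF n(3), of y] by (simp only: p)
  have C: "theta 1 (y^3) = 2 * qpoch_inf (y^6) (y^6) / qpoch_inf (y^3) (y^6)"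
    using theta_one_product(2)[OF n(2)] assms by (simp only: p) simp
  have "qpoch_inf (y^3) (y^6) \<noteq> 0" using n by (intro qpoch_inf_nonzero)
  thus "theta (- y) (y^6) = qpoch_inf y (y^2) * theta 1 (y^3) / 2"
    unfolding A B C by simp
qed

text \<open>Dissected modulo 3, \<open>(-y;y)\<^sub>\<infinity>\<close> differs from the triple product with nome \<open>y^3\<close> only in having the factor \<open>(-y^3;y^3)\<^sub>\<infinity>\<close> in place
of \<open>(y^3;y^3)\<^sub>\<infinity>\<close>, and the quotient of the latter by the former is \<open>\<phi>(-y^3)\<close>. The last equation is Euler's pentagonal number theorem.\<close>

lemma theta_third_product:
  assumes "norm y < 1" "y \<noteq> 0"
  shows "theta (y^2) (y^3) = qpoch_inf (- y) y * theta (- (y^3)) (y^6)"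
    and "theta y (y^3) = qpoch_inf (- y) y * theta (- (y^3)) (y^6)"
    and "theta (- (y^2)) (y^3) = qpoch_inf y y"
proof -
  have n: "norm (y^6) < 1" "norm (y^3) < 1" "norm (y^2) < 1" using assms by (auto simp: norm_power power_less_one_iff)
  have l: "norm (y^3) < norm y" "norm (y^3) < norm (y^2)" "norm (y^3) < norm (- (y^2))"
    using assms power_strict_decreasing[of 1 3 "norm y"] power_strict_decreasing[of 2 3 "norm y"]
    by (simp_all add: norm_power)
  have nz: "y^3 \<noteq> 0" using assms by simp
  have d: "- (y^3) / y = - (y^2)" "- (y^3) / y^2 = - y" "- (y^3) / - (y^2) = y"
    using assms by (simp_all add: eval_nat_numeral)
  have p: "- y * y = - (y^2)" "- y * y^2 = - (y^3)" "y * y = y^2" "y * y^2 = y^3" "(y^3)^2 = y^6"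
    by (simp_all add: eval_nat_numeral)
  have A: "theta (y^2) (y^3) = qpoch_inf (- (y^2)) (y^3) * qpoch_inf (- y) (y^3) * qpoch_inf (y^3) (y^3)"
    using jacobi_triple_product[OF n(2) nz l(2)] by (simp only: d minus_minus)
  have A': "theta y (y^3) = theta (y^2) (y^3)"
    unfolding A using jacobi_triple_product[OF n(2) nz l(1)] by (simp only: d minus_minus mult_ac)
  have B: "qpoch_inf (- y) y = qpoch_inf (- y) (y^3) * qpoch_inf (- (y^2)) (y^3) * qpoch_inf (- (y^3)) (y^3)"
    using qpoch_inf_dissect3[OF assms(1), of "- y"] by (simp only: p)
  have "qpoch_inf (- (y^3)) (y^3) * theta (- (y^3)) (y^6)
      = (qpoch_inf (y^3) ((y^3)^2) * qpoch_inf (- (y^3)) (y^3)) * qpoch_inf (y^3) (y^3)"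
    using theta_minus_square_product[OF n(2)] assms by (simp add: p)
  hence C: "qpoch_inf (- (y^3)) (y^3) * theta (- (y^3)) (y^6) = qpoch_inf (y^3) (y^3)"
    by (simp only: euler_odd[OF n(2)] mult_1_left)
  show D: "theta (y^2) (y^3) = qpoch_inf (- y) y * theta (- (y^3)) (y^6)"
    unfolding A B C[symmetric] by simp
  show "theta y (y^3) = qpoch_inf (- y) y * theta (- (y^3)) (y^6)"
    unfolding A' D ..
  have "theta (- (y^2)) (y^3) = qpoch_inf (y^2) (y^3) * qpoch_inf y (y^3) * qpoch_inf (y^3) (y^3)"
    using jacobi_triple_product[OF n(2) nz l(3)] by (simp only: d minus_minus)
  also have "\<dots> = qpoch_inf y y"
    using qpoch_inf_dissect3[OF assms(1), of y] by (simp only: p mult_ac)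
  finally show "theta (- (y^2)) (y^3) = qpoch_inf y y" .
qed

section \<open>Collapsing the two-term theta expressions\<close>

context
  fixes q :: complex
  assumes q: "norm q < 1" "q \<noteq> 0"
begin

lemma qn: "norm (q^Suc n) < 1" "norm (q^2) < 1" "norm (q^4) < 1"
  using q by (simp_all add: norm_power power_less_one_iff del: power_Suc)

lemma pows: "(q^2)^2 = q^4" "(q^4)^2 = q^8" "(q^2)^3 = q^6" "(q^4)^3 = q^12" "(q^2)^6 = q^12" "(q^4)^6 = q^24"
  "(q^4)^5 = q^20" "(- (q^2))^6 = q^12" "(- (q^2))^3 = - (q^6)" "(- (q^2))^2 = q^4" "- (q^2) * q^4 = - (q^6)"
  "- (q^2) * q^2 = - (q^4)" "(q^6)^2 = q^12"
  by (simp_all add: eval_nat_numeral)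

lemma prod_facts: "prod_a q * prod_b q * prod_c q = 1" "prod_a q \<noteq> 0" "prod_b q \<noteq> 0" "prod_c q \<noteq> 0" "prod_p q \<noteq> 0"
proof -
  show 1: "prod_a q * prod_b q * prod_c q = 1" using euler_three[OF qn(2)] by (simp only: pows)
  thus "prod_a q \<noteq> 0" "prod_b q \<noteq> 0" "prod_c q \<noteq> 0" by auto
  show "prod_p q \<noteq> 0" using qn by (intro qpoch_inf_nonzero)
qed

text \<open>The theta series of the reduced sums and of the lattice identities in terms of the four basic products and of the few
theta series that are eliminated below.\<close>

lemma theta_values:
  "theta (- (q^2)) ((q^4)^3) = prod_a q * theta 1 (q^6) / 2"
  "theta (q^4) ((q^4)^3) = prod_c q * theta (- (q^12)) (q^24)"
  "theta (q^2) ((q^4)^3) = prod_b q * theta 1 (- (q^6)) / 2"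
  "theta 1 (q^2) = 2 * prod_p q / prod_a q" "theta 1 (- (q^2)) = 2 * prod_p q / prod_b q" "theta 1 (q^4) = 2 * (prod_c q)^2 * prod_p q"
  "theta (q^2) (q^4) = (prod_b q)^2 * prod_p q" "theta (- (q^4)) (q^8) = prod_p q / prod_c q"
  "theta (q^4) (q^6) = prod_b q * prod_c q * theta (- (q^6)) (q^12)"
  "theta (- (q^20)) (q^24) = theta 1 ((q^4)^3) / (2 * prod_c q)"
proof -
  note n2 = qn(2) and n4 = qn(3)
  have m2: "norm (- (q^2)) < 1" using n2 by simp
  have nz: "q^2 \<noteq> 0" "q^4 \<noteq> 0" "- (q^2) \<noteq> 0" using q by auto
  have inv: "qpoch_inf (q^4) (q^8) = 1 / prod_c q"
    using euler_odd[OF n4] prod_facts(4) by (simp only: pows) (simp add: field_simps)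
  have bc: "qpoch_inf (- (q^2)) (q^2) = prod_b q * prod_c q"
    using qpoch_inf_dissect2[OF n2, of "- (q^2)"] by (simp only: pows)
  show "theta (- (q^2)) ((q^4)^3) = prod_a q * theta 1 (q^6) / 2"
    using theta_sixth_product(1)[OF n2 nz(1)] by (simp only: pows)
  show "theta (q^4) ((q^4)^3) = prod_c q * theta (- (q^12)) (q^24)"
    using theta_third_product(2)[OF n4 nz(2)] by (simp only: pows)
  show "theta (q^2) ((q^4)^3) = prod_b q * theta 1 (- (q^6)) / 2"
    using theta_sixth_product(1)[OF m2 nz(3)] by (simp only: pows minus_minus)
  show "theta 1 (q^2) = 2 * prod_p q / prod_a q"
    using theta_one_product(2)[OF n2 nz(1)] by (simp only: pows)
  show "theta 1 (- (q^2)) = 2 * prod_p q / prod_b q"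
    using theta_one_product(2)[OF m2 nz(3)] by (simp only: pows)
  show "theta 1 (q^4) = 2 * (prod_c q)^2 * prod_p q"
    by (rule theta_one_product(1)[OF n4 nz(2)])
  show "theta (q^2) (q^4) = (prod_b q)^2 * prod_p q"
    using theta_square_product[OF n2 nz(1)] by (simp only: pows)
  show "theta (- (q^4)) (q^8) = prod_p q / prod_c q"
    using theta_minus_square_product[OF n4 nz(2)] by (simp only: pows inv) simp
  show "theta (q^4) (q^6) = prod_b q * prod_c q * theta (- (q^6)) (q^12)"
    using theta_third_product(1)[OF n2 nz(1)] by (simp only: pows bc)
  show "theta (- (q^20)) (q^24) = theta 1 ((q^4)^3) / (2 * prod_c q)"
    using theta_sixth_product[OF n4 nz(2)] by (simp only: pows inv) simp
qed

text \<open>The lattice identities for \<open>\<phi>(q) \<phi>(q^3)\<close> and \<open>\<phi>(q) \<phi>(-q^3)\<close> express both remaining theta series by \<open>\<phi>(\<plusminus>q)\<close> and \<open>\<phi>(\<plusminus>q^3)\<close>. In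
the sum the terms with \<open>\<phi>(-q^3)\<close> cancel, and \<open>\<phi>(q^3)\<close> is multiplied by \<open>\<phi>(q)^2 + \<phi>(-q)^2 = 2 \<phi>(q^2)^2\<close>, which is a product.\<close>

lemma first_theta_form:
  "phi q * reduced_sum q 0 0 2 1 + phi_neg q * reduced_sum q 0 0 2 (-1) = prod_b q * (phi q + phi3 q)"
proof -
  define T where "T = theta 1 (q^6)"
  define U where "U = theta (- (q^12)) (q^24)"
  have T: "phi q * phi3 q - phi_neg q * phi3_neg q = q * (2 * prod_p q / prod_a q) * T"
    using cubic_difference_plus[OF q] by (simp only: theta_values T_def)
  have U: "phi q * phi3_neg q + phi_neg q * phi3 q = 2 * (prod_p q / prod_c q) * U"
    using cubic_sum[OF q] by (simp only: theta_values U_def)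
  have sq: "(phi q)^2 + (phi_neg q)^2 = 2 * ((prod_b q)^2 * prod_p q)^2"
    using two_squares_sum[OF q] by (simp only: theta_values)
  have T': "T = prod_a q * (phi q * phi3 q - phi_neg q * phi3_neg q) / (2 * q * prod_p q)"
    unfolding T using prod_facts q by (simp add: field_simps)
  have U': "U = prod_c q * (phi q * phi3_neg q + phi_neg q * phi3 q) / (2 * prod_p q)"
    unfolding U using prod_facts q by (simp add: field_simps)
  have "phi q * reduced_sum q 0 0 2 1 + phi_neg q * reduced_sum q 0 0 2 (-1)
    = prod_b q * phi q + (prod_a q * prod_c q)^2 / (2 * (prod_p q)^2 * prod_b q) * (phi3 q * ((phi q)^2 + (phi_neg q)^2))"
    unfolding reduced_sum_first_plus[OF q] reduced_sum_first_minus[OF q] theta_values T_def[symmetric] U_def[symmetric] T' U'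
    using prod_facts(2-) q by (simp add: field_simps power2_eq_square)
  also have "(prod_a q * prod_c q)^2 / (2 * (prod_p q)^2 * prod_b q) * (phi3 q * ((phi q)^2 + (phi_neg q)^2)) = (prod_a q * prod_b q * prod_c q)^2 * prod_b q * phi3 q"
    unfolding sq using prod_facts(2-) by (simp add: field_simps power2_eq_square)
  finally show ?thesis unfolding prod_facts(1) by (simp add: algebra_simps)
qed

lemma fourth_theta_form:
  "phi q * reduced_sum q 0 2 0 1 - phi_neg q * reduced_sum q 0 2 0 (-1) = prod_b q * (phi q - phi3 q)"
proof -
  have 1: "reduced_sum q 0 2 0 1 = 2 * prod_b q - reduced_sum q 0 0 2 1"
    using reduced_sum_fourth_plus[OF q] by (simp add: algebra_simps)
  have "phi q * reduced_sum q 0 2 0 1 - phi_neg q * reduced_sum q 0 2 0 (-1)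
    = 2 * (prod_b q * phi q) - (phi q * reduced_sum q 0 0 2 1 + phi_neg q * reduced_sum q 0 0 2 (-1))"
    unfolding reduced_sum_fourth_minus[OF q] 1 by (simp add: algebra_simps)
  thus ?thesis unfolding first_theta_form by (simp add: algebra_simps)
qed

text \<open>The same elimination with \<open>C(\<plusminus>q)\<close> in place of \<open>\<phi>(\<plusminus>q^3)\<close>; the terms with \<open>C(-q)\<close> cancel.\<close>

lemma second_theta_form:
  "phi q * reduced_sum q (-2) 2 2 1 + phi_neg q * reduced_sum q (-2) 2 2 (-1) = 2 * prod_b q * theta q (q^6)"
proof -
  define C where "C = theta q (q^6)"
  define C' where "C' = theta (- q) (q^6)"
  define U where "U = theta (- (q^6)) (q^12)"
  define T where "T = theta 1 ((q^4)^3)"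
  have U: "phi q * C + phi_neg q * C' = 2 * prod_p q / prod_a q * (prod_b q * prod_c q * U)"
    using pentagonal_sum[OF q] by (simp only: theta_values U_def C_def C'_def)
  have T: "phi q * C' - phi_neg q * C = 2 * q * (prod_p q / prod_c q) * (T / (2 * prod_c q))"
    using pentagonal_difference[OF q] by (simp only: theta_values T_def C_def C'_def)
  have sq: "(phi q)^2 + (phi_neg q)^2 = 2 * ((prod_b q)^2 * prod_p q)^2"
    using two_squares_sum[OF q] by (simp only: theta_values)
  have U': "U = prod_a q * (phi q * C + phi_neg q * C') / (2 * prod_p q * prod_b q * prod_c q)"
    unfolding U using prod_facts q by (simp add: field_simps)
  have T': "T = (prod_c q)^2 * (phi q * C' - phi_neg q * C) / (q * prod_p q)"
    unfolding T using prod_facts q by (simp add: field_simps power2_eq_square)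
  have bq: "1 / prod_b q = prod_a q * prod_c q" using prod_facts by (simp add: field_simps)
  have "phi q * reduced_sum q (-2) 2 2 1 + phi_neg q * reduced_sum q (-2) 2 2 (-1)
    = prod_c q * prod_a q / ((prod_p q)^2 * (prod_b q)^2) * phi q * (phi q * C + phi_neg q * C') - (prod_a q * prod_c q)^2 / ((prod_p q)^2 * prod_b q) * phi_neg q * (phi q * C' - phi_neg q * C)"
    unfolding reduced_sum_second_plus[OF q] reduced_sum_second_minus[OF q] pows(11) pows(4)[symmetric]
      T_def[symmetric] 
    unfolding pows(4) U_def[symmetric] U' T'
    using prod_facts(2-) q by (simp add: field_simps power2_eq_square)
  also have "prod_c q * prod_a q / ((prod_p q)^2 * (prod_b q)^2) = (prod_a q * prod_c q)^2 / ((prod_p q)^2 * prod_b q)"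
    unfolding bq[symmetric] using bq prod_facts(2-) by (simp add: field_simps power2_eq_square)
  also have "(prod_a q * prod_c q)^2 / ((prod_p q)^2 * prod_b q) * phi q * (phi q * C + phi_neg q * C') - (prod_a q * prod_c q)^2 / ((prod_p q)^2 * prod_b q) * phi_neg q * (phi q * C' - phi_neg q * C)
    = (prod_a q * prod_c q)^2 / ((prod_p q)^2 * prod_b q) * (C * ((phi q)^2 + (phi_neg q)^2))"
  proof -
    have "K * x * (x * C + y * C') - K * y * (x * C' - y * C) = K * (C * (x^2 + y^2))" for K x y
      by (simp add: algebra_simps power2_eq_square)
    thus ?thesis .
  qed
  also have "\<dots> = 2 * (prod_a q * prod_b q * prod_c q)^2 * prod_b q * C"
    unfolding sq using prod_facts(2-) by (simp add: field_simps power2_eq_square)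
  finally show ?thesis unfolding prod_facts(1) C_def by simp
qed

text \<open>Here the elimination leaves \<open>\<phi>(q)^2 - \<phi>(-q)^2\<close>, which is a product as well.\<close>

lemma third_theta_form:
  "phi q * reduced_sum q 0 2 2 1 + phi_neg q * reduced_sum q 0 2 2 (-1) = 2 * prod_c q * phi3 q"
proof -
  define T where "T = theta 1 (q^6)"
  define T' where "T' = theta 1 (- (q^6))"
  have T: "phi q * phi3 q - phi_neg q * phi3_neg q = q * (2 * prod_p q / prod_a q) * T"
    using cubic_difference_plus[OF q] by (simp only: theta_values T_def)
  have Tm: "phi q * phi3_neg q - phi_neg q * phi3 q = q * (2 * prod_p q / prod_b q) * T'"
    using cubic_difference_minus[OF q] by (simp only: theta_values T'_def)
  have sq: "(phi q)^2 - (phi_neg q)^2 = 2 * q * (2 * (prod_c q)^2 * prod_p q)^2"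
    using two_squares_difference[OF q] by (simp only: theta_values)
  have T1: "T = prod_a q * (phi q * phi3 q - phi_neg q * phi3_neg q) / (2 * q * prod_p q)"
    unfolding T using prod_facts q by (simp add: field_simps)
  have T2: "T' = prod_b q * (phi q * phi3_neg q - phi_neg q * phi3 q) / (2 * q * prod_p q)"
    unfolding Tm using prod_facts q by (simp add: field_simps)
  have f: "reduced_sum q 0 2 2 1 = prod_b q * (prod_b q * theta (- (q^2)) ((q^4)^3) / (prod_p q * prod_c q))"
    "reduced_sum q 0 2 2 (-1) = prod_a q * (prod_a q * theta (q^2) ((q^4)^3) / (prod_p q * prod_c q))"
    using reduced_sum_third[OF q, of 1] reduced_sum_third[OF q, of "-1"] by simp_all
  have "phi q * reduced_sum q 0 2 2 1 + phi_neg q * reduced_sum q 0 2 2 (-1)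
    = (prod_a q * prod_b q)^2 / (4 * q * (prod_p q)^2 * prod_c q) * (phi3 q * ((phi q)^2 - (phi_neg q)^2))"
    unfolding f theta_values T_def[symmetric] T'_def[symmetric] T1 T2
    using prod_facts(2-) q by (simp add: field_simps power2_eq_square)
  also have "\<dots> = 2 * (prod_a q * prod_b q * prod_c q)^2 * prod_c q * phi3 q"
    unfolding sq using prod_facts(2-) q by (simp add: field_simps power2_eq_square)
  finally show ?thesis unfolding prod_facts(1) by simp
qed

end
section \<open>Products modulo twelve\<close>

context
  fixes q :: complex
  assumes q: "norm q < 1" "q \<noteq> 0"
begin

lemma qpow: "n > 0 \<Longrightarrow> norm (q^n) < 1" "q^n \<noteq> 0"
  using q by (simp_all add: norm_power power_less_one_iff)

lemma qpow_inf_nonzero: "n > 0 \<Longrightarrow> qpoch_inf (q^n) (q^n) \<noteq> 0" "m > 0 \<Longrightarrow> n > 0 \<Longrightarrow> qpoch_inf (q^m) (q^n) \<noteq> 0"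
  using qpow by (intro qpoch_inf_nonzero; simp)+

abbreviation (input) "euler_prod n \<equiv> qpoch_inf (q^n) (q^n)"
abbreviation (input) "prod_k \<equiv> qpoch_inf (- q) (q^2)"
abbreviation (input) "units \<equiv> (qpoch_inf q (q^12) * qpoch_inf (q^11) (q^12)) * (qpoch_inf (q^5) (q^12) * qpoch_inf (q^7) (q^12))"

lemma dissect: "n > 0 \<Longrightarrow> qpoch_inf (q^m) (q^n) = qpoch_inf (q^m) (q^(2 * n)) * qpoch_inf (q^(m + n)) (q^(2 * n))"
  using qpoch_inf_dissect2[OF qpow(1)[of n], of "q^m"] by (simp add: power_add power_mult mult.commute[of 2 n])

lemma plus_minus: "n > 0 \<Longrightarrow> qpoch_inf (q^m) (q^n) * qpoch_inf (- (q^m)) (q^n) = qpoch_inf (q^(2 * m)) (q^(2 * n))"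
  using qpoch_inf_pm[OF qpow(1)[of n], of "q^m"] by (simp add: mult.commute[of 2] power_mult)

text \<open>The odd residues modulo 12 are the units 1, 5, 7, 11 together with 3 and 9.\<close>

lemma units_eq: "units * qpoch_inf (q^3) (q^6) = qpoch_inf q (q^2)"
proof -
  have 1: "qpoch_inf q (q^6) = qpoch_inf q (q^12) * qpoch_inf (q^7) (q^12)"
    using dissect[of 6 1] by simp
  have 2: "qpoch_inf (q^5) (q^6) = qpoch_inf (q^5) (q^12) * qpoch_inf (q^11) (q^12)"
    using dissect[of 6 5] by simp
  have p: "(q^2)^3 = q^6" "q * q^2 = q^3" "q * (q^2)^2 = q^5"
    by (simp_all add: eval_nat_numeral)
  have "qpoch_inf q (q^2) = qpoch_inf q (q^6) * qpoch_inf (q^3) (q^6) * qpoch_inf (q^5) (q^6)"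
    using qpoch_inf_dissect3[OF qpow(1)[of 2], of q] by (simp only: p zero_less_numeral)
  thus ?thesis unfolding 1 2 by (simp only: mult_ac)
qed

text \<open>Euler's \<open>(q;q^2)\<^sub>\<infinity> (-q;q^2)\<^sub>\<infinity> (-q^2;q^4)\<^sub>\<infinity> = (q^4;q^8)\<^sub>\<infinity>\<close> with the factors of \<open>(q;q^2)\<^sub>\<infinity>\<close> sorted by
their residues modulo 12.\<close>

lemma product_relation: "prod_b q * prod_k * units * euler_prod 3 * euler_prod 8 = euler_prod 4 * euler_prod 6"
proof -
  have "euler_prod 3 = qpoch_inf (q^3) (q^6) * euler_prod 6" using dissect[of 3 3] by simp
  hence "prod_b q * prod_k * units * euler_prod 3 * euler_prod 8
     = prod_b q * (prod_k * (units * qpoch_inf (q^3) (q^6))) * euler_prod 8 * euler_prod 6"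
    by (simp only: mult_ac)
  also have "prod_k * (units * qpoch_inf (q^3) (q^6)) = prod_a q"
    unfolding units_eq using plus_minus[of 2 1] by (simp add: mult.commute)
  also have "prod_b q * prod_a q = qpoch_inf (q^4) (q^8)"
    using plus_minus[of 4 2] by (simp add: mult.commute)
  also have "qpoch_inf (q^4) (q^8) * euler_prod 8 = euler_prod 4" using dissect[of 4 4] by simp
  finally show ?thesis .
qed

lemma units_nonzero: "qpoch_inf q (q^12) \<noteq> 0" "qpoch_inf (q^11) (q^12) \<noteq> 0"
   "qpoch_inf (q^5) (q^12) \<noteq> 0" "qpoch_inf (q^7) (q^12) \<noteq> 0" "euler_prod 3 \<noteq> 0" "euler_prod 4 \<noteq> 0" "euler_prod 6 \<noteq> 0" "euler_prod 8 \<noteq> 0" "euler_prod 12 \<noteq> 0"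
  using qpow_inf_nonzero(2)[of 1 12] qpow_inf_nonzero by simp_all

lemma theta_twelve:
  "theta (- (q^7)) (q^12) = qpoch_inf (q^5) (q^12) * qpoch_inf (q^7) (q^12) * euler_prod 12"
  "theta (- q) (q^12) = qpoch_inf q (q^12) * qpoch_inf (q^11) (q^12) * euler_prod 12"
proof -
  have l: "norm (q^12) < norm (- (q^7))" "norm (q^12) < norm (- q)"
    using q power_strict_decreasing[of 7 12 "norm q"] power_strict_decreasing[of 1 12 "norm q"]
    by (simp_all add: norm_power)
  have d: "- (q^12) / - (q^7) = q^5" "- (q^12) / - q = q^11"
    using q by (simp_all add: eval_nat_numeral)
  have n: "norm (q^12) < 1" "q^12 \<noteq> 0" using qpow by auto
  show "theta (- (q^7)) (q^12) = qpoch_inf (q^5) (q^12) * qpoch_inf (q^7) (q^12) * euler_prod 12"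
    using jacobi_triple_product[OF n l(1)] by (simp only: d minus_minus mult_ac)
  show "theta (- q) (q^12) = qpoch_inf q (q^12) * qpoch_inf (q^11) (q^12) * euler_prod 12"
    using jacobi_triple_product[OF n l(2)] by (simp only: d minus_minus mult_ac)
qed

text \<open>For \<open>r = -q\<close> the series \<open>\<Sum> (\<plusminus>1)^m r^(m (3 m + 1) / 2)\<close> equal \<open>\<phi>(q)\<close> and \<open>\<phi>(q^3)\<close> divided by \<open>(-q;q^2)\<^sub>\<infinity>\<close>, with the lower
sign for \<open>\<phi>(q)\<close>. Their half sum and half difference
are the parts with even and odd \<open>m\<close>, which are theta series with nome \<open>q^12\<close>.\<close>

lemma pentagonal_dissection:
  "phi q + phi3 q = 2 * prod_k * theta (- (q^7)) (q^12)"
  "phi q - phi3 q = 2 * q * prod_k * theta (- q) (q^12)"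
proof -
  define X where "X = theta (q^2) (- (q^3))"
  define Y where "Y = theta (- (q^2)) (- (q^3))"
  have m: "norm (- q) < 1" "- q \<noteq> 0" using q by auto
  have pw: "(- q)^2 = q^2" "(- q)^3 = - (q^3)" "(- q)^6 = q^6" by (simp_all add: power_minus_odd)
  have X: "X = qpoch_inf q (- q) * phi3 q" and Y: "Y = qpoch_inf (- q) (- q)"
    using theta_third_product(1,3)[OF m] unfolding X_def Y_def pw by simp_all
  have e: "prod_k * qpoch_inf q (- q) = 1" using euler_odd[OF m(1)] by (simp add: pw)
  have X': "prod_k * X = phi3 q" unfolding X mult.assoc[symmetric] e by simp
  have Y': "prod_k * Y = phi q"
    unfolding Y using theta_minus_square_product[OF m] by (simp add: pw)
  define f where "f = (\<lambda>n::int. (q^2) powi n * (- (q^3)) powi (n * (n - 1) div 2))"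
  have n3: "norm (- (q^3)) < 1" "- (q^3) \<noteq> 0" using qpow[of 3] by simp_all
  have q2: "q^2 \<noteq> 0" "- (q^2) \<noteq> 0" using q by auto
  have fX: "(f has_sum X) UNIV"
    unfolding f_def X_def by (rule theta_has_sum[OF n3 q2(1)])
  have sg: "(- y) powi k = (-1) powi k * y powi k" for y :: complex and k
    using power_int_mult_distrib[of "-1" y k] by simp
  have fY: "((\<lambda>n. (-1) powi n * f n) has_sum Y) UNIV"
    using theta_has_sum[OF n3 q2(2)] unfolding f_def Y_def sg[of "q^2"] by (simp only: mult.assoc)
  have f_even: "f (2 * n) = (-1) powi n * q powi (6 * n^2 + n)" for n
  proof -
    have "2 * n * (2 * n - 1) div 2 = n * (2 * n - 1)" by simp
    hence "f (2 * n) = (-1) powi (n * (2 * n - 1)) * ((q^2) powi (2 * n) * (q^3) powi (n * (2 * n - 1)))"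
      unfolding f_def sg[of "q^3"] by (simp add: mult_ac)
    also have "(q^2) powi (2 * n) = q powi (2 * (2 * n))" by (metis power_int_mult power_int_numeral)
    also have "(q^3) powi (n * (2 * n - 1)) = q powi (3 * (n * (2 * n - 1)))" by (metis power_int_mult power_int_numeral)
    also have "q powi (2 * (2 * n)) * q powi (3 * (n * (2 * n - 1))) = q powi (6 * n^2 + n)"
      using q by (subst power_int_add[symmetric]) (auto simp: power2_eq_square algebra_simps)
    also have "(-1 :: complex) powi (n * (2 * n - 1)) = (-1) powi n"
      by (cases "even n") simp_all
    finally show ?thesis .
  qed
  have f_odd: "f (2 * n + (-1)) = - (q * ((-1) powi n * q powi (6 * n^2 - 5 * n)))" for n
  proof -
    have "(2 * n + (-1)) * ((2 * n + (-1)) - 1) = 2 * ((2 * n - 1) * (n - 1))" by (simp add: algebra_simps)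
    hence d: "(2 * n + (-1)) * ((2 * n + (-1)) - 1) div 2 = (2 * n - 1) * (n - 1)"
      by (metis nonzero_mult_div_cancel_left zero_neq_numeral)
    have "f (2 * n + (-1)) = (-1) powi ((2 * n - 1) * (n - 1)) * ((q^2) powi (2 * n - 1) * (q^3) powi ((2 * n - 1) * (n - 1)))"
      unfolding f_def d sg[of "q^3"] by (simp add: mult_ac)
    also have "(q^2) powi (2 * n - 1) = q powi (2 * (2 * n - 1))" by (metis power_int_mult power_int_numeral)
    also have "(q^3) powi ((2 * n - 1) * (n - 1)) = q powi (3 * ((2 * n - 1) * (n - 1)))" by (metis power_int_mult power_int_numeral)
    also have "q powi (2 * (2 * n - 1)) * q powi (3 * ((2 * n - 1) * (n - 1))) = q powi (1 + (6 * n^2 - 5 * n))"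
      using q by (subst power_int_add[symmetric]) (auto simp: power2_eq_square algebra_simps)
    also have "q powi (1 + (6 * n^2 - 5 * n)) = q * q powi (6 * n^2 - 5 * n)"
      using q by (subst power_int_add) auto
    also have "(-1 :: complex) powi ((2 * n - 1) * (n - 1)) = - ((-1) powi n)"
      by (cases "even n") simp_all
    finally show ?thesis by simp
  qed
  have "((\<lambda>n. f (2 * n + 0)) has_sum ((X + (-1) powi 0 * Y) / 2)) UNIV"
    by (rule has_sum_parity[OF fX fY])
  moreover have "((\<lambda>n. f (2 * n + 0)) has_sum theta (- (q^7)) (q^12)) UNIV"
    using theta_quadratic_has_sum[OF q, of "-1" 6 1] by (simp add: f_even)
  ultimately have 1: "(X + (-1) powi 0 * Y) / 2 = theta (- (q^7)) (q^12)"
    by (rule has_sum_unique)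
  have "((\<lambda>n. f (2 * n + (-1))) has_sum ((X + (-1) powi (-1) * Y) / 2)) UNIV"
    by (rule has_sum_parity[OF fX fY])
  moreover have "((\<lambda>n. f (2 * n + (-1))) has_sum - (q * theta (- q) (q^12))) UNIV"
    unfolding f_odd using theta_quadratic_has_sum[OF q, of "-1" 6 "-5"]
    by (intro has_sum_uminusI has_sum_cmult_right) simp
  ultimately have 2: "(X + (-1) powi (-1) * Y) / 2 = - (q * theta (- q) (q^12))"
    by (rule has_sum_unique)
  have "phi q + phi3 q = 2 * prod_k * ((X + (-1) powi 0 * Y) / 2)"
    unfolding X'[symmetric] Y'[symmetric] by (simp add: field_simps)
  thus "phi q + phi3 q = 2 * prod_k * theta (- (q^7)) (q^12)" by (simp only: 1)
  have "phi q - phi3 q = 2 * prod_k * - ((X + (-1) powi (-1) * Y) / 2)"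
    unfolding X'[symmetric] Y'[symmetric] by (simp add: field_simps)
  thus "phi q - phi3 q = 2 * q * prod_k * theta (- q) (q^12)" by (simp only: 2) simp
qed

lemma first_product:
  "prod_b q * (phi q + phi3 q) / (2 * euler_prod 4)
    = euler_prod 6 * euler_prod 12 / (euler_prod 3 * euler_prod 8 * (qpoch_inf q (q^12) * qpoch_inf (q^11) (q^12)))"
  unfolding pentagonal_dissection theta_twelve
  using product_relation units_nonzero by (simp add: field_simps)

lemma fourth_product:
  "prod_b q * (phi q - phi3 q) / (2 * euler_prod 4)
    = q * (euler_prod 6 * euler_prod 12 / (euler_prod 3 * euler_prod 8 * (qpoch_inf (q^5) (q^12) * qpoch_inf (q^7) (q^12))))"
  unfolding pentagonal_dissection theta_twelve
  using product_relation units_nonzero q by (simp add: field_simps)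

lemma six_relations:
  "euler_prod 3 = qpoch_inf (q^3) (q^6) * euler_prod 6" "qpoch_inf (q^3) (q^6) * qpoch_inf (- (q^3)) (q^6) * euler_prod 12 = euler_prod 6"
  "qpoch_inf (q^3) (q^6) \<noteq> 0"
proof -
  show "euler_prod 3 = qpoch_inf (q^3) (q^6) * euler_prod 6" using dissect[of 3 3] by simp
  show "qpoch_inf (q^3) (q^6) * qpoch_inf (- (q^3)) (q^6) * euler_prod 12 = euler_prod 6"
    using plus_minus[of 6 3] dissect[of 6 6] by simp
  show "qpoch_inf (q^3) (q^6) \<noteq> 0" using qpow_inf_nonzero by simp
qed

text \<open>The usual eta quotient for \<open>(-y;y^2)\<^sub>\<infinity>\<close>, at \<open>y = q^3\<close>.\<close>

lemma minus_cube: "qpoch_inf (- (q^3)) (q^6) = (euler_prod 6)^2 / (euler_prod 3 * euler_prod 12)"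
proof -
  have "qpoch_inf (- (q^3)) (q^6) = (qpoch_inf (q^3) (q^6) * qpoch_inf (- (q^3)) (q^6) * euler_prod 12) * euler_prod 6 / (qpoch_inf (q^3) (q^6) * euler_prod 6 * euler_prod 12)"
    using six_relations(3) units_nonzero by (simp add: field_simps)
  thus ?thesis unfolding six_relations(2) six_relations(1)[symmetric] by (simp add: power2_eq_square)
qed

lemma second_product:
  "prod_b q * theta q (q^6) / euler_prod 4 = euler_prod 12 / (euler_prod 8 * units)"
proof -
  have l: "norm (q^6) < norm q" using q power_strict_decreasing[of 1 6 "norm q"] by (simp add: norm_power)
  have d: "- (q^6) / q = - (q^5)" using q by (simp add: eval_nat_numeral)
  have C: "theta q (q^6) = qpoch_inf (- q) (q^6) * qpoch_inf (- (q^5)) (q^6) * euler_prod 6"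
    using jacobi_triple_product[OF qpow(1)[of 6] qpow(2)[of 6] l] by (simp only: d zero_less_numeral)
  have p: "(q^2)^3 = q^6" "- q * q^2 = - (q^3)" "- q * (q^2)^2 = - (q^5)"
    by (simp_all add: eval_nat_numeral)
  have "prod_k = qpoch_inf (- q) (q^6) * qpoch_inf (- (q^3)) (q^6) * qpoch_inf (- (q^5)) (q^6)"
    using qpoch_inf_dissect3[OF qpow(1)[of 2], of "- q"] by (simp only: p zero_less_numeral)
  hence "theta q (q^6) * qpoch_inf (- (q^3)) (q^6) = prod_k * euler_prod 6" unfolding C by (simp only: mult_ac)
  hence 1: "theta q (q^6) = prod_k * euler_prod 3 * euler_prod 12 / euler_prod 6"
    unfolding minus_cube using units_nonzero by (simp add: field_simps power2_eq_square)
  show ?thesis unfolding 1 using product_relation units_nonzero by (simp add: field_simps)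
qed

lemma third_product:
  "prod_c q * phi3 q / euler_prod 4
    = euler_prod 6^5 * euler_prod 8 / (euler_prod 3^2 * euler_prod 4^2 * euler_prod 12^2)"
proof -
  have "(q^3)^2 = q^6" by simp
  hence 1: "phi3 q = ((euler_prod 6)^2 / (euler_prod 3 * euler_prod 12))^2 * euler_prod 6"
    using theta_square_product[OF qpow(1)[of 3] qpow(2)[of 3]] by (simp add: minus_cube)
  have "euler_prod 4 * prod_c q = euler_prod 8" using plus_minus[of 4 4] by simp
  hence 2: "prod_c q = euler_prod 8 / euler_prod 4" using units_nonzero by (simp add: field_simps)
  show ?thesis unfolding 1 2 using units_nonzero by (simp add: field_simps eval_nat_numeral)
qed

end

section \<open>The four identities\<close>

lemma summand_has_sum_at_zero:
  assumes "e 0 0 0 = 0" "\<And>m k n. (m, k, n) \<noteq> (0, 0, 0) \<Longrightarrow> e m k n \<noteq> 0"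
  shows "((\<lambda>(m, k, n). summand 0 (e m k n) m k n) has_sum 1) UNIV"
proof (rule has_sum_finite_neutralI[of "{(0, 0, 0)}"])
  fix u :: "nat \<times> nat \<times> nat" assume u: "u \<in> UNIV - {(0, 0, 0)}"
  obtain m k n where mkn: "u = (m, k, n)" by (cases u)
  hence "e m k n \<noteq> 0" using u assms(2) by auto
  thus "(case u of (m, k, n) \<Rightarrow> summand 0 (e m k n) m k n) = 0" by (simp add: mkn summand_def)
qed (simp_all add: summand_def assms(1))

text \<open>Only the first square involves the index that is extended to all integers.\<close>

lemma quad_form_squares: "quad_form m k n = (2 * int m + int k)^2 + (int k)^2 + (int n - int k)^2"
  by (simp add: quad_form_def power2_eq_square algebra_simps)

theorem theorem1p3:
  fixes q :: complex
  assumes "norm q < 1"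
  shows
    "((\<lambda>(n1, n2, n3). summand q (quad_form n1 n2 n3) n1 n2 n3) has_sum
        (qpoch_inf (q^6) (q^6) * qpoch_inf (q^12) (q^12) /
         (qpoch_inf (q^3) (q^3) * qpoch_inf (q^8) (q^8) * qpochs_inf [q, q^11] (q^12)))) UNIV \<and>
     ((\<lambda>(n1, n2, n3). summand q (quad_form n1 n2 n3 - 2 * int n2 + 2 * int n3) n1 n2 n3) has_sum
        (qpoch_inf (q^12) (q^12) /
         (qpoch_inf (q^8) (q^8) * qpochs_inf [q, q^11] (q^12) * qpochs_inf [q^5, q^7] (q^12)))) UNIV \<and>
     ((\<lambda>(n1, n2, n3). summand q (quad_form n1 n2 n3 + 2 * int n3) n1 n2 n3) has_sum
        (qpoch_inf (q^6) (q^6) ^ 5 * qpoch_inf (q^8) (q^8) /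
         (qpoch_inf (q^3) (q^3) ^ 2 * qpoch_inf (q^4) (q^4) ^ 2 * qpoch_inf (q^12) (q^12) ^ 2))) UNIV \<and>
     ((\<lambda>(n1, n2, n3). summand q (quad_form n1 n2 n3 + 4 * int n1 + 2 * int n2 + 2 * int n3) n1 n2 n3) has_sum
        (qpoch_inf (q^6) (q^6) * qpoch_inf (q^12) (q^12) /
         (qpoch_inf (q^3) (q^3) * qpoch_inf (q^8) (q^8) * qpochs_inf [q^5, q^7] (q^12)))) UNIV"
proof (cases "q = 0")
  case True
  have nz: "quad_form m k n + 2 * int n \<noteq> 0" "quad_form m k n \<noteq> 0"
     "quad_form m k n + 4 * int m + 2 * int k + 2 * int n \<noteq> 0" "quad_form m k n - 2 * int k + 2 * int n \<noteq> 0"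
    if "(m, k, n) \<noteq> (0, 0, 0)" for m k n
  proof -
    have a: "m = 0 \<and> k = 0 \<and> n = 0" if "quad_form m k n \<le> 0"
    proof -
      have "(2 * int m + int k)^2 = 0" "(int k)^2 = 0" "(int n - int k)^2 = 0"
        using that zero_le_power2[of "2 * int m + int k"] zero_le_power2[of "int k"] zero_le_power2[of "int n - int k"]
        unfolding quad_form_squares by linarith+
      thus ?thesis by auto
    qed
    show "quad_form m k n + 2 * int n \<noteq> 0" "quad_form m k n \<noteq> 0" "quad_form m k n + 4 * int m + 2 * int k + 2 * int n \<noteq> 0"
      using a \<open>(m, k, n) \<noteq> (0, 0, 0)\<close> by force+
    show "quad_form m k n - 2 * int k + 2 * int n \<noteq> 0"
    proof
      assume z: "quad_form m k n - 2 * int k + 2 * int n = 0"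
      have e: "quad_form m k n - 2 * int k + 2 * int n = (2 * int m + int k)^2 + (int k)^2 + (int k - int n - 1)^2 - 1"
        unfolding quad_form_squares by (simp add: power2_eq_square algebra_simps)
      have k: "int k * int k \<le> (2 * int m + int k)^2"
        unfolding power2_eq_square by (intro mult_mono) auto
      (* otherwise the first two squares contribute at least 2, which outweighs the -1 *)
      have "k = 0"
      proof (rule ccontr)
        assume "k \<noteq> 0"
        hence "1 * 1 \<le> int k * int k" by (intro mult_mono) auto
        moreover have "(int k)^2 = int k * int k" by (simp add: power2_eq_square)
        ultimately show False using z e k zero_le_power2[of "int k - int n - 1"] by linarith
      qed
      with z e have "(2 * int m)^2 + ((int n)^2 + 2 * int n) = 0"
        by (simp add: power2_eq_square algebra_simps)
      moreover have "(2 * int m)^2 \<ge> 0" "(int n)^2 \<ge> 0" by simp_all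
      ultimately have "int n = 0" "(2 * int m)^2 = 0" by linarith+
      with \<open>k = 0\<close> \<open>(m, k, n) \<noteq> (0, 0, 0)\<close> show False by simp
    qed
  qed
  have z: "quad_form 0 0 0 = 0" by (simp add: quad_form_def)
  have "((\<lambda>(m, k, n). summand 0 (quad_form m k n) m k n) has_sum 1) UNIV"
    "((\<lambda>(m, k, n). summand 0 (quad_form m k n - 2 * int k + 2 * int n) m k n) has_sum 1) UNIV"
    "((\<lambda>(m, k, n). summand 0 (quad_form m k n + 2 * int n) m k n) has_sum 1) UNIV"
    "((\<lambda>(m, k, n). summand 0 (quad_form m k n + 4 * int m + 2 * int k + 2 * int n) m k n) has_sum 1) UNIV"
    by (rule summand_has_sum_at_zero; use nz z in simp)+
  thus ?thesis unfolding True by (simp add: qpochs_inf_def)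
next
  case False
  note q = assms False
  have Ss: "summand q e m k n = q powi e / (poch4 q m * poch4 q k * poch4 q n)" for e m k n
    by (simp add: summand_def)
  have S1: "((\<lambda>(m, k, n). summand q (quad_form m k n) m k n) has_sum
      (prod_b q * (phi q + phi3 q) / (2 * prod_p q))) UNIV"
    using nahm_sum_reduction[OF q, of 0 0 0] first_theta_form[OF q]
    unfolding Ss quad_form_squares by simp
  have S2: "((\<lambda>(m, k, n). summand q (quad_form m k n - 2 * int k + 2 * int n) m k n) has_sum
      (prod_b q * theta q (q^6) / prod_p q)) UNIV"
    using nahm_sum_reduction[OF q, of "-2" 2 0] second_theta_form[OF q]
    unfolding Ss quad_form_squares by simp
  have S3: "((\<lambda>(m, k, n). summand q (quad_form m k n + 2 * int n) m k n) has_sum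
      (prod_c q * phi3 q / prod_p q)) UNIV"
    using nahm_sum_reduction[OF q, of 0 2 0] third_theta_form[OF q]
    unfolding Ss quad_form_squares by simp
  have "((\<lambda>(m, k, n). q powi ((2 * int m + int k + 1)^2 + (int k)^2 + (int n - int k)^2 + 0 * int k + 2 * int n)
       / (poch4 q m * poch4 q k * poch4 q n)) has_sum
      (prod_b q * (phi q - phi3 q) / (2 * prod_p q))) UNIV"
    using nahm_sum_reduction[OF q, of 0 2 1] fourth_theta_form[OF q] by simp
  also have "(\<lambda>(m, k, n). q powi ((2 * int m + int k + 1)^2 + (int k)^2 + (int n - int k)^2 + 0 * int k + 2 * int n)
       / (poch4 q m * poch4 q k * poch4 q n))
     = (\<lambda>u. q * (case u of (m, k, n) \<Rightarrow> summand q (quad_form m k n + 4 * int m + 2 * int k + 2 * int n) m k n))"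
  proof (rule ext)
    fix u :: "nat \<times> nat \<times> nat"
    obtain m k n where u: "u = (m, k, n)" by (cases u)
    have "(2 * int m + int k + 1)^2 + (int k)^2 + (int n - int k)^2 + 0 * int k + 2 * int n
       = 1 + (quad_form m k n + 4 * int m + 2 * int k + 2 * int n)"
      unfolding quad_form_squares by (simp add: power2_eq_square algebra_simps)
    hence "q powi ((2 * int m + int k + 1)^2 + (int k)^2 + (int n - int k)^2 + 0 * int k + 2 * int n)
       = q * q powi (quad_form m k n + 4 * int m + 2 * int k + 2 * int n)"
      using q(2) by (simp only: power_int_add power_int_1_right simp_thms)
    thus "(case u of (m, k, n) \<Rightarrow> q powi ((2 * int m + int k + 1)^2 + (int k)^2 + (int n - int k)^2 + 0 * int k + 2 * int n)
       / (poch4 q m * poch4 q k * poch4 q n))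
     = q * (case u of (m, k, n) \<Rightarrow> summand q (quad_form m k n + 4 * int m + 2 * int k + 2 * int n) m k n)"
      by (simp add: u Ss)
  qed
  finally have S4: "((\<lambda>u. q * (case u of (m, k, n) \<Rightarrow> summand q (quad_form m k n + 4 * int m + 2 * int k + 2 * int n) m k n)) has_sum
      (prod_b q * (phi q - phi3 q) / (2 * prod_p q))) UNIV" .
  have S4': "((\<lambda>(m, k, n). summand q (quad_form m k n + 4 * int m + 2 * int k + 2 * int n) m k n) has_sum
      (qpoch_inf (q^6) (q^6) * qpoch_inf (q^12) (q^12) /
         (qpoch_inf (q^3) (q^3) * qpoch_inf (q^8) (q^8) * (qpoch_inf (q^5) (q^12) * qpoch_inf (q^7) (q^12))))) UNIV"
    using S4 unfolding fourth_product[OF q] by (subst (asm) has_sum_cmult_right_iff) (use q in simp_all)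
  show ?thesis
    using S1 S2 S3 S4' unfolding first_product[OF q] second_product[OF q] third_product[OF q]
    by (simp add: qpochs_inf_def mult.assoc)
qed

end
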